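(* Let $n\ge 2$ and let $(\mathbb S^n,\mathcal F)$ be an isoparametric foliation of the round unit sphere with $g$ distinct principal curvatures. Then its radial spectrum is $$\mathrm{Spec}(\mathbb S^n,\mathcal F)=\{gk(gk+n-1):k\in\mathbb N\}.$$
   Context: $\mathbb N$ includes $0$. $\mathbb S^n\subset\mathbb R^{n+1}$ is the unit sphere with its round metric, and $\Delta=-\mathrm{div}\,\nabla$ is its positive Laplacian. An isoparametric function on $\mathbb S^n$ is a smooth function $F:\mathbb S^n\to[a,b]$ with $F(\mathbb S^n)=[a,b]$, $a<b$, such that $|\nabla F|^2=A\circ F$ and $\Delta F=B\circ F$ for some smooth functions $A,B:[a,b]\to\mathbb R$. The sets $M^+:=F^{-1}(a)$ and $M^-:=F^{-1}(b)$ are smooth closed submanifolds, called the focal sets; $F$ is called proper if both focal sets have codimension at least $2$. All isoparametric functions are assumed proper. The isoparametric foliation $\mathcal F$ is the decomposition of $\mathbb S^n$ into level sets of $F$. Every regular level set $F^{-1}(t)$, $t\in(a,b)$, is a connected hypersurface with constant principal curvatures, and the number $g$ of distinct principal curvatures is the same for all regular level sets; this is the number $g$ of distinct principal curvatures of $\mathcal F$. Let $\rho(x)=\mathrm{dist}(x,M^+)$ and $D(\mathcal F)=\mathrm{dist}(M^+,M^-)$. A function $f$ on $\mathbb S^n$ is radial if $f=\psi\circ\rho$ for some $\psi:[0,D(\mathcal F)]\to\mathbb R$. An eigenvalue $\lambda$ of $\Delta$ is radial if there is a (nonzero) radial eigenfunction associated to $\lambda$; the radial spectrum $\mathrm{Spec}(\mathbb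 S^n,\mathcal F)$ is the set of radial eigenvalues. *)

theory Defs
  imports "HOL-Analysis.Analysis"
begin

(* C^k maps on an open set U of a finite-dimensional space: k-fold iterated directional
   derivatives exist and are continuous.  Only meaningful for open U. *)
primrec Ck_open :: "nat \<Rightarrow> 'a::euclidean_space set \<Rightarrow> ('a \<Rightarrow> 'b::euclidean_space) \<Rightarrow> bool" where
  "Ck_open 0 U f \<longleftrightarrow> continuous_on U f"
| "Ck_open (Suc k) U f \<longleftrightarrow> f differentiable_on U \<and>
     (\<forall>v. Ck_open k U (\<lambda>x. frechet_derivative f (at x) v))"

definition smooth_open :: "'a::euclidean_space set \<Rightarrow> ('a \<Rightarrow> 'b::euclidean_space) \<Rightarrow> bool" where
  "smooth_open U f \<longleftrightarrow> open U \<and> (\<forall>k. Ck_open k U f)"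

(* Smoothness on an arbitrary subset: f is locally the restriction of a smooth map on an open
   set.  It is used both on the unit sphere and on compact intervals. *)
definition smooth :: "'a::euclidean_space set \<Rightarrow> ('a \<Rightarrow> 'b::euclidean_space) \<Rightarrow> bool" where
  "smooth S f \<longleftrightarrow>
     (\<forall>x\<in>S. \<exists>U h. x \<in> U \<and> smooth_open U h \<and> (\<forall>y\<in>S \<inter> U. f y = h y))"

(* M is near its point x an embedded d-dimensional submanifold: some diffeomorphism between
   open sets of the ambient space straightens M to a d-dimensional linear subspace. *)
definition submanifold_at :: "nat \<Rightarrow> 'a::euclidean_space set \<Rightarrow> 'a \<Rightarrow> bool" where
  "submanifold_at d M x \<longleftrightarrow>
     (\<exists>U V L (\<phi> :: 'a \<Rightarrow> 'a) (\<psi> :: 'a \<Rightarrow> 'a). x \<in> U \<and>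
        smooth_open U \<phi> \<and> smooth_open V \<psi> \<and> homeomorphism U V \<phi> \<psi> \<and>
        subspace L \<and> dim L = d \<and> \<phi> ` (M \<inter> U) = V \<inter> L)"

abbreviation usphere :: "'a::euclidean_space set" where
  "usphere \<equiv> sphere 0 1"

(* Tangent space of the unit sphere at x, and the orthogonal projection onto it (for norm x = 1). *)
definition tangent :: "'a::euclidean_space \<Rightarrow> 'a set" where
  "tangent x = {v. x \<bullet> v = 0}"

definition tproj :: "'a::euclidean_space \<Rightarrow> 'a \<Rightarrow> 'a" where
  "tproj x v = v - (x \<bullet> v) *\<^sub>R x"

(* Differential of a map on the unit sphere.  The derivative within the sphere depends only on
   the values on the sphere; as a linear map it is arbitrary in the normal direction, but its
   restriction to the tangent space is unique, and below it is applied to tangent vectors only. *)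
definition sdiff :: "('a::euclidean_space \<Rightarrow> 'b::euclidean_space) \<Rightarrow> 'a \<Rightarrow> 'a \<Rightarrow> 'b" where
  "sdiff f x = frechet_derivative f (at x within usphere)"

definition sgrad :: "('a::euclidean_space \<Rightarrow> real) \<Rightarrow> 'a \<Rightarrow> 'a" where
  "sgrad f x = (THE v. v \<in> tangent x \<and> (\<forall>w\<in>tangent x. v \<bullet> w = sdiff f x w))"

(* Levi-Civita connection of the round metric: tangential part of the ambient derivative. *)
definition covd :: "('a::euclidean_space \<Rightarrow> 'a) \<Rightarrow> 'a \<Rightarrow> 'a \<Rightarrow> 'a" where
  "covd X x v = tproj x (sdiff X x v)"

(* Trace of v |-> covd X x v on the tangent space, computed in the ambient standard basis after
   precomposing with the projection, which adds only a zero in the normal direction. *)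
definition sdiv :: "('a::euclidean_space \<Rightarrow> 'a) \<Rightarrow> 'a \<Rightarrow> real" where
  "sdiv X x = (\<Sum>e\<in>Basis. e \<bullet> covd X x (tproj x e))"

definition laplacian :: "('a::euclidean_space \<Rightarrow> real) \<Rightarrow> 'a \<Rightarrow> real" where
  "laplacian f x = - sdiv (sgrad f) x"

definition level_set :: "('a::euclidean_space \<Rightarrow> real) \<Rightarrow> real \<Rightarrow> 'a set" where
  "level_set F t = {x \<in> usphere. F x = t}"

definition isoparametric :: "real \<Rightarrow> real \<Rightarrow> ('a::euclidean_space \<Rightarrow> real) \<Rightarrow> bool" where
  "isoparametric a b F \<longleftrightarrow> a < b \<and> smooth usphere F \<and> F ` usphere = {a..b} \<and>
     (\<exists>A B :: real \<Rightarrow> real. smooth {a..b} A \<and> smooth {a..b} B \<and>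
        (\<forall>x\<in>usphere. (norm (sgrad F x))\<^sup>2 = A (F x) \<and> laplacian F x = B (F x)))"

(* The sphere has dimension DIM('a) - 1, so a submanifold of dimension d has codimension
   at least 2 in it iff d + 2 \<le> DIM('a) - 1.  Components may differ in dimension. *)
definition codim_ge_2 :: "'a::euclidean_space set \<Rightarrow> bool" where
  "codim_ge_2 M \<longleftrightarrow> (\<forall>x\<in>M. \<exists>d. submanifold_at d M x \<and> d + 2 \<le> DIM('a) - 1)"

definition proper_isoparametric :: "real \<Rightarrow> real \<Rightarrow> ('a::euclidean_space \<Rightarrow> real) \<Rightarrow> bool" where
  "proper_isoparametric a b F \<longleftrightarrow> isoparametric a b F \<and>
     codim_ge_2 (level_set F a) \<and> codim_ge_2 (level_set F b)"

definition unit_normal :: "('a::euclidean_space \<Rightarrow> real) \<Rightarrow> 'a \<Rightarrow> 'a" where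
  "unit_normal F x = sgrad F x /\<^sub>R norm (sgrad F x)"

(* Principal curvatures at x of the level set of F through x, as a hypersurface of the sphere:
   eigenvalues of the shape operator v |-> - covd (unit_normal F) x v on its tangent space. *)
definition principal_curvatures :: "('a::euclidean_space \<Rightarrow> real) \<Rightarrow> 'a \<Rightarrow> real set" where
  "principal_curvatures F x =
     {\<kappa>. \<exists>v. v \<in> tangent x \<and> v \<bullet> unit_normal F x = 0 \<and> v \<noteq> 0 \<and>
          - covd (unit_normal F) x v = \<kappa> *\<^sub>R v}"

definition num_principal_curvatures ::
    "real \<Rightarrow> real \<Rightarrow> ('a::euclidean_space \<Rightarrow> real) \<Rightarrow> nat \<Rightarrow> bool" where
  "num_principal_curvatures a b F g \<longleftrightarrow>
     (\<forall>t\<in>{a<..<b}. \<forall>x\<in>level_set F t.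
        finite (principal_curvatures F x) \<and> card (principal_curvatures F x) = g)"

(* Geodesic (great-circle) distance of the round unit sphere. *)
definition sdist :: "'a::euclidean_space \<Rightarrow> 'a \<Rightarrow> real" where
  "sdist x y = arccos (x \<bullet> y)"

definition sdist_set :: "'a::euclidean_space \<Rightarrow> 'a set \<Rightarrow> real" where
  "sdist_set x M = (INF y\<in>M. sdist x y)"

(* F takes its minimum a on the focal set from which the distance is measured. *)
definition radial :: "real \<Rightarrow> ('a::euclidean_space \<Rightarrow> real) \<Rightarrow> ('a \<Rightarrow> real) \<Rightarrow> bool" where
  "radial a F f \<longleftrightarrow>
     (\<exists>\<psi> :: real \<Rightarrow> real. \<forall>x\<in>usphere. f x = \<psi> (sdist_set x (level_set F a)))"

definition eigenfunction :: "real \<Rightarrow> ('a::euclidean_space \<Rightarrow> real) \<Rightarrow> bool" where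
  "eigenfunction \<mu> f \<longleftrightarrow> smooth usphere f \<and> (\<exists>x\<in>usphere. f x \<noteq> 0) \<and>
     (\<forall>x\<in>usphere. laplacian f x = \<mu> * f x)"

definition radial_spectrum :: "real \<Rightarrow> ('a::euclidean_space \<Rightarrow> real) \<Rightarrow> real set" where
  "radial_spectrum a F = {\<mu>. \<exists>f. eigenfunction \<mu> f \<and> radial a F f}"

end

theory Submission
  imports Defs "HOL-Complex_Analysis.Complex_Analysis"
begin

text \<open>
  The level sets of \<open>F\<close> are parallel to each other. Along the great circle that leaves a level set
  in the normal direction, \<open>F\<close> increases from \<open>a\<close> to \<open>b\<close> within a time \<open>D\<close> that does not depend on
  the circle. Hence radial functions are the functions of \<open>v = dist(x, M\<^sup>+) \<in> [0, D]\<close>, and on them the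
  Laplacian is \<open>- (\<psi>'' + h \<psi>')\<close>, where \<open>h(v)\<close> is the sum of the principal curvatures of the level
  set at distance \<open>v\<close>, up to sign. The theorem holds because \<open>h\<close> can be computed.

  First, \<open>h\<close> is a sum of cotangents. The unit normal field transports itself along normal great
  circles, and differentiating this relation in a principal direction yields the shape operator of
  every level set met by the circle (\<open>shape_operator_flow\<close>). The outcome is
  \<open>h(v) = \<Sum>\<^sub>i cot(v - z\<^sub>i)\<close> with \<open>n - 1\<close> constants \<open>z\<^sub>i\<close>, which fall into \<open>g\<close> classes modulo \<open>\<pi>\<close>
  (\<open>mean_curvature_cotangents\<close>). Modulo \<open>\<pi>\<close> no \<open>z\<^sub>i\<close> lies in \<open>(0, D)\<close>, but \<open>0\<close> and \<open>D\<close> both occur: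
  otherwise moving each point to the focal set along its normal circle would have rank \<open>n - 1\<close>,
  against codimension at least \<open>2\<close> (\<open>focal_point_exists\<close>).

  Second, \<open>h\<close> is odd about \<open>0\<close> and about \<open>D\<close> (\<open>focal_reflection\<close>). As a function of \<open>v\<close> the value
  \<open>F\<close> solves \<open>F'' = A'(F)/2\<close> with \<open>F'(0) = 0\<close>, so it has a smooth even extension, and then so has
  \<open>h F' = - B(F) - A'(F)/2\<close>. This forces the even part of the meromorphic function \<open>h\<close> to vanish to
  infinite order at \<open>0\<close>. The poles of \<open>h\<close> are therefore the lattice \<open>D\<int>\<close>, which gives \<open>D = \<pi>/g\<close>, with
  residues that alternate between two values (\<open>focal_lattice\<close>), and the sum collapses to
  \<open>sin(g v) h(v) = \<alpha> + (n - 1) cos(g v)\<close> (\<open>focal_structure\<close>).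

  Finally put \<open>w = cos(g v)\<close>. On polynomials in \<open>w\<close> the Laplacian becomes a triangular operator with
  diagonal entries \<open>gk(gk + n - 1)\<close>, so each of these numbers has an eigenpolynomial. It is smooth
  across the focal sets because \<open>w\<close>, as a function of the value of \<open>F\<close>, solves a linear system that
  is regular at \<open>a\<close> and \<open>b\<close> (\<open>cosV_structure\<close>). Conversely, let \<open>f\<close> be a radial eigenfunction whose
  eigenvalue is not in the list. With the weight \<open>P(v) = \<Prod>\<^sub>i sin(v - z\<^sub>i)\<close>, which satisfies \<open>P' = h P\<close>
  and vanishes at both ends, integration by parts shows that \<open>f\<close> is orthogonal to all polynomials
  in \<open>w\<close>, hence zero (\<open>radial_eigenvalue_form\<close>).
\<close>

section \<open>Iterated derivatives within a set\<close>

text \<open>On an open set this is \<^const>\<open>Ck_open\<close>. Taking derivatives within the set makes it meaningful on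
closed intervals as well, where it means smoothness up to the end points. Functions of the value of
\<open>F\<close> live on such an interval, and composing them with \<open>F\<close> needs no extension beyond it.\<close>

primrec Ck_on :: "nat \<Rightarrow> 'a::euclidean_space set \<Rightarrow> ('a \<Rightarrow> 'b::euclidean_space) \<Rightarrow> bool" where
  "Ck_on 0 S f \<longleftrightarrow> continuous_on S f"
| "Ck_on (Suc k) S f \<longleftrightarrow>
     (\<exists>f'. (\<forall>x\<in>S. (f has_derivative f' x) (at x within S)) \<and> (\<forall>v. Ck_on k S (\<lambda>x. f' x v)))"

lemma Ck_on_cong:
  assumes "\<And>x. x \<in> S \<Longrightarrow> f x = g x"
  shows "Ck_on k S f \<longleftrightarrow> Ck_on k S g"
proof (cases k)
  case 0
  then show ?thesis using assms by (simp cong: continuous_on_cong)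
next
  case (Suc k)
  have "(f has_derivative f') (at x within S) \<longleftrightarrow> (g has_derivative f') (at x within S)"
    if "x \<in> S" for x f'
    using that assms has_derivative_transform by metis
  then show ?thesis by (auto simp: Suc)
qed

lemma Ck_on_continuous: "Ck_on k S f \<Longrightarrow> continuous_on S f"
  by (cases k) (auto simp: continuous_on_eq_continuous_within intro: has_derivative_continuous)

lemma Ck_on_SucD: "Ck_on (Suc k) S f \<Longrightarrow> Ck_on k S f"
proof (induction k arbitrary: f)
  case 0
  show ?case using Ck_on_continuous[OF 0] by simp
next
  case (Suc k)
  then show ?case
    by (subst Ck_on.simps, subst (asm) Ck_on.simps) blast
qed

lemma Ck_on_subset:
  assumes "Ck_on k S f" "T \<subseteq> S"
  shows "Ck_on k T f"
  using assms
proof (induction k arbitrary: f)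
  case 0
  then show ?case by (auto intro: continuous_on_subset)
next
  case (Suc k)
  then show ?case by (auto 4 4 intro: has_derivative_subset)
qed

lemma Ck_on_const [simp]: "Ck_on k S (\<lambda>x. c)"
proof (induction k arbitrary: c)
  case (Suc k)
  show ?case by (auto simp: Suc intro!: exI[of _ "\<lambda>x v. 0"])
qed simp

lemma Ck_on_linear:
  assumes "bounded_linear L"
  shows "Ck_on k S L"
proof (cases k)
  case 0
  then show ?thesis using assms by (simp add: linear_continuous_on)
next
  case (Suc m)
  then show ?thesis
    using bounded_linear_imp_has_derivative[OF assms] by (auto intro!: exI[of _ "\<lambda>x. L"])
qed

lemma Ck_on_linear_compose:
  assumes "bounded_linear L" "Ck_on k S f"
  shows "Ck_on k S (\<lambda>x. L (f x))"
  using assms(2)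
proof (induction k arbitrary: f)
  case 0
  then show ?case
    using assms(1) by (auto intro: bounded_linear.continuous_on)
next
  case (Suc k)
  then obtain f' where "\<forall>x\<in>S. (f has_derivative f' x) (at x within S)" "\<forall>v. Ck_on k S (\<lambda>x. f' x v)"
    by auto
  then show ?case
    using Suc.IH
    by (auto intro!: exI[of _ "\<lambda>x v. L (f' x v)"] bounded_linear.has_derivative[OF assms(1)])
qed

lemma Ck_on_add:
  assumes "Ck_on k S f" "Ck_on k S g"
  shows "Ck_on k S (\<lambda>x. f x + g x)"
  using assms
proof (induction k arbitrary: f g)
  case 0
  then show ?case by (auto intro: continuous_intros)
next
  case (Suc k)
  then obtain f' g' where "\<forall>x\<in>S. (f has_derivative f' x) (at x within S)" "\<forall>v. Ck_on k S (\<lambda>x. f' x v)"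
    "\<forall>x\<in>S. (g has_derivative g' x) (at x within S)" "\<forall>v. Ck_on k S (\<lambda>x. g' x v)"
    by auto
  then show ?case
    using Suc.IH
    by (auto intro!: exI[of _ "\<lambda>x v. f' x v + g' x v"] has_derivative_add)
qed

lemma Ck_on_sum:
  assumes "\<And>i. i \<in> I \<Longrightarrow> Ck_on k S (f i)"
  shows "Ck_on k S (\<lambda>x. \<Sum>i\<in>I. f i x)"
  using assms by (induction I rule: infinite_finite_induct) (auto intro: Ck_on_add)

lemma Ck_on_scaleR:
  fixes f :: "'a::euclidean_space \<Rightarrow> real"
  assumes "Ck_on k S f" "Ck_on k S g"
  shows "Ck_on k S (\<lambda>x. f x *\<^sub>R g x)"
  using assms
proof (induction k arbitrary: f g)
  case 0
  then show ?case by (auto intro: continuous_intros)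
next
  case (Suc k)
  then obtain f' g' where "\<forall>x\<in>S. (f has_derivative f' x) (at x within S)" "\<forall>v. Ck_on k S (\<lambda>x. f' x v)"
    "\<forall>x\<in>S. (g has_derivative g' x) (at x within S)" "\<forall>v. Ck_on k S (\<lambda>x. g' x v)"
    by auto
  moreover have "Ck_on k S f" "Ck_on k S g"
    using Suc.prems by (auto intro: Ck_on_SucD simp del: Ck_on.simps)
  ultimately show ?case
    using Suc.IH
    by (auto intro!: exI[of _ "\<lambda>x v. f x *\<^sub>R g' x v + f' x v *\<^sub>R g x"] has_derivative_scaleR
        Ck_on_add)
qed

lemma Ck_on_mult:
  fixes f g :: "'a::euclidean_space \<Rightarrow> real"
  assumes "Ck_on k S f" "Ck_on k S g"
  shows "Ck_on k S (\<lambda>x. f x * g x)"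
  using Ck_on_scaleR[OF assms] by simp

lemma Ck_on_minus: "Ck_on k S f \<Longrightarrow> Ck_on k S (\<lambda>x. - f x)"
  by (rule Ck_on_linear_compose[OF bounded_linear_minus[OF bounded_linear_ident]])

lemma Ck_on_diff: "Ck_on k S f \<Longrightarrow> Ck_on k S g \<Longrightarrow> Ck_on k S (\<lambda>x. f x - g x)"
  using Ck_on_add[OF _ Ck_on_minus] by fastforce

text \<open>In coordinates the derivative of \<open>g \<circ> f\<close> is a sum of products of derivatives of \<open>f\<close> with partial
derivatives of \<open>g\<close> composed with \<open>f\<close>, to which the induction hypothesis applies.\<close>

lemma Ck_on_compose:
  fixes f :: "'a::euclidean_space \<Rightarrow> 'b::euclidean_space" and g :: "'b \<Rightarrow> 'c::euclidean_space"
  assumes "Ck_on k T g" "Ck_on k S f" "f ` S \<subseteq> T"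
  shows "Ck_on k S (\<lambda>x. g (f x))"
  using assms(1,2)
proof (induction k arbitrary: g)
  case 0
  then show ?case using assms(3) by (auto intro: continuous_on_compose2)
next
  case (Suc k)
  then obtain f' g' where f': "\<forall>x\<in>S. (f has_derivative f' x) (at x within S)" "\<forall>v. Ck_on k S (\<lambda>x. f' x v)"
    and g': "\<forall>x\<in>T. (g has_derivative g' x) (at x within T)" "\<forall>v. Ck_on k T (\<lambda>x. g' x v)"
    by auto
  have fk: "Ck_on k S f"
    using Suc.prems by (auto intro: Ck_on_SucD simp del: Ck_on.simps)
  have "((\<lambda>x. g (f x)) has_derivative (\<lambda>v. g' (f x) (f' x v))) (at x within S)" if "x \<in> S" for x
    by (rule has_derivative_in_compose2[where t = T]) (use that f' g' assms(3) in blast)+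
  moreover have "Ck_on k S (\<lambda>x. g' (f x) (f' x v))" for v
  proof -
    have "Ck_on k S (\<lambda>x. \<Sum>i\<in>Basis. (f' x v \<bullet> i) *\<^sub>R g' (f x) i)"
      using Suc.IH[OF _ fk] g' f'(2)
      by (auto intro!: Ck_on_sum Ck_on_scaleR Ck_on_linear_compose[OF bounded_linear_inner_left])
    moreover have "g' (f x) (f' x v) = (\<Sum>i\<in>Basis. (f' x v \<bullet> i) *\<^sub>R g' (f x) i)" if "x \<in> S" for x
    proof -
      have "linear (g' (f x))"
        using g' that assms(3) has_derivative_linear by blast
      then have "g' (f x) (\<Sum>i\<in>Basis. (f' x v \<bullet> i) *\<^sub>R i) = (\<Sum>i\<in>Basis. (f' x v \<bullet> i) *\<^sub>R g' (f x) i)"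
        by (simp add: linear_sum linear_cmul)
      then show ?thesis by (simp add: euclidean_representation)
    qed
    ultimately show ?thesis by (subst Ck_on_cong) auto
  qed
  ultimately show ?case by (auto intro!: exI[of _ "\<lambda>x v. g' (f x) (f' x v)"])
qed

lemma Ck_on_real_Suc:
  fixes f :: "real \<Rightarrow> real"
  assumes "\<And>x. x \<in> S \<Longrightarrow> (f has_real_derivative fd x) (at x within S)" "Ck_on k S fd"
  shows "Ck_on (Suc k) S f"
  using assms
  by (auto simp: has_field_derivative_def intro!: exI[of _ "\<lambda>x v. fd x * v"] Ck_on_mult)

lemma Ck_on_inverse: "Ck_on k (- {0::real}) inverse"
proof (induction k)
  case 0
  show ?case by (auto intro: continuous_intros)
next
  case (Suc k)
  show ?case
    by (rule Ck_on_real_Suc[where fd = "\<lambda>x. - (inverse x * inverse x)"])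
       (auto intro!: derivative_eq_intros Ck_on_minus Ck_on_mult Suc simp: power2_eq_square
         simp del: Ck_on.simps)
qed

lemma Ck_on_sqrt: "Ck_on k {0<..} sqrt"
proof (induction k)
  case 0
  show ?case by (auto intro: continuous_intros)
next
  case (Suc k)
  show ?case
  proof (rule Ck_on_real_Suc)
    show "(sqrt has_real_derivative inverse (sqrt x) * (1/2)) (at x within {0<..})"
      if "x \<in> {0<..}" for x
      using that by (auto intro!: DERIV_subset[OF DERIV_real_sqrt])
    show "Ck_on k {0<..} (\<lambda>x. inverse (sqrt x) * (1 / 2))"
      by (intro Ck_on_mult Ck_on_compose[OF Ck_on_inverse Suc] Ck_on_const) auto
  qed
qed

lemma Ck_on_divide:
  fixes f g :: "'a::euclidean_space \<Rightarrow> real"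
  assumes "Ck_on k S f" "Ck_on k S g" "\<And>x. x \<in> S \<Longrightarrow> g x \<noteq> 0"
  shows "Ck_on k S (\<lambda>x. f x / g x)"
  unfolding divide_inverse
  by (intro Ck_on_mult assms Ck_on_compose[OF Ck_on_inverse]) (use assms in auto)

lemma Ck_on_poly:
  assumes "Ck_on k S f"
  shows "Ck_on k S (\<lambda>x. poly p (f x :: real))"
  by (induction p) (auto intro!: Ck_on_add Ck_on_mult assms)

lemma Ck_on_norm: "Ck_on k (- {0}) (norm :: 'a::euclidean_space \<Rightarrow> real)"
proof -
  have "Ck_on k (- {0}) (\<lambda>x::'a. sqrt (\<Sum>b\<in>Basis. (x \<bullet> b) * (x \<bullet> b)))"
    by (intro Ck_on_compose[OF Ck_on_sqrt] Ck_on_sum Ck_on_mult Ck_on_linear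
        bounded_linear_inner_left) (auto simp flip: euclidean_inner)
  then show ?thesis
    by (simp add: norm_eq_sqrt_inner euclidean_inner[symmetric] cong: Ck_on_cong)
qed

lemma Ck_on_sgn: "Ck_on k (- {0}) (sgn :: 'a::euclidean_space \<Rightarrow> 'a)"
  unfolding sgn_div_norm
  by (intro Ck_on_scaleR Ck_on_compose[OF Ck_on_inverse Ck_on_norm] Ck_on_linear
      bounded_linear_ident) auto

lemma Ck_open_iff_Ck_on:
  assumes "open U"
  shows "Ck_open k U f \<longleftrightarrow> Ck_on k U f"
proof (induction k arbitrary: f)
  case (Suc k)
  show ?case
  proof
    assume "Ck_open (Suc k) U f"
    then show "Ck_on (Suc k) U f"
      using assms Suc
      by (auto intro!: exI[of _ "\<lambda>x. frechet_derivative f (at x)"]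
          simp: differentiable_on_eq_differentiable_at frechet_derivative_works
            at_within_open[OF _ assms])
  next
    assume "Ck_on (Suc k) U f"
    then obtain f' where f': "\<forall>x\<in>U. (f has_derivative f' x) (at x)" "\<forall>v. Ck_on k U (\<lambda>x. f' x v)"
      by (auto simp: at_within_open[OF _ assms])
    then have "frechet_derivative f (at x) = f' x" if "x \<in> U" for x
      using that frechet_derivative_at by metis
    then have "Ck_on k U (\<lambda>x. frechet_derivative f (at x) v)" for v
      using f'(2) by (subst Ck_on_cong[where g = "\<lambda>x. f' x v"]) auto
    then show "Ck_open (Suc k) U f"
      using f' Suc assms
      by (auto simp: differentiable_on_eq_differentiable_at differentiable_def)
  qed
qed simp

lemma Ck_open_local:
  assumes "\<And>x. x \<in> S \<Longrightarrow> \<exists>U. open U \<and> x \<in> U \<and> Ck_open k U f"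
  shows "Ck_open k S f"
  using assms
proof (induction k arbitrary: f)
  case 0
  show ?case
    unfolding Ck_open.simps continuous_on_eq_continuous_within
  proof
    fix x assume "x \<in> S"
    then obtain U where "open U" "x \<in> U" "continuous_on U f" using 0 by auto
    then show "continuous (at x within S) f"
      by (meson continuous_at_imp_continuous_at_within continuous_on_eq_continuous_at)
  qed
next
  case (Suc k)
  have "f differentiable_on S"
    unfolding differentiable_on_def
  proof
    fix x assume "x \<in> S"
    then obtain U where "open U" "x \<in> U" "f differentiable_on U"
      using Suc.prems by (metis Ck_open.simps(2))
    then show "f differentiable at x within S"
      by (meson differentiable_at_withinI differentiable_on_eq_differentiable_at)
  qed
  moreover have "Ck_open k S (\<lambda>x. frechet_derivative f (at x) v)" for v
    by (rule Suc.IH) (use Suc.prems in \<open>metis Ck_open.simps(2)\<close>)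
  ultimately show ?case by simp
qed

text \<open>Derivatives within a nondegenerate interval are unique, so the derivatives of the local smooth
extensions agree on the interval and define one smooth function.\<close>

lemma smooth_interval_deriv:
  fixes A :: "real \<Rightarrow> real"
  assumes "a < b" "smooth {a..b} A"
  shows "\<exists>A1. smooth {a..b} A1 \<and> (\<forall>t\<in>{a..b}. (A has_real_derivative A1 t) (at t within {a..b}))"
proof -
  define A1 where "A1 t = (THE d. (A has_real_derivative d) (at t within {a..b}))" for t
  have key: "(A has_real_derivative A1 t) (at t within {a..b}) \<and> A1 t = frechet_derivative h (at t) 1"
    if t: "t \<in> U" "t \<in> {a..b}" and h: "smooth_open U h" "\<forall>y\<in>{a..b} \<inter> U. A y = h y" for t U h
  proof -
    have U: "open U" "Ck_open 1 U h" using h by (auto simp: smooth_open_def)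
    then have "(h has_derivative frechet_derivative h (at t)) (at t)"
      using t by (auto simp: differentiable_on_eq_differentiable_at frechet_derivative_works)
    moreover have "frechet_derivative h (at t) = (*) (frechet_derivative h (at t) 1)"
    proof
      fix v
      have "linear (frechet_derivative h (at t))"
        using calculation has_derivative_linear by blast
      then have "frechet_derivative h (at t) (v *\<^sub>R 1) = v *\<^sub>R frechet_derivative h (at t) 1"
        by (rule linear_cmul)
      then show "frechet_derivative h (at t) v = frechet_derivative h (at t) 1 * v"
        by (simp add: mult.commute)
    qed
    ultimately have "(h has_real_derivative frechet_derivative h (at t) 1) (at t)"
      unfolding has_field_derivative_def by simp
    then have E: "(h has_real_derivative frechet_derivative h (at t) 1) (at t within {a..b})"
      by (rule DERIV_subset) auto
    obtain d where d: "d > 0" "ball t d \<subseteq> U"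
      using U(1) t(1) open_contains_ball by blast
    have D: "(A has_real_derivative frechet_derivative h (at t) 1) (at t within {a..b})"
      by (rule has_field_derivative_transform_within[OF E d(1) t(2)])
         (use h(2) d in \<open>auto simp: dist_commute subset_iff\<close>)
    have "A1 t = frechet_derivative h (at t) 1"
      unfolding A1_def
    proof (rule the_equality)
      fix d assume "(A has_real_derivative d) (at t within {a..b})"
      then show "d = frechet_derivative h (at t) 1"
        using D vector_derivative_unique_within_closed_interval[OF assms(1)] t(2)
        by (metis cbox_interval has_real_derivative_iff_has_vector_derivative)
    qed (fact D)
    then show ?thesis using D by simp
  qed
  have "smooth {a..b} A1"
    unfolding smooth_def
  proof
    fix t assume t: "t \<in> {a..b}"
    then obtain U h where U: "t \<in> U" "smooth_open U h" "\<forall>y\<in>{a..b} \<inter> U. A y = h y"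
      using assms(2) unfolding smooth_def by blast
    have "Ck_open k U (\<lambda>x. frechet_derivative h (at x) 1)" for k
      using U(2) unfolding smooth_open_def by (metis Ck_open.simps(2))
    then have "smooth_open U (\<lambda>x. frechet_derivative h (at x) 1)"
      using U(2) unfolding smooth_open_def by blast
    moreover have "\<forall>y\<in>{a..b} \<inter> U. A1 y = frechet_derivative h (at y) 1"
      using key U by auto
    ultimately show "\<exists>U h. t \<in> U \<and> smooth_open U h \<and> (\<forall>y\<in>{a..b} \<inter> U. A1 y = h y)"
      using U(1) by blast
  qed
  moreover have "(A has_real_derivative A1 t) (at t within {a..b})" if t: "t \<in> {a..b}" for t
  proof -
    obtain U h where "t \<in> U" "smooth_open U h" "\<forall>y\<in>{a..b} \<inter> U. A y = h y"
      using assms(2) t unfolding smooth_def by blast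
    then show ?thesis using key t by blast
  qed
  ultimately show ?thesis by blast
qed

lemma smooth_interval_imp_Ck_on:
  fixes A :: "real \<Rightarrow> real"
  assumes "a < b" "smooth {a..b} A"
  shows "Ck_on k {a..b} A"
  using assms(2)
proof (induction k arbitrary: A)
  case 0
  then obtain A1 where "\<forall>t\<in>{a..b}. (A has_real_derivative A1 t) (at t within {a..b})"
    using smooth_interval_deriv[OF assms(1)] by blast
  then show ?case
    by (auto intro: DERIV_continuous_on)
next
  case (Suc k)
  then obtain A1 where "smooth {a..b} A1"
      "\<forall>t\<in>{a..b}. (A has_real_derivative A1 t) (at t within {a..b})"
    using smooth_interval_deriv[OF assms(1)] by blast
  then show ?case
    using Suc.IH by (intro Ck_on_real_Suc) auto
qed

lemma Ck_on_sin_cos: "Ck_on k S (sin :: real \<Rightarrow> real) \<and> Ck_on k S (cos :: real \<Rightarrow> real)"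
proof (induction k)
  case 0
  show ?case by (auto intro: continuous_intros)
next
  case (Suc k)
  have "(sin has_real_derivative cos x) (at x within S)"
    "(cos has_real_derivative - sin x) (at x within S)" for x :: real
    by (auto intro!: DERIV_subset[OF DERIV_sin] DERIV_subset[OF DERIV_cos])
  then show ?case
    using Suc by (intro conjI Ck_on_real_Suc[where fd = cos] Ck_on_real_Suc[where fd = "\<lambda>x. - sin x"] Ck_on_minus) auto
qed

lemma Ck_on_prod:
  fixes f :: "'i \<Rightarrow> 'a::euclidean_space \<Rightarrow> real"
  assumes "\<And>i. i \<in> I \<Longrightarrow> Ck_on k S (f i)"
  shows "Ck_on k S (\<lambda>x. \<Prod>i\<in>I. f i x)"
  using assms by (induction I rule: infinite_finite_induct) (auto intro: Ck_on_mult)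

lemma Ck_on_real_deriv:
  fixes f :: "real \<Rightarrow> real"
  assumes "open S" "Ck_on (Suc k) S f"
  shows "Ck_on k S (deriv f)" "x \<in> S \<Longrightarrow> (f has_real_derivative deriv f x) (at x)"
proof -
  obtain f' where f': "\<forall>x\<in>S. (f has_derivative f' x) (at x)" "\<forall>v. Ck_on k S (\<lambda>x. f' x v)"
    using assms by (auto simp: at_within_open[OF _ assms(1)])
  have D: "(f has_real_derivative f' x 1) (at x)" if "x \<in> S" for x
  proof -
    have "f' x = (*) (f' x 1)"
    proof
      fix v
      have "f' x (v *\<^sub>R 1) = v *\<^sub>R f' x 1"
        using f' that has_derivative_linear linear_cmul by blast
      then show "f' x v = f' x 1 * v" by (simp add: mult.commute)
    qed
    then show ?thesis using f' that unfolding has_field_derivative_def by metis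
  qed
  then have "deriv f x = f' x 1" if "x \<in> S" for x using that DERIV_imp_deriv by blast
  then show "Ck_on k S (deriv f)" "x \<in> S \<Longrightarrow> (f has_real_derivative deriv f x) (at x)"
    using D f'(2) Ck_on_cong[of S "deriv f" "\<lambda>x. f' x 1"] by auto
qed

section \<open>Symmetric second derivatives and symmetric operators\<close>

text \<open>The mean value theorem in direction \<open>v\<close> turns the mixed second difference into a first difference
of \<open>G \<bullet> v\<close> in direction \<open>w\<close>, which the differentiability of \<open>G\<close> at \<open>x\<close> evaluates.\<close>

lemma second_difference_bound:
  fixes G :: "'a::euclidean_space \<Rightarrow> 'a"
  assumes E: "\<And>y. y \<in> ball x r \<Longrightarrow> (E has_derivative (\<lambda>h. G y \<bullet> h)) (at y)"
    and G: "\<And>y. norm (y - x) < r \<Longrightarrow> norm (G y - G x - H (y - x)) \<le> e * norm (y - x)"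
    and H: "linear H" and e: "e \<ge> 0" and t: "t > 0" "t * (norm v + norm w) < r"
  shows "\<bar>(E (x + t *\<^sub>R v + t *\<^sub>R w) - E (x + t *\<^sub>R v) - E (x + t *\<^sub>R w) + E x) - t\<^sup>2 * (H w \<bullet> v)\<bar>
    \<le> t\<^sup>2 * e * (2 * norm v + norm w) * norm v"
proof -
  define p where "p s = E (x + s *\<^sub>R v + t *\<^sub>R w) - E (x + s *\<^sub>R v)" for s
  have small: "norm (s *\<^sub>R v + t *\<^sub>R w) < r" "norm (s *\<^sub>R v) < r"
    "norm (s *\<^sub>R v + t *\<^sub>R w) \<le> t * (norm v + norm w)" "norm (s *\<^sub>R v) \<le> t * norm v"
    if "0 \<le> s" "s \<le> t" for s
  proof -
    have "norm (s *\<^sub>R v) \<le> t * norm v" "norm (t *\<^sub>R w) = t * norm w"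
      using that t by (auto intro: mult_right_mono)
    then show "norm (s *\<^sub>R v) \<le> t * norm v"
      "norm (s *\<^sub>R v + t *\<^sub>R w) \<le> t * (norm v + norm w)"
      using norm_triangle_ineq[of "s *\<^sub>R v" "t *\<^sub>R w"] by (auto simp: algebra_simps)
    moreover have "t * norm v \<le> t * (norm v + norm w)"
      using t by simp
    ultimately show "norm (s *\<^sub>R v + t *\<^sub>R w) < r" "norm (s *\<^sub>R v) < r"
      using t by linarith+
  qed
  have dp: "(p has_real_derivative (G (x + s *\<^sub>R v + t *\<^sub>R w) \<bullet> v - G (x + s *\<^sub>R v) \<bullet> v)) (at s)"
    if "0 \<le> s" "s \<le> t" for s
  proof -
    have "(E has_derivative (\<lambda>h. G (x + s *\<^sub>R v + t *\<^sub>R w) \<bullet> h)) (at (x + s *\<^sub>R v + t *\<^sub>R w))"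
      "(E has_derivative (\<lambda>h. G (x + s *\<^sub>R v) \<bullet> h)) (at (x + s *\<^sub>R v))"
      using small[OF that] by (auto intro!: E simp: dist_norm norm_minus_commute algebra_simps)
    moreover have "((\<lambda>s. x + s *\<^sub>R v + t *\<^sub>R w) has_derivative (\<lambda>h. h *\<^sub>R v)) (at s)"
      "((\<lambda>s. x + s *\<^sub>R v) has_derivative (\<lambda>h. h *\<^sub>R v)) (at s)"
      by (auto intro!: derivative_eq_intros)
    ultimately have "(p has_derivative (\<lambda>h. G (x + s *\<^sub>R v + t *\<^sub>R w) \<bullet> (h *\<^sub>R v) - G (x + s *\<^sub>R v) \<bullet> (h *\<^sub>R v))) (at s)"
      unfolding p_def
      by (intro has_derivative_diff has_derivative_compose[where f = "\<lambda>s. x + s *\<^sub>R v + t *\<^sub>R w" and g = E]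
          has_derivative_compose[where f = "\<lambda>s. x + s *\<^sub>R v" and g = E])
    then show ?thesis
      by (rule has_derivative_imp_has_field_derivative) (auto simp: algebra_simps)
  qed
  obtain s where s: "0 < s" "s < t" "p t - p 0 = (t - 0) * (G (x + s *\<^sub>R v + t *\<^sub>R w) \<bullet> v - G (x + s *\<^sub>R v) \<bullet> v)"
    using MVT2[OF t(1), of p "\<lambda>s. G (x + s *\<^sub>R v + t *\<^sub>R w) \<bullet> v - G (x + s *\<^sub>R v) \<bullet> v"] dp by blast
  define R where "R y = G y - G x - H (y - x)" for y
  have "H (s *\<^sub>R v + t *\<^sub>R w) - H (s *\<^sub>R v) = t *\<^sub>R H w"
    using H by (simp add: linear_add linear_cmul)
  then have "G (x + s *\<^sub>R v + t *\<^sub>R w) - G (x + s *\<^sub>R v) = t *\<^sub>R H w + (R (x + s *\<^sub>R v + t *\<^sub>R w) - R (x + s *\<^sub>R v))"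
    unfolding R_def by (simp add: algebra_simps)
  then have "G (x + s *\<^sub>R v + t *\<^sub>R w) \<bullet> v - G (x + s *\<^sub>R v) \<bullet> v
      = t * (H w \<bullet> v) + (R (x + s *\<^sub>R v + t *\<^sub>R w) - R (x + s *\<^sub>R v)) \<bullet> v"
    by (metis inner_add_left inner_diff_left inner_scaleR_left)
  moreover have bd: "\<bar>(R (x + s *\<^sub>R v + t *\<^sub>R w) - R (x + s *\<^sub>R v)) \<bullet> v\<bar> \<le> t * e * (2 * norm v + norm w) * norm v"
  proof -
    have "e * norm (s *\<^sub>R v) \<le> e * (t * norm v)"
      "e * norm (s *\<^sub>R v + t *\<^sub>R w) \<le> e * (t * (norm v + norm w))"
      using small[of s] s e by (auto intro!: mult_left_mono)
    moreover have "norm (R (x + s *\<^sub>R v)) \<le> e * norm (s *\<^sub>R v)"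
      "norm (R (x + s *\<^sub>R v + t *\<^sub>R w)) \<le> e * norm (s *\<^sub>R v + t *\<^sub>R w)"
      using G[of "x + s *\<^sub>R v"] G[of "x + s *\<^sub>R v + t *\<^sub>R w"] small[of s] s
      unfolding R_def by (auto simp: add.assoc)
    moreover have "norm (R (x + s *\<^sub>R v + t *\<^sub>R w) - R (x + s *\<^sub>R v)) \<le> norm (R (x + s *\<^sub>R v + t *\<^sub>R w)) + norm (R (x + s *\<^sub>R v))"
      by (rule norm_triangle_ineq4)
    ultimately have "norm (R (x + s *\<^sub>R v + t *\<^sub>R w) - R (x + s *\<^sub>R v)) \<le> t * e * (2 * norm v + norm w)"
      by (simp add: algebra_simps)
    then show ?thesis
      using Cauchy_Schwarz_ineq2 mult_right_mono norm_ge_zero order_trans by metis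
  qed
  moreover have "E (x + t *\<^sub>R v + t *\<^sub>R w) - E (x + t *\<^sub>R v) - E (x + t *\<^sub>R w) + E x = p t - p 0"
    unfolding p_def by simp
  ultimately have "E (x + t *\<^sub>R v + t *\<^sub>R w) - E (x + t *\<^sub>R v) - E (x + t *\<^sub>R w) + E x
      = t * (t * (H w \<bullet> v) + (R (x + s *\<^sub>R v + t *\<^sub>R w) - R (x + s *\<^sub>R v)) \<bullet> v)"
    using s(3) by simp
  then have "(E (x + t *\<^sub>R v + t *\<^sub>R w) - E (x + t *\<^sub>R v) - E (x + t *\<^sub>R w) + E x) - t\<^sup>2 * (H w \<bullet> v)
      = t * ((R (x + s *\<^sub>R v + t *\<^sub>R w) - R (x + s *\<^sub>R v)) \<bullet> v)"
    by (simp only: distrib_left power2_eq_square mult.assoc add_diff_cancel_left')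
  then have "\<bar>(E (x + t *\<^sub>R v + t *\<^sub>R w) - E (x + t *\<^sub>R v) - E (x + t *\<^sub>R w) + E x) - t\<^sup>2 * (H w \<bullet> v)\<bar>
      = t * \<bar>(R (x + s *\<^sub>R v + t *\<^sub>R w) - R (x + s *\<^sub>R v)) \<bullet> v\<bar>"
    using t(1) by (simp only: abs_mult abs_of_pos)
  also have "\<dots> \<le> t * (t * e * (2 * norm v + norm w) * norm v)"
    using bd t(1) by (intro mult_left_mono) auto
  finally show ?thesis by (simp add: power2_eq_square mult.assoc)
qed

text \<open>The mixed second difference is symmetric in \<open>v\<close> and \<open>w\<close>, and to leading order it is both
\<open>t\<^sup>2 (H w \<bullet> v)\<close> and \<open>t\<^sup>2 (H v \<bullet> w)\<close>.\<close>

lemma gradient_derivative_symmetric: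
  fixes G :: "'a::euclidean_space \<Rightarrow> 'a"
  assumes U: "open U" "x \<in> U" and E: "\<And>y. y \<in> U \<Longrightarrow> (E has_derivative (\<lambda>h. G y \<bullet> h)) (at y)"
    and G: "(G has_derivative H) (at x)"
  shows "H v \<bullet> w = v \<bullet> H w"
proof -
  have lin: "linear H" using G has_derivative_linear by blast
  define K where "K = (2 * norm v + norm w) * norm v + (2 * norm w + norm v) * norm w"
  have K: "K \<ge> 0" unfolding K_def by simp
  have bound: "\<bar>H w \<bullet> v - H v \<bullet> w\<bar> \<le> e * K" if "e > 0" for e
  proof -
    obtain d where d: "d > 0" "\<And>y. norm (y - x) < d \<Longrightarrow> norm (G y - G x - H (y - x)) \<le> e * norm (y - x)"
      using G \<open>e > 0\<close> unfolding has_derivative_at_alt by blast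
    obtain d' where d': "d' > 0" "ball x d' \<subseteq> U" using U open_contains_ball by blast
    define r where "r = min d d'"
    define t where "t = r / (2 * (norm v + norm w + 1))"
    have pos: "norm v + norm w + 1 > 0" using norm_ge_zero[of v] norm_ge_zero[of w] by linarith
    have r: "r > 0" unfolding r_def using d d' by simp
    have t: "t > 0" "t * (norm v + norm w) < r"
    proof -
      show "t > 0" unfolding t_def using r pos by simp
      have "t * (norm v + norm w) \<le> t * (norm v + norm w + 1)" using \<open>t > 0\<close> by simp
      also have "\<dots> = r / 2" unfolding t_def using pos by (simp add: field_simps)
      finally show "t * (norm v + norm w) < r" using r by linarith
    qed
    have E': "(E has_derivative (\<lambda>h. G y \<bullet> h)) (at y)" if "y \<in> ball x r" for y
      using that d' E unfolding r_def by auto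
    have G': "norm (G y - G x - H (y - x)) \<le> e * norm (y - x)" if "norm (y - x) < r" for y
      using that d unfolding r_def by auto
    have e: "e \<ge> 0" using \<open>e > 0\<close> by simp
    have "t * (norm w + norm v) < r" using t(2) by (simp add: add.commute)
    note second_difference_bound[OF E' G' lin e t] second_difference_bound[OF E' G' lin e t(1) this]
    moreover have "E (x + t *\<^sub>R w + t *\<^sub>R v) - E (x + t *\<^sub>R w) - E (x + t *\<^sub>R v)
        = E (x + t *\<^sub>R v + t *\<^sub>R w) - E (x + t *\<^sub>R v) - E (x + t *\<^sub>R w)"
      by (simp add: algebra_simps)
    ultimately have "\<bar>t\<^sup>2 * (H w \<bullet> v) - t\<^sup>2 * (H v \<bullet> w)\<bar>
        \<le> t\<^sup>2 * e * (2 * norm v + norm w) * norm v + t\<^sup>2 * e * (2 * norm w + norm v) * norm w"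
      by linarith
    also have "\<dots> = t\<^sup>2 * (e * K)"
      unfolding K_def by (simp add: algebra_simps)
    finally have "\<bar>t\<^sup>2 * (H w \<bullet> v) - t\<^sup>2 * (H v \<bullet> w)\<bar> \<le> t\<^sup>2 * (e * K)" .
    then have "t\<^sup>2 * \<bar>H w \<bullet> v - H v \<bullet> w\<bar> \<le> t\<^sup>2 * (e * K)"
      by (simp add: abs_mult flip: right_diff_distrib)
    then show ?thesis using t(1) by simp
  qed
  have "\<bar>H w \<bullet> v - H v \<bullet> w\<bar> \<le> 0 + e" if "e > 0" for e
  proof -
    have "e / (K + 1) * K \<le> e" using K that by (simp add: field_simps)
    then show ?thesis using bound[of "e / (K + 1)"] K that by simp
  qed
  then have "\<bar>H w \<bullet> v - H v \<bullet> w\<bar> \<le> 0" using field_le_epsilon by blast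
  then show ?thesis by (simp add: inner_commute)
qed

text \<open>A maximum of \<open>v \<bullet> S v\<close> on the unit sphere of \<open>T\<close> is critical along every great circle through it,
which says that \<open>S v\<close> is orthogonal to all \<open>w \<in> T\<close> that are orthogonal to \<open>v\<close>.\<close>

lemma quadratic_form_maximum_eigenvector:
  fixes S :: "'a::euclidean_space \<Rightarrow> 'a"
  assumes T: "subspace T" "T \<noteq> {0}" and S: "linear S" "\<And>v. v \<in> T \<Longrightarrow> S v \<in> T"
    and sym: "\<And>v w. v \<in> T \<Longrightarrow> w \<in> T \<Longrightarrow> S v \<bullet> w = v \<bullet> S w"
  obtains v c where "v \<in> T" "norm v = 1" "S v = c *\<^sub>R v"
proof -
  let ?U = "T \<inter> sphere 0 1"
  have "compact ?U"
    using closed_subspace[OF T(1)] by (simp add: closed_Int_compact)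
  moreover obtain u where "u \<in> T" "u \<noteq> 0" using T subspace_0 by blast
  then have "u /\<^sub>R norm u \<in> ?U" using T(1) by (simp add: subspace_scale)
  moreover have "continuous_on ?U (\<lambda>v. v \<bullet> S v)"
    using S(1) by (intro continuous_intros linear_continuous_on linear_conv_bounded_linear[THEN iffD1])
  ultimately obtain v where v: "v \<in> ?U" "\<And>w. w \<in> ?U \<Longrightarrow> w \<bullet> S w \<le> v \<bullet> S v"
    using continuous_attains_sup[of ?U "\<lambda>v. v \<bullet> S v"] by blast
  have vv: "v \<bullet> v = 1" and vT: "v \<in> T" using v by (auto simp: norm_eq_1)
  have perp: "w \<bullet> S v = 0" if w: "w \<in> T" "w \<bullet> v = 0" "norm w = 1" for w
  proof -
    define q where "q s = (cos s *\<^sub>R v + sin s *\<^sub>R w) \<bullet> S (cos s *\<^sub>R v + sin s *\<^sub>R w)" for s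
    have q: "q s = (cos s)\<^sup>2 * (v \<bullet> S v) + 2 * sin s * cos s * (w \<bullet> S v) + (sin s)\<^sup>2 * (w \<bullet> S w)" for s
      using sym[OF vT w(1)] S(1)
      by (simp add: q_def linear_add linear_cmul inner_add_left inner_add_right power2_eq_square
          inner_commute algebra_simps)
    have "(q has_real_derivative 2 * (w \<bullet> S v)) (at 0)"
      unfolding q[abs_def] by (auto intro!: derivative_eq_intros)
    moreover have "q s \<le> q 0" for s
    proof -
      have "(cos s *\<^sub>R v + sin s *\<^sub>R w) \<bullet> (cos s *\<^sub>R v + sin s *\<^sub>R w) = 1"
        using vv w by (simp add: inner_add_left inner_add_right inner_commute norm_eq_1 flip: power2_eq_square)
      then have "cos s *\<^sub>R v + sin s *\<^sub>R w \<in> ?U"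
        using vT w T(1) by (simp add: subspace_add subspace_scale norm_eq_1)
      then show ?thesis unfolding q_def using v(2) by simp
    qed
    ultimately have "2 * (w \<bullet> S v) = 0"
      using DERIV_local_max[of q "2 * (w \<bullet> S v)" 0 1] by fastforce
    then show ?thesis by simp
  qed
  define c where "c = v \<bullet> S v"
  let ?r = "S v - c *\<^sub>R v"
  have rT: "?r \<in> T" using vT S T(1) by (simp add: subspace_diff subspace_scale)
  have rv: "?r \<bullet> v = 0" unfolding c_def by (simp add: inner_diff_left inner_diff_right vv inner_commute)
  have "?r = 0"
  proof (rule ccontr)
    assume nz: "?r \<noteq> 0"
    have "(?r /\<^sub>R norm ?r) \<bullet> S v = 0"
      using nz rT rv T(1) by (intro perp) (auto simp: subspace_scale)
    then have "?r \<bullet> S v = 0" using nz by simp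
    then have "?r \<bullet> ?r = 0" using rv by (simp add: inner_diff_right)
    then show False using nz by simp
  qed
  then have "S v = c *\<^sub>R v" by simp
  with that v show thesis by auto
qed

text \<open>Split off one eigenvector and continue in its orthogonal complement inside \<open>T\<close>.\<close>

lemma symmetric_eigenbasis:
  fixes S :: "'a::euclidean_space \<Rightarrow> 'a"
  assumes "subspace T" "linear S" "\<And>v. v \<in> T \<Longrightarrow> S v \<in> T"
    and "\<And>v w. v \<in> T \<Longrightarrow> w \<in> T \<Longrightarrow> S v \<bullet> w = v \<bullet> S w"
  shows "\<exists>B c. finite B \<and> B \<subseteq> T \<and> span B = T \<and> card B = dim T \<and> pairwise orthogonal B \<and>
           (\<forall>b\<in>B. norm b = 1 \<and> S b = c b *\<^sub>R b)"
  using assms(1,3,4)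
proof (induction "dim T" arbitrary: T rule: less_induct)
  case less
  show ?case
  proof (cases "T = {0}")
    case True
    then show ?thesis by (intro exI[of _ "{}"]) auto
  next
    case False
    then obtain v l where v: "v \<in> T" "norm v = 1" "S v = l *\<^sub>R v"
      using quadratic_form_maximum_eigenvector[OF less.prems(1) False assms(2) less.prems(2,3)] by metis
    define T' where "T' = {w \<in> T. v \<bullet> w = 0}"
    have T': "subspace T'"
      using less.prems(1) unfolding T'_def subspace_def by (auto simp: inner_add_right)
    have vv: "v \<bullet> v = 1" using v by (simp add: norm_eq_1)
    have decomp: "w - (v \<bullet> w) *\<^sub>R v \<in> T'" if "w \<in> T" for w
      using that v(1) less.prems(1) vv
      unfolding T'_def by (auto simp: subspace_diff subspace_scale inner_diff_right)
    have "v \<notin> T'" using vv unfolding T'_def by simp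
    then have "dim T' < dim T"
      using T' less.prems(1) v(1) unfolding T'_def
      by (intro dim_psubset) (metis (no_types, lifting) mem_Collect_eq psubsetI span_eq_iff subsetI)
    moreover have "S w \<in> T'" if "w \<in> T'" for w
    proof -
      have "v \<bullet> S w = l * (v \<bullet> w)"
        using less.prems(3)[OF v(1), of w] that v(3) unfolding T'_def by simp
      then show ?thesis using that less.prems(2) unfolding T'_def by simp
    qed
    ultimately obtain B c where B: "finite B" "B \<subseteq> T'" "span B = T'" "card B = dim T'" "pairwise orthogonal B"
      "\<forall>b\<in>B. norm b = 1 \<and> S b = c b *\<^sub>R b"
      using less.hyps[of T'] T' less.prems(3) unfolding T'_def by auto
    have vB: "v \<notin> B" using B(2) \<open>v \<notin> T'\<close> by blast
    have sp: "span (insert v B) = T"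
    proof
      show "span (insert v B) \<subseteq> T"
        using less.prems(1) v(1) B(2) unfolding T'_def by (intro span_minimal) auto
      show "T \<subseteq> span (insert v B)"
      proof
        fix w assume "w \<in> T"
        then have "w - (v \<bullet> w) *\<^sub>R v \<in> span B" using decomp B(3) by simp
        then show "w \<in> span (insert v B)" unfolding span_insert by blast
      qed
    qed
    have orth: "pairwise orthogonal (insert v B)"
      using B(2,5) unfolding T'_def
      by (auto simp: pairwise_insert orthogonal_def inner_commute)
    have "0 \<notin> insert v B" using v(2) B(6) by force
    then have "independent (insert v B)" using orth pairwise_orthogonal_independent by blast
    then have "card (insert v B) = dim T" using sp dim_span_eq_card_independent by metis
    then show ?thesis
      using B v vB sp orth less.prems(1)
      by (intro exI[of _ "insert v B"] exI[of _ "c(v := l)"]) (auto simp: T'_def)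
  qed
qed

lemma orthonormal_basis_expansion:
  fixes B :: "'a::euclidean_space set"
  assumes "finite B" "pairwise orthogonal B" "\<And>b. b \<in> B \<Longrightarrow> norm b = 1" "v \<in> span B"
  shows "v = (\<Sum>b\<in>B. (v \<bullet> b) *\<^sub>R b)"
proof -
  obtain c where c: "v = (\<Sum>b\<in>B. c b *\<^sub>R b)"
    using assms(1,4) span_finite by (metis (mono_tags, lifting) imageE)
  have "v \<bullet> b = c b" if "b \<in> B" for b
  proof -
    have "v \<bullet> b = (\<Sum>b'\<in>B. c b' * (b' \<bullet> b))" by (simp add: c inner_sum_left)
    also have "\<dots> = (\<Sum>b'\<in>B. if b' = b then c b else 0)"
      using assms(2,3) that
      by (intro sum.cong) (auto simp: pairwise_def orthogonal_def norm_eq_1)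
    finally show ?thesis using assms(1) that by simp
  qed
  then show ?thesis using c by simp
qed

text \<open>The divergence is a trace in the standard basis, whereas the shape operator is diagonal in a basis of
principal directions; this passes from one to the other.\<close>

lemma trace_orthonormal_basis:
  fixes M :: "'a::euclidean_space \<Rightarrow> 'a"
  assumes "linear M" "finite B" "pairwise orthogonal B" "\<And>b. b \<in> B \<Longrightarrow> norm b = 1" "span B = UNIV"
  shows "(\<Sum>e\<in>Basis. e \<bullet> M e) = (\<Sum>b\<in>B. b \<bullet> M b)"
proof -
  have "(\<Sum>e\<in>Basis. e \<bullet> M e) = (\<Sum>e\<in>Basis. \<Sum>b\<in>B. (e \<bullet> b) * (b \<bullet> M e))"
  proof (rule sum.cong[OF refl])
    fix e :: 'a
    have "e \<bullet> M e = (\<Sum>b\<in>B. (e \<bullet> b) *\<^sub>R b) \<bullet> M e"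
      using orthonormal_basis_expansion[OF assms(2-4), of e] assms(5) by auto
    then show "e \<bullet> M e = (\<Sum>b\<in>B. (e \<bullet> b) * (b \<bullet> M e))"
      by (simp add: inner_sum_left)
  qed
  also have "\<dots> = (\<Sum>b\<in>B. b \<bullet> M (\<Sum>e\<in>Basis. (b \<bullet> e) *\<^sub>R e))"
    unfolding linear_sum[OF assms(1)] linear_cmul[OF assms(1)]
    by (subst sum.swap) (simp add: inner_sum_right inner_commute)
  finally show ?thesis by (simp add: euclidean_representation)
qed

section \<open>Reflection of zeros of products of sines\<close>

text \<open>Gronwall's inequality with vanishing initial value: \<open>f\<^sup>2 exp(- 2 K s)\<close> decreases and
\<open>f\<^sup>2 exp(2 K s)\<close> increases.\<close>

lemma linear_differential_inequality_zero:
  fixes f :: "real \<Rightarrow> real"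
  assumes deriv: "\<And>s. s \<in> {l..r} \<Longrightarrow> (f has_real_derivative fd s) (at s)"
    and bound: "\<And>s. s \<in> {l..r} \<Longrightarrow> \<bar>fd s\<bar> \<le> K * \<bar>f s\<bar>"
    and zero: "s0 \<in> {l..r}" "f s0 = 0" and s: "s \<in> {l..r}"
  shows "f s = 0"
proof -
  have main: "\<bar>2 * f x * fd x\<bar> \<le> 2 * K * (f x)\<^sup>2" if "x \<in> {l..r}" for x
  proof -
    have "\<bar>f x\<bar> * \<bar>fd x\<bar> \<le> \<bar>f x\<bar> * (K * \<bar>f x\<bar>)"
      using bound[OF that] by (intro mult_left_mono) auto
    then show ?thesis by (simp add: abs_mult power2_eq_square mult_ac)
  qed
  have "(f s)\<^sup>2 \<le> 0"
  proof (cases "s0 \<le> s")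
    case True
    define h where "h x = (f x)\<^sup>2 * exp (- (2 * K) * x)" for x
    have "h s \<le> h s0"
    proof (rule DERIV_nonpos_imp_nonincreasing[OF True, of h])
      fix x assume "s0 \<le> x" "x \<le> s"
      then have x: "x \<in> {l..r}" using zero s by auto
      have "(h has_real_derivative (2 * f x * fd x - 2 * K * (f x)\<^sup>2) * exp (- (2 * K) * x)) (at x)"
        unfolding h_def by (auto intro!: derivative_eq_intros deriv[OF x] simp: algebra_simps power2_eq_square)
      moreover have "(2 * f x * fd x - 2 * K * (f x)\<^sup>2) * exp (- (2 * K) * x) \<le> 0"
        using main[OF x] by (intro mult_nonpos_nonneg) auto
      ultimately show "\<exists>y. (h has_real_derivative y) (at x) \<and> y \<le> 0" by blast
    qed
    then show ?thesis using zero unfolding h_def by (simp add: mult_le_0_iff)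
  next
    case False
    define h where "h x = (f x)\<^sup>2 * exp ((2 * K) * x)" for x
    have "h s \<le> h s0"
    proof (rule DERIV_nonneg_imp_nondecreasing[of s s0 h])
      show "s \<le> s0" using False by simp
      fix x assume "s \<le> x" "x \<le> s0"
      then have x: "x \<in> {l..r}" using zero s by auto
      have "(h has_real_derivative (2 * f x * fd x + 2 * K * (f x)\<^sup>2) * exp ((2 * K) * x)) (at x)"
        unfolding h_def by (auto intro!: derivative_eq_intros deriv[OF x] simp: algebra_simps power2_eq_square)
      moreover have "(2 * f x * fd x + 2 * K * (f x)\<^sup>2) * exp ((2 * K) * x) \<ge> 0"
        using main[OF x] by (intro mult_nonneg_nonneg) auto
      ultimately show "\<exists>y. (h has_real_derivative y) (at x) \<and> y \<ge> 0" by blast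
    qed
    then show ?thesis using zero unfolding h_def by (simp add: mult_le_0_iff)
  qed
  then show ?thesis by simp
qed

text \<open>If \<open>sgn v * Q v\<close> extends smoothly across \<open>0\<close> then \<open>Q 0 = 0\<close> by continuity, and the derivatives of
\<open>T\<close> and \<open>Q\<close> form a pair of the same kind. So \<open>Q\<close> vanishes to infinite order.\<close>

lemma smooth_sign_times_smooth_flat:
  fixes T Q :: "real \<Rightarrow> real"
  assumes "d > 0" "\<And>k. Ck_on k {-d<..<d} T" "\<And>k. Ck_on k {-d<..<d} Q"
    and "\<And>v. v \<in> {-d<..<d} \<Longrightarrow> v \<noteq> 0 \<Longrightarrow> T v = sgn v * Q v" and "0 < e" "e < d"
  shows "\<exists>K. \<forall>v\<in>{-e..e}. \<bar>Q v\<bar> \<le> K * \<bar>v\<bar> ^ k"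
  using assms(2-4)
proof (induction k arbitrary: T Q)
  case 0
  have "continuous_on {-e..e} Q"
    using Ck_on_continuous[OF 0(2)] assms(5,6) by (auto intro: continuous_on_subset)
  then have "bounded (Q ` {-e..e})" by (intro compact_imp_bounded compact_continuous_image) auto
  then obtain K where "\<forall>x\<in>{-e..e}. \<bar>Q x\<bar> \<le> K" unfolding bounded_iff by auto
  then show ?case by auto
next
  case (Suc k)
  have op: "open {-d<..<d}" by simp
  have DQ: "(Q has_real_derivative deriv Q x) (at x)" and DT: "(T has_real_derivative deriv T x) (at x)"
    if "x \<in> {-d<..<d}" for x
    using that Ck_on_real_deriv(2)[OF op Suc.prems(1), of x] Ck_on_real_deriv(2)[OF op Suc.prems(2), of x] by auto
  have "deriv T v = sgn v * deriv Q v" if v: "v \<in> {-d<..<d}" "v \<noteq> 0" for v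
  proof -
    \<comment> \<open>a neighbourhood of \<open>v\<close> on which the sign is constant\<close>
    define U where "U = (if v > 0 then {0<..<d} else {-d<..<0})"
    have U: "open U" "v \<in> U" using v unfolding U_def by auto
    have "((\<lambda>x. sgn v * Q x) has_real_derivative sgn v * deriv Q v) (at v)"
      by (rule DERIV_cmult[OF DQ[OF v(1)]])
    then have "(T has_real_derivative sgn v * deriv Q v) (at v)"
      by (rule has_field_derivative_transform_within_open[OF _ U])
         (use Suc.prems(3) v assms(1) in \<open>auto simp: U_def split: if_splits\<close>)
    then show ?thesis by (rule DERIV_imp_deriv)
  qed
  then obtain K where K: "\<forall>v\<in>{-e..e}. \<bar>deriv Q v\<bar> \<le> K * \<bar>v\<bar> ^ k"
    using Suc.IH[of "deriv T" "deriv Q"] Ck_on_real_deriv(1)[OF op Suc.prems(1)]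
      Ck_on_real_deriv(1)[OF op Suc.prems(2)] by blast
  have Q0: "Q 0 = 0"
  proof -
    have z: "0 \<in> {-d<..<d}" using assms(1) by simp
    have TQ: "isCont T 0" "isCont Q 0" using DQ[OF z] DT[OF z] DERIV_isCont by blast+
    have r: "eventually (\<lambda>v. T v = Q v) (at_right 0)"
      using eventually_at_right_real[OF assms(1)] by eventually_elim (use Suc.prems(3) in auto)
    have l: "eventually (\<lambda>v. T v = - Q v) (at_left 0)"
      using eventually_at_left_real[of "-d" 0] assms(1) Suc.prems(3)
      by (auto elim!: eventually_mono)
    have "(Q \<longlongrightarrow> T 0) (at_right 0)"
      using tendsto_cong[OF r] TQ(1) by (simp add: isCont_def filterlim_at_split)
    moreover have "(Q \<longlongrightarrow> Q 0) (at_right 0)" "(Q \<longlongrightarrow> Q 0) (at_left 0)"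
      using TQ(2) by (simp_all add: isCont_def filterlim_at_split)
    moreover have "((\<lambda>v. - Q v) \<longlongrightarrow> T 0) (at_left 0)"
      using tendsto_cong[OF l] TQ(1) by (simp add: isCont_def filterlim_at_split)
    ultimately have "T 0 = Q 0" "T 0 = - Q 0"
      using tendsto_unique[OF trivial_limit_at_right_real, of Q "T 0" 0 "Q 0"] tendsto_minus[of Q "Q 0"]
        tendsto_unique[OF trivial_limit_at_left_real, of "\<lambda>v. - Q v" "T 0" 0 "- Q 0"] by auto
    then show ?thesis by simp
  qed
  have "\<bar>Q v\<bar> \<le> K * \<bar>v\<bar> ^ Suc k" if v: "v \<in> {-e..e}" for v
  proof (cases "v = 0")
    case False
    have "\<exists>x. \<bar>x\<bar> \<le> \<bar>v\<bar> \<and> Q v = v * deriv Q x"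
    proof (cases "v > 0")
      case True
      obtain x where "0 < x" "x < v" "Q v - Q 0 = (v - 0) * deriv Q x"
        using MVT2[OF True, of Q "deriv Q"] DQ v assms(5,6) by force
      then show ?thesis using Q0 by (intro exI[of _ x]) auto
    next
      case v0: False
      then have "v < 0" using False by simp
      then obtain x where "v < x" "x < 0" "Q 0 - Q v = (0 - v) * deriv Q x"
        using MVT2[of v 0 Q "deriv Q"] DQ v assms(5,6) by force
      then show ?thesis using Q0 by (intro exI[of _ x]) auto
    qed
    then obtain x where x: "\<bar>x\<bar> \<le> \<bar>v\<bar>" "Q v = v * deriv Q x" by blast
    have "x \<in> {-e..e}" using x(1) v by auto
    then have dx: "\<bar>deriv Q x\<bar> \<le> K * \<bar>x\<bar> ^ k" using K by blast
    have "K * \<bar>x\<bar> ^ k \<le> K * \<bar>v\<bar> ^ k"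
    proof (cases "K \<ge> 0")
      case True
      then show ?thesis using x(1) by (intro mult_left_mono power_mono) auto
    next
      case K0: False
      have "\<bar>deriv Q v\<bar> \<le> K * \<bar>v\<bar> ^ k" using K v by blast
      moreover have "K * \<bar>v\<bar> ^ k < 0" using K0 False by (simp add: mult_neg_pos)
      ultimately show ?thesis by linarith
    qed
    then have "\<bar>v\<bar> * \<bar>deriv Q x\<bar> \<le> \<bar>v\<bar> * (K * \<bar>v\<bar> ^ k)"
      using dx by (intro mult_left_mono) auto
    then show ?thesis using x(2) by (simp add: abs_mult mult_ac)
  qed (simp add: Q0)
  then show ?case by blast
qed

text \<open>Up to a constant factor, the volume density of the parallel hypersurfaces. The real version is the
weight of the radial problem; the complex version gives access to the finite order of zeros.\<close>

definition sin_prod :: "'i set \<Rightarrow> ('i \<Rightarrow> real) \<Rightarrow> 'f::{real_normed_field,banach} \<Rightarrow> 'f" where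
  "sin_prod I z v = (\<Prod>i\<in>I. sin (v - of_real (z i)))"

text \<open>The derivative of \<^const>\<open>sin_prod\<close>, again over the reals and over the complex numbers; see
\<open>sin_prod_deriv\<close>.\<close>

definition sin_prod' :: "'i set \<Rightarrow> ('i \<Rightarrow> real) \<Rightarrow> 'f::{real_normed_field,banach} \<Rightarrow> 'f" where
  "sin_prod' I z v = (\<Sum>i\<in>I. cos (v - of_real (z i)) * (\<Prod>j\<in>I - {i}. sin (v - of_real (z j))))"

text \<open>The numerator of twice the even part of the cotangent sum, which is the logarithmic derivative of
\<^const>\<open>sin_prod\<close>. It vanishes identically if and only if that sum is odd.\<close>

definition sin_prod_reflect :: "'i set \<Rightarrow> ('i \<Rightarrow> real) \<Rightarrow> 'f::{real_normed_field,banach} \<Rightarrow> 'f" where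
  "sin_prod_reflect I z v = sin_prod' I z v * sin_prod I z (- v) + sin_prod' I z (- v) * sin_prod I z v"

lemma sin_prod_of_real:
  "sin_prod I z (of_real v) = (of_real (sin_prod I z v) :: complex)"
  "sin_prod' I z (of_real v) = (of_real (sin_prod' I z v) :: complex)"
  unfolding sin_prod_def sin_prod'_def by (simp_all flip: of_real_diff sin_of_real cos_of_real)

lemma sin_prod_reflect_of_real:
  "sin_prod_reflect I z (of_real v) = (of_real (sin_prod_reflect I z v) :: complex)"
  unfolding sin_prod_reflect_def by (simp flip: of_real_minus add: sin_prod_of_real)

lemma holomorphic_sin_prod_reflect: "(sin_prod_reflect I z :: complex \<Rightarrow> complex) holomorphic_on S"
  unfolding sin_prod_reflect_def sin_prod_def sin_prod'_def by (intro holomorphic_intros)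

lemma Ck_on_sin_prod:
  "Ck_on k S (sin_prod I z :: real \<Rightarrow> real)" "Ck_on k S (sin_prod' I z :: real \<Rightarrow> real)"
proof -
  have "Ck_on k S (\<lambda>v. sin (v - c))" "Ck_on k S (\<lambda>v. cos (v - c))" for c :: real
    using Ck_on_compose[of k UNIV sin S "\<lambda>v. v - c"] Ck_on_compose[of k UNIV cos S "\<lambda>v. v - c"]
      Ck_on_sin_cos[of k UNIV] Ck_on_diff[OF Ck_on_linear[OF bounded_linear_ident] Ck_on_const, of k S c] by auto
  then show "Ck_on k S (sin_prod I z :: real \<Rightarrow> real)" "Ck_on k S (sin_prod' I z :: real \<Rightarrow> real)"
    unfolding sin_prod_def[abs_def] sin_prod'_def[abs_def]
    by (auto intro!: Ck_on_sum Ck_on_mult Ck_on_prod)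
qed

lemma sin_prod'_eq:
  fixes v :: real
  assumes "finite I" "\<And>i. i \<in> I \<Longrightarrow> sin (v - z i) \<noteq> 0"
  shows "sin_prod' I z v = (\<Sum>i\<in>I. cot (v - z i)) * sin_prod I z v"
proof -
  have "cot (v - z i) * (\<Prod>j\<in>I. sin (v - z j)) = cos (v - z i) * (\<Prod>j\<in>I - {i}. sin (v - z j))"
    if "i \<in> I" for i
    using assms that by (simp add: prod.remove cot_def)
  then show ?thesis unfolding sin_prod'_def sin_prod_def by (simp add: sum_distrib_right)
qed

text \<open>A holomorphic function that is not constant has a zero of finite order.\<close>

lemma sin_prod_reflect_zero_if_flat:
  fixes e :: real
  assumes e: "e > 0" and flat: "\<And>k. \<exists>K. \<forall>v\<in>{0<..<e}. \<bar>sin_prod_reflect I z v\<bar> \<le> K * v ^ k"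
  shows "sin_prod_reflect I z (w::complex) = 0"
proof -
  let ?N = "sin_prod_reflect I z :: complex \<Rightarrow> complex"
  have small: "\<exists>v\<in>{0<..<e}. v < c \<and> K * v < c" if "c > 0" for c K :: real
  proof -
    define v where "v = min (e / 2) (c / (2 * (\<bar>K\<bar> + 1)))"
    have "v > 0" "v < e" unfolding v_def using e that by auto
    have "v \<le> c / (2 * (\<bar>K\<bar> + 1))" unfolding v_def by simp
    then have "2 * v + 2 * (\<bar>K\<bar> * v) \<le> c" by (simp add: field_simps)
    moreover have "K * v \<le> \<bar>K\<bar> * v" using \<open>v > 0\<close> by (simp add: mult_right_mono)
    moreover have "0 \<le> \<bar>K\<bar> * v" using \<open>v > 0\<close> by simp
    ultimately have "v < c" "K * v < c" using \<open>v > 0\<close> by linarith+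
    then show ?thesis using \<open>v > 0\<close> \<open>v < e\<close> by auto
  qed
  have N0: "?N 0 = 0"
  proof (rule ccontr)
    assume nz: "?N 0 \<noteq> 0"
    have "continuous_on UNIV ?N"
      using holomorphic_sin_prod_reflect holomorphic_on_imp_continuous_on by blast
    then have "isCont ?N 0" by (simp add: continuous_on_eq_continuous_at)
    then obtain d where d: "d > 0" "\<And>w. dist w 0 < d \<Longrightarrow> dist (?N w) (?N 0) < norm (?N 0) / 2"
      using nz unfolding continuous_at_eps_delta by (metis half_gt_zero zero_less_norm_iff)
    obtain K where K: "\<forall>v\<in>{0<..<e}. \<bar>sin_prod_reflect I z v\<bar> \<le> K * v ^ 1" using flat by blast
    define c where "c = min d (norm (?N 0) / 2)"
    have "c > 0" unfolding c_def using d nz by simp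
    then obtain v where v: "v \<in> {0<..<e}" "v < c" "K * v < c" using small[of c K] by blast
    then have "norm (?N (of_real v)) < norm (?N 0) / 2"
      using K unfolding c_def by (fastforce simp: sin_prod_reflect_of_real)
    moreover have "dist (?N (of_real v)) (?N 0) < norm (?N 0) / 2"
      using v d(2)[of "of_real v"] unfolding c_def by (simp add: dist_norm)
    moreover have "norm (?N 0) \<le> norm (?N (of_real v)) + dist (?N (of_real v)) (?N 0)"
      unfolding dist_norm by (metis norm_minus_commute norm_triangle_sub add.commute)
    ultimately show False by linarith
  qed
  have "?N constant_on UNIV"
  proof (rule ccontr)
    assume "\<not> ?N constant_on UNIV"
    then obtain g r n where g: "0 < n" "0 < r" "g holomorphic_on ball 0 r"
      "\<And>w. w \<in> ball 0 r \<Longrightarrow> ?N w = (w - 0) ^ n * g w" "\<And>w. w \<in> ball 0 r \<Longrightarrow> g w \<noteq> 0"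
      using holomorphic_factor_zero_nonconstant[OF holomorphic_sin_prod_reflect _ _ _ N0, of UNIV]
      by (metis UNIV_I connected_UNIV open_UNIV)
    have "isCont g 0"
      using g(2) holomorphic_on_imp_continuous_on[OF g(3)] by (simp add: continuous_on_eq_continuous_at)
    moreover have g0: "g 0 \<noteq> 0" using g(2,5) by simp
    ultimately obtain d where d: "d > 0" "\<And>w. dist w 0 < d \<Longrightarrow> dist (g w) (g 0) < norm (g 0) / 2"
      unfolding continuous_at_eps_delta by (metis half_gt_zero zero_less_norm_iff)
    obtain K where K: "\<forall>v\<in>{0<..<e}. \<bar>sin_prod_reflect I z v\<bar> \<le> K * v ^ Suc n" using flat by blast
    define c where "c = min (min d r) (norm (g 0) / 2)"
    have "c > 0" unfolding c_def using d g0 g(2) by simp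
    then obtain v where v: "v \<in> {0<..<e}" "v < c" "K * v < c" using small[of c K] by blast
    have "dist (g (of_real v)) (g 0) < norm (g 0) / 2"
      using v d(2)[of "of_real v"] unfolding c_def by (simp add: dist_norm)
    moreover have "norm (g 0) \<le> norm (g (of_real v)) + dist (g (of_real v)) (g 0)"
      unfolding dist_norm by (metis norm_minus_commute norm_triangle_sub add.commute)
    ultimately have gv: "norm (g (of_real v)) > norm (g 0) / 2" by linarith
    have "?N (of_real v) = of_real v ^ n * g (of_real v)"
      using g(4)[of "of_real v"] v unfolding c_def by simp
    then have "\<bar>sin_prod_reflect I z v\<bar> = v ^ n * norm (g (of_real v))"
      using v by (simp add: sin_prod_reflect_of_real norm_mult norm_power)
        (metis abs_of_pos norm_mult norm_of_real norm_power)
    moreover have "K * v ^ Suc n = v ^ n * (K * v)" by simp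
    ultimately have "v ^ n * norm (g (of_real v)) \<le> v ^ n * (K * v)"
      using bspec[OF K v(1)] by argo
    then have "norm (g (of_real v)) \<le> K * v" using v(1) by simp
    then show False using gv v(3) unfolding c_def by linarith
  qed
  then show ?thesis using N0 unfolding constant_on_def by auto
qed


lemma sin_difference_zero_eventually_nonzero:
  "eventually (\<lambda>v::real. sin (v - z) \<noteq> 0) (at \<zeta>)"
proof -
  have "eventually (\<lambda>v. v \<in> {\<zeta> - pi<..<\<zeta> + pi}) (at \<zeta>)"
    by (intro eventually_at_in_open') auto
  moreover have "eventually (\<lambda>v. v \<noteq> \<zeta>) (at \<zeta>)" by (simp add: eventually_at_filter)
  moreover have "eventually (\<lambda>v. sin (\<zeta> - z) \<noteq> 0 \<longrightarrow> sin (v - z) \<noteq> 0) (at \<zeta>)"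
  proof (cases "sin (\<zeta> - z) = 0")
    case False
    have "((\<lambda>v. sin (v - z)) \<longlongrightarrow> sin (\<zeta> - z)) (at \<zeta>)" by (intro tendsto_intros)
    then show ?thesis using False tendsto_imp_eventually_ne by (auto elim: eventually_mono)
  qed simp
  ultimately show ?thesis
  proof eventually_elim
    case (elim v)
    show ?case
    proof
      assume v: "sin (v - z) = 0"
      then have "sin (\<zeta> - z) = 0" using elim by blast
      then have "sin ((v - z) - (\<zeta> - z)) = 0" using v by (simp only: sin_diff)
      then have "sin (v - \<zeta>) = 0" by simp
      then show False using sin_eq_0_pi[of "v - \<zeta>"] elim by auto
    qed
  qed
qed

lemma cot_shift: "sin (w::real) = 0 \<Longrightarrow> cot (u + w) = cot u"
proof -
  assume w: "sin w = 0"
  then have "cos w \<noteq> 0" using sin_cos_squared_add[of w] by auto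
  then show ?thesis using w by (simp add: cot_def sin_add cos_add)
qed

lemma tendsto_times_cot:
  "((\<lambda>v. (v - \<zeta>) * cot (v - z)) \<longlongrightarrow> (if sin (\<zeta> - z) = 0 then 1 else 0)) (at (\<zeta>::real))"
proof (cases "sin (\<zeta> - z) = 0")
  case True
  have "(sin has_real_derivative 1) (at 0)" using DERIV_sin[of "0::real"] by simp
  then have s: "((\<lambda>h::real. sin h / h) \<longlongrightarrow> 1) (at 0)" by (simp add: DERIV_def)
  have "((\<lambda>h::real. cos h) \<longlongrightarrow> cos 0) (at 0)" by (intro tendsto_intros)
  then have "((\<lambda>h::real. cos h / (sin h / h)) \<longlongrightarrow> 1) (at 0)"
    using tendsto_divide[OF _ s] by fastforce
  then have "((\<lambda>h::real. h * cot h) \<longlongrightarrow> 1) (at 0)" by (simp add: cot_def mult.commute)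
  then have "((\<lambda>v. (v - \<zeta>) * cot (v - \<zeta>)) \<longlongrightarrow> 1) (at \<zeta>)"
    by (subst LIM_offset_zero_iff[of \<zeta>]) auto
  moreover have "cot (v - z) = cot (v - \<zeta>)" for v
    using cot_shift[OF True, of "v - \<zeta>"] by simp
  ultimately show ?thesis using True by simp
next
  case False
  then have "((\<lambda>v. (v - \<zeta>) * cot (v - z)) \<longlongrightarrow> (\<zeta> - \<zeta>) * cot (\<zeta> - z)) (at \<zeta>)"
    by (intro tendsto_intros) auto
  then show ?thesis using False by simp
qed

text \<open>The multiplicity of \<open>\<zeta>\<close> as a zero of the product of the \<open>sin (v - z i)\<close>.\<close>

definition zero_mult :: "'i set \<Rightarrow> ('i \<Rightarrow> real) \<Rightarrow> real \<Rightarrow> nat" where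
  "zero_mult I z \<zeta> = card {i\<in>I. sin (\<zeta> - z i) = 0}"

text \<open>The multiplicity is the residue of the cotangent sum.\<close>

lemma tendsto_times_cot_sum:
  assumes "finite I"
  shows "((\<lambda>v. (v - \<zeta>) * (\<Sum>i\<in>I. cot (v - z i))) \<longlongrightarrow> real (zero_mult I z \<zeta>)) (at \<zeta>)"
proof -
  have "((\<lambda>v. \<Sum>i\<in>I. (v - \<zeta>) * cot (v - z i)) \<longlongrightarrow> (\<Sum>i\<in>I. if sin (\<zeta> - z i) = 0 then 1 else 0)) (at \<zeta>)"
    by (intro tendsto_sum tendsto_times_cot)
  moreover have "(\<Sum>i\<in>I. if sin (\<zeta> - z i) = 0 then 1 else 0) = real (zero_mult I z \<zeta>)"
    using assms unfolding zero_mult_def by (simp add: sum.If_cases Int_def)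
  ultimately show ?thesis by (simp add: sum_distrib_left)
qed

lemma zero_mult_minus:
  assumes I: "finite I" and N: "\<And>v::real. sin_prod_reflect I z v = 0"
  shows "zero_mult I z (- \<zeta>) = zero_mult I z \<zeta>"
proof -
  have "eventually (\<lambda>v. \<forall>i\<in>I. sin (v - z i) \<noteq> 0 \<and> sin (- v - z i) \<noteq> 0) (at \<zeta>)"
  proof (intro eventually_ball_finite[OF I] ballI)
    fix i
    have "eventually (\<lambda>v. sin (v - z i) \<noteq> 0 \<and> sin (v - (- z i)) \<noteq> 0) (at \<zeta>)"
      by (intro eventually_conj sin_difference_zero_eventually_nonzero)
    moreover have "sin (- v - z i) = - sin (v - (- z i))" for v
      by (metis diff_minus_eq_add minus_add_distrib sin_minus uminus_add_conv_diff add.commute)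
    ultimately show "eventually (\<lambda>v. sin (v - z i) \<noteq> 0 \<and> sin (- v - z i) \<noteq> 0) (at \<zeta>)" by simp
  qed
  then have "eventually (\<lambda>v. (v - \<zeta>) * (\<Sum>i\<in>I. cot (v - z i)) = (v - \<zeta>) * (\<Sum>i\<in>I. cot (v - (- z i)))) (at \<zeta>)"
  proof eventually_elim
    case (elim v)
    have nz: "sin_prod I z v \<noteq> 0" "sin_prod I z (- v) \<noteq> 0"
      using elim I unfolding sin_prod_def by auto
    have "(\<Sum>i\<in>I. cot (v - z i)) * sin_prod I z v * sin_prod I z (- v)
        + (\<Sum>i\<in>I. cot (- v - z i)) * sin_prod I z (- v) * sin_prod I z v = 0"
      using N[of v] elim unfolding sin_prod_reflect_def
      by (simp add: sin_prod'_eq[OF I])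
    then have "((\<Sum>i\<in>I. cot (v - z i)) + (\<Sum>i\<in>I. cot (- v - z i))) * (sin_prod I z v * sin_prod I z (- v)) = 0"
      by (simp add: algebra_simps)
    then have "(\<Sum>i\<in>I. cot (v - z i)) = - (\<Sum>i\<in>I. cot (- v - z i))" using nz by simp
    also have "\<dots> = (\<Sum>i\<in>I. cot (v - (- z i)))"
      by (simp flip: sum_negf cot_minus add: add.commute)
    finally show ?case by simp
  qed
  then have "((\<lambda>v. (v - \<zeta>) * (\<Sum>i\<in>I. cot (v - (- z i)))) \<longlongrightarrow> real (zero_mult I z \<zeta>)) (at \<zeta>)"
    by (rule Lim_transform_eventually[OF tendsto_times_cot_sum[OF I]])
  then have "real (zero_mult I z \<zeta>) = real (zero_mult I (\<lambda>i. - z i) \<zeta>)"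
    using tendsto_times_cot_sum[OF I, of \<zeta> "\<lambda>i. - z i"] LIM_unique by blast
  moreover have "(sin (\<zeta> - - z i) = 0) = (sin (- \<zeta> - z i) = 0)" for i
    using sin_minus[of "\<zeta> + z i"] by simp
  ultimately show ?thesis unfolding zero_mult_def by simp
qed

lemma DERIV_compose_abs:
  fixes v :: real
  assumes "v \<noteq> 0" "(f has_real_derivative D) (at \<bar>v\<bar>)"
  shows "((\<lambda>x. f \<bar>x\<bar>) has_real_derivative sgn v * D) (at v)"
proof (cases "v > 0")
  case True
  then have "(f has_real_derivative sgn v * D) (at v)" using assms by simp
  then show ?thesis
    by (rule has_field_derivative_transform_within_open[where S = "{0<..}"]) (use True in auto)
next
  case False
  then have "((\<lambda>x. f (- x)) has_real_derivative sgn v * D) (at v)"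
    using assms DERIV_mirror[of f D v] by simp
  then show ?thesis
    by (rule has_field_derivative_transform_within_open[where S = "{..<0}"]) (use False assms in auto)
qed

text \<open>The extension solves the same differential equation on both sides of \<open>0\<close> and is twice
differentiable there, so that the equation raises its order of differentiability step by step.\<close>

lemma even_extension_Ck:
  fixes f :: "real \<Rightarrow> real"
  assumes f: "\<And>s. (f has_real_derivative fd s) (at s)" "\<And>s. (fd has_real_derivative fdd s) (at s)"
    and d: "d > 0" and range: "\<And>s. s \<in> {0..<d} \<Longrightarrow> f s \<in> {a..b}" and ode: "\<And>s. s \<in> {0..<d} \<Longrightarrow> fdd s = g (f s)"
    and g: "\<And>k. Ck_on k {a..b} g" and zero: "fd 0 = 0"
  shows "Ck_on k {-d<..<d} (\<lambda>v. f \<bar>v\<bar>)" "Ck_on k {-d<..<d} (\<lambda>v. sgn v * fd \<bar>v\<bar>)"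
proof -
  have D: "((\<lambda>v. f \<bar>v\<bar>) has_real_derivative sgn v * fd \<bar>v\<bar>) (at v)" for v
  proof (cases "v = 0")
    case True
    have "(f has_real_derivative 0) (at 0)" using f(1)[of 0] zero by simp
    then have l: "((\<lambda>h. f h - f 0) \<longlongrightarrow> 0) (at 0)" and q: "((\<lambda>h. (f h - f 0) / h) \<longlongrightarrow> 0) (at 0)"
      using DERIV_isCont[of f 0 0] by (simp_all add: DERIV_def isCont_def LIM_zero)
    have "((\<lambda>h. \<bar>(f h - f 0) / h\<bar>) \<longlongrightarrow> 0) (at 0)" using tendsto_rabs_zero[OF q] .
    moreover have "filterlim abs (at 0) (at (0::real))"
      unfolding filterlim_at by (auto simp: eventually_at_filter intro!: tendsto_rabs_zero)
    ultimately have "((\<lambda>h. \<bar>(f \<bar>h\<bar> - f 0) / \<bar>h\<bar>\<bar>) \<longlongrightarrow> 0) (at 0)"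
      by (rule filterlim_compose)
    then have "((\<lambda>h. (f \<bar>h\<bar> - f 0) / h) \<longlongrightarrow> 0) (at 0)"
      by (simp add: tendsto_rabs_zero_iff abs_divide flip: tendsto_rabs_zero_iff[of "\<lambda>h. (f \<bar>h\<bar> - f 0) / h"])
    then show ?thesis using True by (simp add: DERIV_def)
  next
    case False
    then show ?thesis by (rule DERIV_compose_abs[OF _ f(1)])
  qed
  have D2: "((\<lambda>v. sgn v * fd \<bar>v\<bar>) has_real_derivative g (f \<bar>v\<bar>)) (at v)" if v: "v \<in> {-d<..<d}" for v
  proof (cases "v = 0")
    case True
    have q: "((\<lambda>h. fd h / h) \<longlongrightarrow> g (f 0)) (at 0)"
      using f(2)[of 0] zero ode[of 0] d by (simp add: DERIV_def)
    moreover have "filterlim abs (at 0) (at (0::real))"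
      unfolding filterlim_at by (auto simp: eventually_at_filter intro!: tendsto_rabs_zero)
    ultimately have "((\<lambda>h. fd \<bar>h\<bar> / \<bar>h\<bar>) \<longlongrightarrow> g (f 0)) (at 0)"
      by (rule filterlim_compose)
    moreover have "fd \<bar>h\<bar> / \<bar>h\<bar> = sgn h * fd \<bar>h\<bar> / h" for h :: real
      by (cases h "0::real" rule: linorder_cases) auto
    ultimately show ?thesis using True by (simp add: DERIV_def)
  next
    case False
    have "((\<lambda>x. sgn v * fd \<bar>x\<bar>) has_real_derivative sgn v * (sgn v * fdd \<bar>v\<bar>)) (at v)"
      by (rule DERIV_cmult[OF DERIV_compose_abs[OF False f(2)]])
    moreover have "sgn v * (sgn v * fdd \<bar>v\<bar>) = g (f \<bar>v\<bar>)"
    proof -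
      have "\<bar>v\<bar> \<in> {0..<d}" using v by auto
      then show ?thesis using False ode[of "\<bar>v\<bar>"] by (cases "v > 0") auto
    qed
    ultimately have "((\<lambda>x. sgn v * fd \<bar>x\<bar>) has_real_derivative g (f \<bar>v\<bar>)) (at v)" by simp
    moreover have "open (if v > 0 then {0<..} else {..<0::real})" "v \<in> (if v > 0 then {0<..} else {..<0})"
      using False by auto
    ultimately show ?thesis
      by (rule has_field_derivative_transform_within_open) (use False in \<open>auto split: if_splits\<close>)
  qed
  have "Ck_on k {-d<..<d} (\<lambda>v. f \<bar>v\<bar>) \<and> Ck_on k {-d<..<d} (\<lambda>v. sgn v * fd \<bar>v\<bar>)"
  proof (induction k)
    case 0
    show ?case using D D2 by (auto intro!: DERIV_continuous_on DERIV_subset[OF D] DERIV_subset[OF D2])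
  next
    case (Suc k)
    have "Ck_on k {-d<..<d} (\<lambda>v. g (f \<bar>v\<bar>))"
      by (rule Ck_on_compose[OF g]) (use Suc range in auto)
    then show ?case
      using Suc
      by (intro conjI Ck_on_real_Suc[OF DERIV_subset[OF D]] Ck_on_real_Suc[OF DERIV_subset[OF D2]]) auto
  qed
  then show "Ck_on k {-d<..<d} (\<lambda>v. f \<bar>v\<bar>)" "Ck_on k {-d<..<d} (\<lambda>v. sgn v * fd \<bar>v\<bar>)" by auto
qed

text \<open>Write \<open>h\<close> for the cotangent sum and \<open>N\<close> for the numerator of its even part. Since \<open>fd h = C \<circ> f\<close> for
\<open>s > 0\<close>, and the even extensions of \<open>f\<close> and \<open>C \<circ> f\<close> are smooth, multiplying out the denominators
exhibits \<open>sgn v * (fd v * N v)\<close>, with \<open>fd\<close> extended as an odd function, as a smooth function. Hence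
\<open>N\<close> vanishes to infinite order at \<open>0\<close>, and being analytic it is zero.\<close>

lemma focal_reflection:
  fixes f :: "real \<Rightarrow> real"
  assumes f: "\<And>s. (f has_real_derivative fd s) (at s)" "\<And>s. (fd has_real_derivative fdd s) (at s)"
    and d: "d > 0" and range: "\<And>s. s \<in> {0..<d} \<Longrightarrow> f s \<in> {a..b}" and ode: "\<And>s. s \<in> {0..<d} \<Longrightarrow> fdd s = g (f s)"
    and g: "\<And>k. Ck_on k {a..b} g" and C: "\<And>k. Ck_on k {a..b} C"
    and zero: "fd 0 = 0" "fdd 0 \<noteq> 0"
    and I: "finite I" and nz: "\<And>s i. s \<in> {0<..<d} \<Longrightarrow> i \<in> I \<Longrightarrow> sin (s - z i) \<noteq> 0"
    and trace: "\<And>s. s \<in> {0<..<d} \<Longrightarrow> fd s * (\<Sum>i\<in>I. cot (s - z i)) = C (f s)"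
  shows "zero_mult I z (- \<zeta>) = zero_mult I z \<zeta>"
proof -
  let ?P = "sin_prod I z :: real \<Rightarrow> real" and ?P' = "sin_prod' I z :: real \<Rightarrow> real"
    and ?N = "sin_prod_reflect I z :: real \<Rightarrow> real"
  let ?f = "\<lambda>v. f \<bar>v\<bar>" and ?fd = "\<lambda>v. sgn v * fd \<bar>v\<bar>"
  let ?S = "{-d<..<d}"
  define Q where "Q v = ?fd v * ?N v" for v
  define T where "T v = 2 * C (?f v) * ?P v * ?P (- v) - ?fd v * (?P' v * ?P (- v) - ?P' (- v) * ?P v)" for v
  have P: "Ck_on k ?S ?P" "Ck_on k ?S ?P'" "Ck_on k ?S (\<lambda>v. ?P (- v))" "Ck_on k ?S (\<lambda>v. ?P' (- v))" for k
    using Ck_on_sin_prod[of k ?S I z] Ck_on_compose[of k UNIV ?P ?S uminus] Ck_on_compose[of k UNIV ?P' ?S uminus]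
      Ck_on_sin_prod[of k UNIV I z] Ck_on_minus[OF Ck_on_linear[OF bounded_linear_ident], of k ?S] by auto
  have E: "Ck_on k ?S ?f" "Ck_on k ?S ?fd" for k
    using even_extension_Ck[OF f d range ode g zero(1)] by auto
  have CE: "Ck_on k ?S (\<lambda>v. C (?f v))" for k
    by (rule Ck_on_compose[OF C E(1)]) (use range in auto)
  have Qk: "Ck_on k ?S Q" for k
    unfolding Q_def sin_prod_reflect_def by (intro Ck_on_mult Ck_on_add P E)
  have Tk: "Ck_on k ?S T" for k
    unfolding T_def by (intro Ck_on_mult Ck_on_diff CE P E Ck_on_const)
  have key: "C (f s) * ?P s = fd s * ?P' s" if "s \<in> {0<..<d}" for s
  proof -
    have "?P' s = (\<Sum>i\<in>I. cot (s - z i)) * ?P s"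
      by (rule sin_prod'_eq[OF I nz[OF that]])
    then show ?thesis using trace[OF that] by (simp flip: mult.assoc)
  qed
  \<comment> \<open>for negative \<open>v\<close> the trace equation is used at \<open>- v\<close>\<close>
  have TQ: "T v = sgn v * Q v" if v: "v \<in> ?S" "v \<noteq> 0" for v
  proof (cases "v > 0")
    case True
    have "2 * C (f v) * ?P v * ?P (- v) = 2 * (fd v * ?P' v) * ?P (- v)"
      using key[of v] True v by simp
    then show ?thesis
      using True unfolding T_def Q_def sin_prod_reflect_def by (simp add: algebra_simps)
  next
    case False
    have "2 * C (f (- v)) * ?P v * ?P (- v) = 2 * (fd (- v) * ?P' (- v)) * ?P v"
      using key[of "- v"] False v by simp
    then show ?thesis
      using False v unfolding T_def Q_def sin_prod_reflect_def by (simp add: algebra_simps)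
  qed
  \<comment> \<open>near \<open>0\<close> the derivative of \<open>f\<close> is comparable to its argument\<close>
  have "((\<lambda>h. fd h / h) \<longlongrightarrow> fdd 0) (at 0)" using f(2)[of 0] zero by (simp add: DERIV_def)
  then have "eventually (\<lambda>h. dist (fd h / h) (fdd 0) < \<bar>fdd 0\<bar> / 2) (at 0)"
    using zero(2) by (intro tendstoD) auto
  then obtain r where r: "r > 0" "\<And>h. h \<noteq> 0 \<Longrightarrow> \<bar>h\<bar> < r \<Longrightarrow> dist (fd h / h) (fdd 0) < \<bar>fdd 0\<bar> / 2"
    unfolding eventually_at by (auto simp: dist_real_def)
  define e where "e = min (d / 2) r"
  have e: "e > 0" "e \<le> d / 2" "e \<le> r" "e < d" unfolding e_def using d r by auto
  define c where "c = \<bar>fdd 0\<bar> / 2"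
  have c: "c > 0" unfolding c_def using zero by simp
  have "\<exists>K. \<forall>v\<in>{0<..<e}. \<bar>?N v\<bar> \<le> K * v ^ k" for k
  proof -
    obtain K where K: "\<forall>v\<in>{-(d/2)..d/2}. \<bar>Q v\<bar> \<le> K * \<bar>v\<bar> ^ Suc k"
      using smooth_sign_times_smooth_flat[OF d Tk Qk TQ, of "d/2" "Suc k"] d by auto
    have "\<bar>?N v\<bar> \<le> K / c * v ^ k" if v: "v \<in> {0<..<e}" for v
    proof -
      have "\<bar>fd v / v - fdd 0\<bar> < c" using r(2)[of v] v e unfolding c_def by (simp add: dist_real_def)
      moreover have "\<bar>fdd 0\<bar> = 2 * c" unfolding c_def by simp
      ultimately have "\<bar>fd v / v\<bar> \<ge> c" by linarith
      then have "c * v \<le> \<bar>fd v\<bar>" using v by (simp add: abs_divide field_simps)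
      then have "c * v * \<bar>?N v\<bar> \<le> \<bar>fd v\<bar> * \<bar>?N v\<bar>" by (intro mult_right_mono) auto
      also have "\<dots> = \<bar>Q v\<bar>" unfolding Q_def using v by (simp add: abs_mult)
      also have "\<dots> \<le> K * v ^ Suc k" using bspec[OF K, of v] v e by auto
      finally have "v * (c * \<bar>?N v\<bar>) \<le> v * (K * v ^ k)" by (simp add: mult_ac)
      then have "c * \<bar>?N v\<bar> \<le> K * v ^ k" using v by simp
      then show ?thesis using c by (simp add: field_simps)
    qed
    then show ?thesis by blast
  qed
  then have "sin_prod_reflect I z (w :: complex) = 0" for w
    by (rule sin_prod_reflect_zero_if_flat[OF e(1)])
  then have "?N v = 0" for v
    using sin_prod_reflect_of_real[of I z v] by simp
  then show ?thesis by (rule zero_mult_minus[OF I])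
qed

section \<open>Cotangent sums over equally spaced points\<close>

lemma one_minus_cis_double: "1 - cis (2 * x) = - 2 * \<i> * of_real (sin x) * cis x"
  by (simp add: complex_eq_iff cos_double_sin sin_double power2_eq_square)

lemma cot_conv_cis:
  assumes "sin x \<noteq> 0"
  shows "complex_of_real (cot x) = \<i> * (1 - 2 / (1 - cis (2 * x)))"
proof -
  have "1 - cis (2 * x) \<noteq> 0" using assms unfolding one_minus_cis_double by simp
  moreover have "complex_of_real (cot x) * (1 - cis (2 * x)) = \<i> * ((1 - cis (2 * x)) - 2)"
  proof -
    have "complex_of_real (cot x) * of_real (sin x) = of_real (cos x)"
      using assms by (metis cot_def nonzero_divide_eq_eq of_real_mult)
    moreover have "complex_of_real (cot x) * (1 - cis (2 * x))
        = - 2 * \<i> * (complex_of_real (cot x) * of_real (sin x)) * cis x"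
      unfolding one_minus_cis_double by (simp add: mult_ac)
    ultimately have "complex_of_real (cot x) * (1 - cis (2 * x)) = - 2 * \<i> * of_real (cos x) * cis x"
      by simp
    also have "\<dots> = \<i> * ((1 - cis (2 * x)) - 2)"
      by (simp add: complex_eq_iff cos_double_cos sin_double power2_eq_square)
    finally show ?thesis .
  qed
  ultimately show ?thesis by (simp add: field_simps)
qed

text \<open>Expand each term as \<open>1 / (1 - y) = (\<Sum>k<N. y ^ k) / (1 - y ^ N)\<close>; after summation over the roots of
unity only \<open>k = 0\<close> survives.\<close>

lemma sum_inverse_one_minus_roots_of_unity:
  assumes N: "N > 0" and w: "w ^ N \<noteq> (1::complex)"
  shows "(\<Sum>j<N. 1 / (1 - w * cis (- 2 * pi / real N) ^ j)) = of_nat N / (1 - w ^ N)"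
proof -
  define \<omega> where "\<omega> = cis (- 2 * pi / real N)"
  have "real N * (- 2 * pi / real N) = - (2 * pi)" using N by simp
  then have "\<omega> ^ N = cis (- (2 * pi))" unfolding \<omega>_def Complex.DeMoivre by (rule arg_cong)
  also have "\<dots> = 1" by (simp add: complex_eq_iff)
  finally have \<omega>N: "\<omega> ^ N = 1" .
  have geo: "1 / (1 - w * \<omega> ^ j) = (\<Sum>k<N. (w * \<omega> ^ j) ^ k) / (1 - w ^ N)" for j
  proof -
    have "(\<omega> ^ j) ^ N = (\<omega> ^ N) ^ j" by (metis mult.commute power_mult)
    then have p: "(w * \<omega> ^ j) ^ N = w ^ N" using \<omega>N by (simp add: power_mult_distrib)
    have "1 - w ^ N = (1 - w * \<omega> ^ j) * (\<Sum>k<N. (w * \<omega> ^ j) ^ k)"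
      using one_diff_power_eq[of "w * \<omega> ^ j" N] p by simp
    moreover have "1 - w * \<omega> ^ j \<noteq> 0" using p w by (metis power_one right_minus_eq)
    ultimately show ?thesis using w by (simp add: field_simps)
  qed
  have inner: "(\<Sum>j<N. (w * \<omega> ^ j) ^ k) = (if k = 0 then of_nat N else 0)" if k: "k < N" for k
  proof (cases "k = 0")
    case False
    define x where "x = - (pi * real k / real N)"
    have "sin (pi * real k / real N) > 0"
      using k False N by (intro sin_gt_zero) (auto simp: field_simps)
    then have "sin x \<noteq> 0" unfolding x_def by simp
    moreover have "\<omega> ^ k = cis (2 * x)" unfolding \<omega>_def x_def Complex.DeMoivre
      by (intro arg_cong[of _ _ cis]) (simp add: field_simps)
    ultimately have "\<omega> ^ k \<noteq> 1" using one_minus_cis_double[of x] by auto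
    moreover have "(1 - \<omega> ^ k) * (\<Sum>j<N. (\<omega> ^ k) ^ j) = 0"
    proof -
      have "(\<omega> ^ k) ^ N = (\<omega> ^ N) ^ k" by (metis mult.commute power_mult)
      then show ?thesis using one_diff_power_eq[of "\<omega> ^ k" N] \<omega>N by simp
    qed
    ultimately have "(\<Sum>j<N. (\<omega> ^ k) ^ j) = 0" by simp
    moreover have "(w * \<omega> ^ j) ^ k = w ^ k * (\<omega> ^ k) ^ j" for j
      by (simp add: power_mult_distrib mult.commute flip: power_mult)
    ultimately show ?thesis using False by (simp flip: sum_distrib_left)
  qed simp
  have "(\<Sum>j<N. 1 / (1 - w * \<omega> ^ j)) = (\<Sum>k<N. \<Sum>j<N. (w * \<omega> ^ j) ^ k) / (1 - w ^ N)"
    unfolding geo by (subst sum.swap) (simp add: sum_divide_distrib)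
  also have "(\<Sum>k<N. \<Sum>j<N. (w * \<omega> ^ j) ^ k) = of_nat N"
    using N inner by simp
  finally show ?thesis unfolding \<omega>_def .
qed

lemma cot_sum_equally_spaced:
  assumes N: "N > 0" and s: "sin (real N * v) \<noteq> 0"
  shows "(\<Sum>j<N. cot (v - real j * pi / real N)) = real N * cot (real N * v)"
proof -
  have wN: "cis (2 * v) ^ N = cis (2 * (real N * v))"
    unfolding Complex.DeMoivre by (intro arg_cong[of _ _ cis]) (simp add: mult_ac)
  have w1: "cis (2 * v) ^ N \<noteq> 1"
    unfolding wN using s one_minus_cis_double[of "real N * v"] by auto
  have sj: "sin (v - real j * pi / real N) \<noteq> 0" for j
  proof
    assume "sin (v - real j * pi / real N) = 0"
    then obtain m :: int where "v - real j * pi / real N = of_int m * pi" using sin_zero_iff_int2 by blast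
    then have "real N * v = of_int (int N * m + int j) * pi" using N by (simp add: field_simps)
    then show False using s sin_zero_iff_int2 by blast
  qed
  have cj: "cis (2 * (v - real j * pi / real N)) = cis (2 * v) * cis (- 2 * pi / real N) ^ j" for j
    unfolding Complex.DeMoivre cis_mult by (intro arg_cong[of _ _ cis]) (simp add: algebra_simps)
  have "complex_of_real (\<Sum>j<N. cot (v - real j * pi / real N))
      = (\<Sum>j<N. \<i> * (1 - 2 / (1 - cis (2 * v) * cis (- 2 * pi / real N) ^ j)))"
    unfolding of_real_sum cot_conv_cis[OF sj] cj ..
  also have "\<dots> = \<i> * (of_nat N - 2 * (\<Sum>j<N. 1 / (1 - cis (2 * v) * cis (- 2 * pi / real N) ^ j)))"
    by (simp add: sum_distrib_left sum_subtractf algebra_simps)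
  also have "\<dots> = of_nat N * (\<i> * (1 - 2 / (1 - cis (2 * (real N * v)))))"
    unfolding sum_inverse_one_minus_roots_of_unity[OF N w1] wN by (simp add: algebra_simps)
  also have "\<dots> = complex_of_real (real N * cot (real N * v))"
    using cot_conv_cis[OF s] by simp
  finally show ?thesis using of_real_eq_iff by blast
qed

text \<open>For odd \<open>l\<close> all coefficients agree. For even \<open>l\<close> the terms with even and with odd \<open>j\<close> are two
equally spaced sums of half the length, the second one shifted by half a period.\<close>

lemma alternating_cot_sum:
  fixes m m' :: nat
  assumes l: "l > 0" and odd: "odd l \<Longrightarrow> m' = m" and s: "sin (real l * v) \<noteq> 0"
  shows "(\<Sum>j<l. real (if even j then m else m') * cot (v - real j * pi / real l)) * sin (real l * v)
    = real l / 2 * (real m - real m') + (\<Sum>j<l. real (if even j then m else m')) * cos (real l * v)"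
proof (cases "odd l")
  case True
  have "(\<Sum>j<l. real (if even j then m else m') * cot (v - real j * pi / real l)) = real m * (real l * cot (real l * v))"
    unfolding cot_sum_equally_spaced[OF l s, symmetric] sum_distrib_left odd[OF True] by simp
  then show ?thesis unfolding odd[OF True] using s by (simp add: cot_def)
next
  case False
  then obtain N where N: "l = 2 * N" by (auto elim: evenE)
  have split: "(\<Sum>j<2 * N. h j) = (\<Sum>j<N. h (2 * j)) + (\<Sum>j<N. h (2 * j + 1))" for h :: "nat \<Rightarrow> real"
    by (induction N) auto
  have N0: "N > 0" using l N by simp
  define x where "x = real N * v"
  have dbl: "sin (real l * v) = 2 * sin x * cos x" "cos (real l * v) = 2 * (cos x)\<^sup>2 - 1"
    "cos (real l * v) = 1 - 2 * (sin x)\<^sup>2"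
    unfolding x_def N using sin_double[of "real N * v"] cos_double_cos[of "real N * v"] cos_double_sin[of "real N * v"]
    by (simp_all add: mult_ac)
  have nz: "sin x \<noteq> 0" "cos x \<noteq> 0" using s dbl(1) by auto
  have half: "real N * (v - pi / real l) = x - pi / 2" using N0 unfolding N x_def by (simp add: field_simps)
  have sh: "sin (x - pi / 2) = - cos x" "cos (x - pi / 2) = sin x" by (simp_all add: sin_diff cos_diff)
  have "v - real (2 * j) * pi / real l = v - real j * pi / real N" for j
    using N0 unfolding N by (simp add: field_simps)
  then have e: "(\<Sum>j<N. cot (v - real (2 * j) * pi / real l)) = real N * (cos x / sin x)"
    using cot_sum_equally_spaced[OF N0, of v] nz unfolding x_def by (simp add: cot_def)
  have "v - real (2 * j + 1) * pi / real l = (v - pi / real l) - real j * pi / real N" for j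
    using N0 unfolding N by (simp add: field_simps)
  then have o: "(\<Sum>j<N. cot (v - real (2 * j + 1) * pi / real l)) = real N * (sin x / - cos x)"
    using cot_sum_equally_spaced[OF N0, of "v - pi / real l"] nz half sh by (simp only:) (simp add: cot_def)
  have L: "(\<Sum>j<l. real (if even j then m else m') * cot (v - real j * pi / real l))
      = real m * (real N * (cos x / sin x)) + real m' * (real N * (sin x / - cos x))"
    unfolding e[symmetric] o[symmetric] sum_distrib_left
    by (subst N, subst split) simp
  have R: "(\<Sum>j<l. real (if even j then m else m')) = real N * real m + real N * real m'"
    by (subst N, subst split) simp
  have "(real m * (real N * (cos x / sin x)) + real m' * (real N * (sin x / - cos x))) * (2 * sin x * cos x)
    = real N * real m * (2 * (cos x)\<^sup>2) - real N * real m' * (2 * (sin x)\<^sup>2)"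
    using nz by (simp add: field_simps power2_eq_square)
  also have "\<dots> = real N * real m * (1 + cos (real l * v)) - real N * real m' * (1 - cos (real l * v))"
    using dbl(2,3) by simp
  finally show ?thesis unfolding L R dbl(1)[symmetric] by (simp add: N algebra_simps)
qed

lemma sin_diff_eq_0_sym: "sin (x - y) = 0 \<longleftrightarrow> sin (y - x) = (0::real)"
  using sin_minus[of "x - y"] by simp

text \<open>Two reflections compose to the translation by \<open>2 D\<close>. As there is no zero strictly between \<open>0\<close> and
\<open>D\<close>, the zeros are the integer multiples of \<open>D\<close>; the period \<open>\<pi>\<close> of the sine is one of them.\<close>

lemma focal_lattice:
  assumes D: "D > 0"
    and refl0: "\<And>\<zeta>. zero_mult I z (- \<zeta>) = zero_mult I z \<zeta>"
    and reflD: "\<And>\<zeta>. zero_mult I z (D + \<zeta>) = zero_mult I z (D - \<zeta>)"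
    and inside: "\<And>\<zeta>. 0 < \<zeta> \<Longrightarrow> \<zeta> < D \<Longrightarrow> zero_mult I z \<zeta> = 0"
    and pos0: "zero_mult I z 0 > 0" and posD: "zero_mult I z D > 0"
  obtains l where "l > 0" "real l * D = pi"
    "\<And>\<zeta>. zero_mult I z \<zeta> > 0 \<longleftrightarrow> (\<exists>k::int. \<zeta> = of_int k * D)"
    "\<And>j::nat. zero_mult I z (real j * D) = (if even j then zero_mult I z 0 else zero_mult I z D)"
    "odd l \<Longrightarrow> zero_mult I z D = zero_mult I z 0"
proof -
  let ?m = "zero_mult I z"
  have per: "?m (\<zeta> + 2 * D) = ?m \<zeta>" for \<zeta>
    using reflD[of "\<zeta> + D"] refl0[of \<zeta>] by (simp add: algebra_simps)
  have perk: "?m (\<zeta> + real k * (2 * D)) = ?m \<zeta>" for \<zeta> k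
  proof (induction k)
    case (Suc k)
    then show ?case using per[of "\<zeta> + real k * (2 * D)"] by (simp add: algebra_simps)
  qed simp
  have peri: "?m (\<zeta> + of_int k * (2 * D)) = ?m \<zeta>" for \<zeta> and k :: int
  proof (cases "k \<ge> 0")
    case True
    then show ?thesis using perk[of \<zeta> "nat k"] by simp
  next
    case False
    then show ?thesis using perk[of "\<zeta> + of_int k * (2 * D)" "nat (- k)"] by (simp add: algebra_simps)
  qed
  have nats: "?m (real j * D) = (if even j then ?m 0 else ?m D)" for j
  proof (cases "even j")
    case True
    then obtain i where "j = 2 * i" by (auto elim: evenE)
    then show ?thesis using True perk[of 0 i] by (simp add: mult_ac)
  next
    case False
    then obtain i where "j = 2 * i + 1" by (auto elim: oddE)
    then show ?thesis using False perk[of D i] by (simp add: algebra_simps)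
  qed
  have lattice: "?m \<zeta> > 0 \<longleftrightarrow> (\<exists>k::int. \<zeta> = of_int k * D)" for \<zeta>
  proof
    assume m: "?m \<zeta> > 0"
    define k where "k = \<lfloor>\<zeta> / D\<rfloor>"
    define r where "r = \<zeta> - of_int k * D"
    have r: "0 \<le> r" "r < D"
      unfolding r_def k_def using D floor_divide_lower[OF D, of \<zeta>] floor_divide_upper[OF D, of \<zeta>]
      by (simp_all add: algebra_simps)
    have "?m r > 0"
    proof (cases "even k")
      case True
      then obtain i where "k = 2 * i" by (auto elim: evenE)
      then show ?thesis using m peri[of \<zeta> "- i"] unfolding r_def by (simp add: algebra_simps)
    next
      case False
      then obtain i where i: "k = 2 * i + 1" by (auto elim: oddE)
      then have "\<zeta> = D + r + of_int i * (2 * D)" unfolding r_def by (simp add: algebra_simps)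
      then have "?m (D + r) > 0" using m peri by metis
      then have p: "?m (D - r) > 0" using reflD by simp
      have "\<not> (0 < D - r \<and> D - r < D)" using p inside by (metis less_irrefl)
      then have "r = 0" using r by linarith
      then show ?thesis using pos0 by simp
    qed
    then have "\<not> 0 < r" using inside r by (metis less_irrefl)
    then have "\<zeta> = of_int k * D" using r unfolding r_def by simp
    then show "\<exists>k::int. \<zeta> = of_int k * D" by blast
  next
    assume "\<exists>k::int. \<zeta> = of_int k * D"
    then obtain k :: int where k: "\<zeta> = of_int k * D" by blast
    show "?m \<zeta> > 0"
    proof (cases "k \<ge> 0")
      case True
      then show ?thesis using nats[of "nat k"] pos0 posD k by (auto split: if_splits)
    next
      case False
      then have "?m (- \<zeta>) > 0" using nats[of "nat (- k)"] pos0 posD k by (auto split: if_splits)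
      then show ?thesis using refl0 by simp
    qed
  qed
  have "sin (pi - z i) = 0 \<longleftrightarrow> sin (0 - z i) = 0" for i by (simp add: sin_diff)
  then have mpi: "?m pi = ?m 0" unfolding zero_mult_def by simp
  then obtain k :: int where k: "pi = of_int k * D" using pos0 lattice[of pi] by auto
  have "k > 0" using k D pi_gt_zero by (metis mult_le_0_iff not_le of_int_0_less_iff less_imp_le)
  define l where "l = nat k"
  have l: "l > 0" "real l * D = pi" unfolding l_def using \<open>k > 0\<close> k by simp_all
  moreover have "?m D = ?m 0" if "odd l" using nats[of l] l(2) mpi that by simp
  ultimately show thesis using that lattice nats by blast
qed

text \<open>The \<open>z i\<close> represent the multiples \<open>j D\<close> with \<open>0 \<le> j < l\<close> modulo \<open>\<pi>\<close>, where \<open>l D = \<pi>\<close>, each at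
least once. Counting classes gives \<open>l = card (z ` I)\<close>, and grouping the sum by classes leads to
\<open>alternating_cot_sum\<close>. The strict bound on \<open>\<alpha>\<close> records that both multiplicities are positive.\<close>

lemma focal_structure:
  assumes I: "finite I" and D: "D > 0"
    and refl0: "\<And>\<zeta>. zero_mult I z (- \<zeta>) = zero_mult I z \<zeta>"
    and reflD: "\<And>\<zeta>. zero_mult I z (D + \<zeta>) = zero_mult I z (D - \<zeta>)"
    and inside: "\<And>\<zeta>. 0 < \<zeta> \<Longrightarrow> \<zeta> < D \<Longrightarrow> zero_mult I z \<zeta> = 0"
    and pos0: "zero_mult I z 0 > 0" and posD: "zero_mult I z D > 0"
    and inj: "\<And>i j. i \<in> I \<Longrightarrow> j \<in> I \<Longrightarrow> sin (z i - z j) = 0 \<Longrightarrow> z i = z j"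
  obtains \<alpha> where "card (z ` I) > 0" "real (card (z ` I)) * D = pi" "\<bar>\<alpha>\<bar> < real (card I)"
    "\<And>v. sin (real (card (z ` I)) * v) \<noteq> 0 \<Longrightarrow>
      (\<Sum>i\<in>I. cot (v - z i)) * sin (real (card (z ` I)) * v) = \<alpha> + real (card I) * cos (real (card (z ` I)) * v)"
proof -
  let ?m = "zero_mult I z"
  obtain l where l: "l > 0" "real l * D = pi"
    and lattice: "\<And>\<zeta>. ?m \<zeta> > 0 \<longleftrightarrow> (\<exists>k::int. \<zeta> = of_int k * D)"
    and nats: "\<And>j::nat. ?m (real j * D) = (if even j then ?m 0 else ?m D)"
    and odd: "odd l \<Longrightarrow> ?m D = ?m 0"
    by (rule focal_lattice[OF D refl0 reflD inside pos0 posD]) (assumption | rule that)+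
  have Dl: "real j * D = real j * pi / real l" for j using l by (simp add: field_simps flip: l(2))
  have uniq: "j = j'" if "j < l" "j' < l" "sin (real j * D - real j' * D) = 0" for j j' :: nat
  proof -
    have "real j * D < pi" "real j' * D < pi" using that D by (simp_all flip: l(2))
    moreover have "0 \<le> real j * D" "0 \<le> real j' * D" using D by simp_all
    ultimately have "real j * D - real j' * D = 0"
      using that(3) sin_eq_0_pi[of "real j * D - real j' * D"] by linarith
    then show ?thesis using D by simp
  qed
  have trans: "sin (x - y) = 0" if "sin (x - w) = 0" "sin (w - y) = 0" for x y w :: real
  proof -
    have "sin ((x - w) + (w - y)) = 0" unfolding sin_add using that by simp
    then show ?thesis by simp
  qed
  have "\<exists>j. j < l \<and> sin (real j * D - z i) = 0" if i: "i \<in> I" for i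
  proof -
    have "i \<in> {i' \<in> I. sin (z i - z i') = 0}" using i by simp
    then have "?m (z i) > 0" using I unfolding zero_mult_def card_gt_0_iff by auto
    then obtain k :: int where k: "z i = of_int k * D" using lattice by blast
    define q where "q = k div int l"
    define j where "j = nat (k mod int l)"
    have j: "j < l" "int j = k mod int l" unfolding j_def using l(1) by (auto simp: nat_less_iff)
    have kq: "k = int l * q + int j" using j unfolding q_def by simp
    have "z i = of_int q * (real l * D) + real j * D" unfolding k kq by (simp add: algebra_simps)
    then have "real j * D - z i = of_int (- q) * pi" using l(2) by simp
    then have "sin (real j * D - z i) = 0" using sin_zero_iff_int2 by blast
    then show ?thesis using j by blast
  qed
  \<comment> \<open>\<open>J i\<close> is the multiple of \<open>D\<close> in \<open>[0, \<pi>)\<close> that represents \<open>z i\<close> modulo \<open>\<pi>\<close>\<close>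
  then obtain J where J: "\<And>i. i \<in> I \<Longrightarrow> J i < l" "\<And>i. i \<in> I \<Longrightarrow> sin (real (J i) * D - z i) = 0" by metis
  have fiber: "{i\<in>I. J i = j} = {i\<in>I. sin (real j * D - z i) = 0}" if "j < l" for j
  proof -
    have "J i = j" if i: "i \<in> I" "sin (real j * D - z i) = 0" for i
    proof (rule uniq[OF J(1)[OF i(1)] \<open>j < l\<close>])
      show "sin (real (J i) * D - real j * D) = 0"
        using trans[OF J(2)[OF i(1)]] i(2) sin_diff_eq_0_sym[of "z i"] by simp
    qed
    then show ?thesis using J by auto
  qed
  have cardf: "card {i\<in>I. J i = j} = (if even j then ?m 0 else ?m D)" if "j < l" for j
    using fiber[OF that] nats[of j] unfolding zero_mult_def by simp
  have fib: "(\<Sum>i\<in>I. h (J i)) = (\<Sum>j<l. real (if even j then ?m 0 else ?m D) * h j)" for h :: "nat \<Rightarrow> real"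
  proof -
    have "(\<Sum>i\<in>I. h (J i)) = (\<Sum>j<l. \<Sum>i\<in>{i\<in>I. J i = j}. h (J i))"
      using sum.group[OF I, of "{..<l}" J "\<lambda>i. h (J i)"] J by (simp add: image_subset_iff)
    also have "\<dots> = (\<Sum>j<l. real (card {i\<in>I. J i = j}) * h j)"
      by (intro sum.cong) auto
    finally show ?thesis using cardf by simp
  qed
  have cots: "(\<Sum>i\<in>I. cot (v - z i)) = (\<Sum>j<l. real (if even j then ?m 0 else ?m D) * cot (v - real j * pi / real l))" for v
  proof -
    have "cot (v - z i) = cot (v - real (J i) * D)" if "i \<in> I" for i
      using cot_shift[OF J(2)[OF that], of "v - real (J i) * D"] by simp
    then have "(\<Sum>i\<in>I. cot (v - z i)) = (\<Sum>i\<in>I. cot (v - real (J i) * D))" by simp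
    then show ?thesis using fib[of "\<lambda>j. cot (v - real j * D)"] by (simp add: Dl)
  qed
  have cardI: "real (card I) = (\<Sum>j<l. real (if even j then ?m 0 else ?m D))"
    using fib[of "\<lambda>_. 1"] by simp
  \<comment> \<open>the points of the configuration represent every class of the lattice exactly once\<close>
  have "\<forall>x\<in>z ` I. \<exists>i. i \<in> I \<and> z i = x" by auto
  then obtain r where r: "\<And>x. x \<in> z ` I \<Longrightarrow> r x \<in> I" "\<And>x. x \<in> z ` I \<Longrightarrow> z (r x) = x" by metis
  have "bij_betw (\<lambda>x. J (r x)) (z ` I) {..<l}"
  proof (intro bij_betwI')
    have key: "J i = J i' \<longleftrightarrow> z i = z i'" if "i \<in> I" "i' \<in> I" for i i'
    proof
      assume "J i = J i'"
      then have "sin (z i - z i') = 0"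
        using trans[of "z i" "real (J i) * D" "z i'"] J(2)[OF that(1)] J(2)[OF that(2)]
          sin_diff_eq_0_sym[of "z i"] by simp
      then show "z i = z i'" using inj that by blast
    next
      assume "z i = z i'"
      then have "sin (real (J i) * D - real (J i') * D) = 0"
        using trans[of "real (J i) * D" "z i" "real (J i') * D"] J(2)[OF that(1)] J(2)[OF that(2)]
          sin_diff_eq_0_sym[of "z i"] by simp
      then show "J i = J i'" using uniq J(1) that by blast
    qed
    show "(J (r x) = J (r y)) = (x = y)" if "x \<in> z ` I" "y \<in> z ` I" for x y
      using key[OF r(1)[OF that(1)] r(1)[OF that(2)]] r(2) that by simp
    show "J (r x) \<in> {..<l}" if "x \<in> z ` I" for x using r(1)[OF that] J(1) by simp
    show "\<exists>x\<in>z ` I. y = J (r x)" if "y \<in> {..<l}" for y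
    proof -
      have "card {i\<in>I. J i = y} > 0" using cardf that pos0 posD by simp
      then obtain i where i: "i \<in> I" "J i = y" unfolding card_gt_0_iff by auto
      then have "y = J (r (z i))" using key[OF r(1)[of "z i"] i(1)] r(2)[of "z i"] by simp
      then show ?thesis using i by blast
    qed
  qed
  then have card: "card (z ` I) = l" using bij_betw_same_card by fastforce
  define \<alpha> where "\<alpha> = real l / 2 * (real (?m 0) - real (?m D))"
  have "\<bar>\<alpha>\<bar> < real (card I)"
  proof (cases "odd l")
    case True
    then have "\<alpha> = 0" unfolding \<alpha>_def using odd by simp
    moreover have "card I > 0" using pos0 I unfolding zero_mult_def by (auto simp: card_gt_0_iff)
    ultimately show ?thesis by simp
  next
    case False
    then obtain N where N: "l = 2 * N" by (auto elim: evenE)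
    have split: "(\<Sum>j<2 * N. h j) = (\<Sum>j<N. h (2 * j)) + (\<Sum>j<N. h (2 * j + 1))" for h :: "nat \<Rightarrow> real"
      by (induction N) auto
    have "real (card I) = real N * real (?m 0) + real N * real (?m D)"
      unfolding cardI by (subst N, subst split) simp
    moreover have "\<alpha> = real N * real (?m 0) - real N * real (?m D)"
      unfolding \<alpha>_def N by (simp add: algebra_simps)
    moreover have "real N * real (?m 0) > 0" "real N * real (?m D) > 0" using pos0 posD l(1) N by auto
    ultimately show ?thesis by linarith
  qed
  moreover have "(\<Sum>i\<in>I. cot (v - z i)) * sin (real l * v) = \<alpha> + real (card I) * cos (real l * v)"
    if "sin (real l * v) \<noteq> 0" for v
    unfolding cots cardI \<alpha>_def by (rule alternating_cot_sum[OF l(1) odd that])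
  ultimately show thesis using that[of \<alpha>] l unfolding card by blast
qed

section \<open>Calculus on the unit sphere\<close>

text \<open>The extension that is constant on rays. On the unit sphere its Euclidean gradient is the tangential
gradient, and its Euclidean Hessian computes covariant derivatives.\<close>

definition hom_ext :: "('a::euclidean_space \<Rightarrow> 'b) \<Rightarrow> 'a \<Rightarrow> 'b" where
  "hom_ext f y = f (sgn y)"

definition egrad :: "('a::euclidean_space \<Rightarrow> real) \<Rightarrow> 'a \<Rightarrow> 'a" where
  "egrad f y = (\<Sum>e\<in>Basis. frechet_derivative (hom_ext f) (at y) e *\<^sub>R e)"

definition ehess :: "('a::euclidean_space \<Rightarrow> real) \<Rightarrow> 'a \<Rightarrow> 'a \<Rightarrow> 'a" where
  "ehess f y = frechet_derivative (egrad f) (at y)"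

lemma sgn_on_usphere: "x \<in> usphere \<Longrightarrow> sgn x = x" "y \<noteq> 0 \<Longrightarrow> sgn y \<in> usphere"
  for x y :: "'a::euclidean_space"
  by (auto simp: sgn_div_norm)

lemma hom_ext_on_usphere: "x \<in> usphere \<Longrightarrow> hom_ext f x = f x"
  by (metis hom_ext_def sgn_on_usphere(1))

lemma Ck_on_hom_ext:
  fixes f :: "'a::euclidean_space \<Rightarrow> 'b::euclidean_space"
  assumes "smooth usphere f"
  shows "Ck_on k (- {0}) (hom_ext f)"
proof -
  have "Ck_open k (- {0}) (hom_ext f)"
  proof (rule Ck_open_local)
    fix y :: 'a assume y: "y \<in> - {0}"
    then have "sgn y \<in> usphere" using sgn_on_usphere(2) by simp
    then obtain U h where U: "sgn y \<in> U" "smooth_open U h" "\<forall>z\<in>usphere \<inter> U. f z = h z"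
      using assms unfolding smooth_def by blast
    define V where "V = {z \<in> - {0}. sgn z \<in> U}"
    have "open (- {0::'a} \<inter> sgn -` U)"
      using U(2) Ck_on_continuous[OF Ck_on_sgn]
      by (intro continuous_open_preimage) (auto simp: smooth_open_def open_Compl)
    moreover have "V = - {0} \<inter> sgn -` U" unfolding V_def by auto
    ultimately have V: "open V" by simp
    have "Ck_on k U h" using U(2) unfolding smooth_open_def by (metis Ck_open_iff_Ck_on)
    then have "Ck_on k V (\<lambda>z. h (sgn z))"
      by (rule Ck_on_compose) (auto simp: V_def intro: Ck_on_subset[OF Ck_on_sgn])
    moreover have "hom_ext f z = h (sgn z)" if "z \<in> V" for z
      using that U(3) sgn_on_usphere(2) unfolding V_def hom_ext_def by blast
    ultimately have "Ck_open k V (hom_ext f)"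
      unfolding Ck_open_iff_Ck_on[OF V] by (simp cong: Ck_on_cong)
    then show "\<exists>U. open U \<and> y \<in> U \<and> Ck_open k U (hom_ext f)"
      using V y U(1) unfolding V_def by blast
  qed
  then show ?thesis by (simp add: Ck_open_iff_Ck_on open_Compl)
qed

lemma open_minus_zero: "open (- {0::'a::euclidean_space})"
  by (simp add: open_Compl)

lemma hom_ext_has_derivative:
  fixes f :: "'a::euclidean_space \<Rightarrow> real"
  assumes "smooth usphere f" "y \<noteq> 0"
  shows "(hom_ext f has_derivative (\<lambda>v. egrad f y \<bullet> v)) (at y)"
proof -
  have "Ck_open (Suc 0) (- {0}) (hom_ext f)"
    using Ck_on_hom_ext[OF assms(1)] Ck_open_iff_Ck_on[OF open_minus_zero] by blast
  then have d: "(hom_ext f has_derivative frechet_derivative (hom_ext f) (at y)) (at y)"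
    using assms(2) by (auto simp: differentiable_on_eq_differentiable_at[OF open_minus_zero] frechet_derivative_works)
  have "frechet_derivative (hom_ext f) (at y) v = egrad f y \<bullet> v" for v
  proof -
    have "linear (frechet_derivative (hom_ext f) (at y))" using d has_derivative_linear by blast
    then have "frechet_derivative (hom_ext f) (at y) (\<Sum>e\<in>Basis. (v \<bullet> e) *\<^sub>R e)
        = (\<Sum>e\<in>Basis. (v \<bullet> e) *\<^sub>R frechet_derivative (hom_ext f) (at y) e)"
      by (simp add: linear_sum linear_cmul)
    also have "\<dots> = egrad f y \<bullet> v"
      unfolding egrad_def by (simp add: inner_sum_left inner_sum_right inner_commute mult.commute)
    finally show ?thesis by (simp only: euclidean_representation)
  qed
  then show ?thesis using d by (metis (no_types, lifting) ext)
qed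

lemma Ck_on_egrad:
  assumes "smooth usphere f"
  shows "Ck_on k (- {0}) (egrad f)"
proof -
  have "Ck_open (Suc k) (- {0}) (hom_ext f)"
    using Ck_on_hom_ext[OF assms(1)] Ck_open_iff_Ck_on[OF open_minus_zero] by blast
  then have "Ck_on k (- {0}) (\<lambda>y. frechet_derivative (hom_ext f) (at y) v)" for v
    using Ck_open_iff_Ck_on[OF open_minus_zero] by (metis Ck_open.simps(2))
  then show ?thesis unfolding egrad_def
    by (intro Ck_on_sum Ck_on_scaleR Ck_on_const)
qed

lemma egrad_has_derivative:
  assumes "smooth usphere f" "y \<noteq> 0"
  shows "(egrad f has_derivative ehess f y) (at y)"
    and "continuous_on (- {0}) (\<lambda>y. ehess f y v)"
proof -
  have c: "Ck_open (Suc 0) (- {0}) (egrad f)"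
    using Ck_on_egrad[OF assms(1)] Ck_open_iff_Ck_on[OF open_minus_zero] by blast
  then show "(egrad f has_derivative ehess f y) (at y)"
    using assms(2) unfolding ehess_def
    by (auto simp: differentiable_on_eq_differentiable_at[OF open_minus_zero] frechet_derivative_works)
  show "continuous_on (- {0}) (\<lambda>y. ehess f y v)" using c unfolding ehess_def by simp
qed

lemma linear_ehess:
  assumes "smooth usphere f" "y \<noteq> 0"
  shows "linear (ehess f y)"
  using egrad_has_derivative(1)[OF assms] has_derivative_linear by blast

lemma ehess_symmetric:
  assumes "smooth usphere f" "y \<noteq> 0"
  shows "ehess f y v \<bullet> w = v \<bullet> ehess f y w"
  by (rule gradient_derivative_symmetric[OF open_minus_zero, where E = "hom_ext f" and G = "egrad f"])
    (use assms in \<open>auto intro: hom_ext_has_derivative egrad_has_derivative(1)\<close>)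

lemma inner_egrad_self:
  assumes "smooth usphere f" "y \<noteq> 0"
  shows "y \<bullet> egrad f y = 0"
proof -
  define p where "p t = hom_ext f (t *\<^sub>R y)" for t
  have "((\<lambda>t. t *\<^sub>R y) has_derivative (\<lambda>h. h *\<^sub>R y)) (at 1)" by (auto intro!: derivative_eq_intros)
  moreover have "(hom_ext f has_derivative (\<lambda>v. egrad f y \<bullet> v)) (at (1 *\<^sub>R y))"
    using hom_ext_has_derivative[OF assms] by simp
  ultimately have "(p has_derivative (\<lambda>h. egrad f y \<bullet> (h *\<^sub>R y))) (at 1)"
    unfolding p_def by (rule has_derivative_compose)
  moreover have "(p has_derivative (\<lambda>h. 0)) (at 1)"
  proof (rule has_derivative_transform_within_open)
    show "((\<lambda>t. f (sgn y)) has_derivative (\<lambda>h. 0)) (at (1::real))" by simp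
    show "open {0::real<..}" "(1::real) \<in> {0<..}" by auto
    show "f (sgn y) = p t" if "t \<in> {0<..}" for t
      using that unfolding p_def hom_ext_def by (simp add: sgn_scaleR)
  qed
  ultimately have "(\<lambda>h. egrad f y \<bullet> (h *\<^sub>R y)) = (\<lambda>h. 0)" by (rule has_derivative_unique)
  then have "egrad f y \<bullet> (1 *\<^sub>R y) = 0" by (rule fun_cong)
  then show ?thesis by (simp add: inner_commute)
qed

text \<open>Differentiate \<open>y \<bullet> egrad f y = 0\<close>.\<close>

lemma inner_ehess_self:
  assumes "smooth usphere f" "y \<noteq> 0"
  shows "y \<bullet> ehess f y v = - (v \<bullet> egrad f y)"
proof -
  have "((\<lambda>z. z \<bullet> egrad f z) has_derivative (\<lambda>v. y \<bullet> ehess f y v + v \<bullet> egrad f y)) (at y)"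
    by (intro has_derivative_inner has_derivative_ident egrad_has_derivative(1) assms)
  moreover have "((\<lambda>z. z \<bullet> egrad f z) has_derivative (\<lambda>v. 0)) (at y)"
  proof (rule has_derivative_transform_within_open[OF _ open_minus_zero])
    show "((\<lambda>z. 0) has_derivative (\<lambda>v. 0)) (at y)" by simp
  qed (use assms inner_egrad_self[OF assms(1)] in auto)
  ultimately have "(\<lambda>v. y \<bullet> ehess f y v + v \<bullet> egrad f y) = (\<lambda>v. 0)" by (rule has_derivative_unique)
  then have "y \<bullet> ehess f y v + v \<bullet> egrad f y = 0" by (rule fun_cong)
  then show ?thesis by simp
qed

definition great_circle :: "'a::euclidean_space \<Rightarrow> 'a \<Rightarrow> real \<Rightarrow> 'a" where
  "great_circle x w s = cos s *\<^sub>R x + sin s *\<^sub>R w"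

lemma great_circle_0 [simp]: "great_circle x w 0 = x"
  unfolding great_circle_def by simp

lemma inner_great_circle:
  assumes "norm x = 1" "norm w = 1" "x \<bullet> w = 0"
  shows "great_circle x w s \<bullet> great_circle x w t = cos (s - t)"
    "great_circle x w s \<bullet> great_circle w (- x) s = 0"
proof -
  have "x \<bullet> x = 1" "w \<bullet> w = 1" "w \<bullet> x = 0" using assms by (auto simp: norm_eq_1 inner_commute)
  then show "great_circle x w s \<bullet> great_circle x w t = cos (s - t)"
    "great_circle x w s \<bullet> great_circle w (- x) s = 0"
    using assms(3) unfolding great_circle_def
    by (simp_all add: inner_add_left inner_add_right inner_diff_right cos_diff)
qed

lemma great_circle_in_usphere:
  assumes "norm x = 1" "norm w = 1" "x \<bullet> w = 0"
  shows "great_circle x w s \<in> usphere" "great_circle x w s \<noteq> 0" "norm (great_circle x w s) = 1"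
proof -
  show n: "norm (great_circle x w s) = 1" using inner_great_circle(1)[OF assms, of s s] by (simp add: norm_eq_1)
  then show "great_circle x w s \<in> usphere" "great_circle x w s \<noteq> 0" by auto
qed

lemma great_circle_has_derivative:
  "(great_circle x w has_derivative (\<lambda>h. h *\<^sub>R great_circle w (- x) s)) (at s)"
  unfolding great_circle_def
  by (auto intro!: derivative_eq_intros simp: algebra_simps)

lemma great_circle_has_vector_derivative:
  "(great_circle x w has_vector_derivative great_circle w (- x) s) (at s)"
  using great_circle_has_derivative unfolding has_vector_derivative_def .

lemma has_vector_derivative_compose_within:
  assumes "(X has_derivative X') (at (c s) within S)" "(c has_vector_derivative v) (at s)" "\<And>t. c t \<in> S"
  shows "((\<lambda>t. X (c t)) has_vector_derivative X' v) (at s)"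
proof -
  have "(X has_derivative X') (at (c s) within c ` UNIV)"
    using assms(1,3) by (auto intro: has_derivative_subset)
  then have "((\<lambda>t. X (c t)) has_derivative (\<lambda>h. X' (h *\<^sub>R v))) (at s)"
    using has_derivative_in_compose[of c "\<lambda>h. h *\<^sub>R v" s UNIV X X'] assms(2)
    unfolding has_vector_derivative_def by simp
  moreover have "X' (h *\<^sub>R v) = h *\<^sub>R X' v" for h
    using assms(1) has_derivative_linear linear_cmul by blast
  ultimately show ?thesis unfolding has_vector_derivative_def by simp
qed

lemma tangent_scaled_unit:
  assumes "w \<in> tangent x" "w \<noteq> 0"
  obtains u where "norm u = 1" "x \<bullet> u = 0" "w = norm w *\<^sub>R u"
  using assms that[of "w /\<^sub>R norm w"] unfolding tangent_def by auto

text \<open>Every tangent vector is the velocity of a great circle, and along a curve the derivative is unique.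
This settles the value of \<^const>\<open>frechet_derivative\<close> on tangent vectors, whatever derivative within
the sphere it selects.\<close>

lemma sdiff_eq:
  fixes X :: "'a::euclidean_space \<Rightarrow> 'b::euclidean_space"
  assumes "x \<in> usphere" "(X has_derivative X') (at x within usphere)" "w \<in> tangent x"
  shows "sdiff X x w = X' w"
proof -
  have D: "(X has_derivative sdiff X x) (at x within usphere)"
    using assms(2) unfolding sdiff_def by (metis differentiableI frechet_derivative_works)
  have lin: "linear X'" "linear (sdiff X x)" using assms(2) D has_derivative_linear by blast+
  show ?thesis
  proof (cases "w = 0")
    case True
    then show ?thesis using lin by (simp add: linear_0)
  next
    case False
    then obtain u where u: "norm u = 1" "x \<bullet> u = 0" "w = norm w *\<^sub>R u"
      using tangent_scaled_unit[OF assms(3)] by metis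
    have x1: "norm x = 1" using assms(1) by simp
    have c: "(great_circle x u has_vector_derivative u) (at 0)"
      using great_circle_has_vector_derivative[of x u 0] by simp
    have "((\<lambda>t. X (great_circle x u t)) has_vector_derivative sdiff X x u) (at 0)"
      "((\<lambda>t. X (great_circle x u t)) has_vector_derivative X' u) (at 0)"
      using D assms(2) great_circle_in_usphere(1)[OF x1 u(1,2)]
      by (auto intro!: has_vector_derivative_compose_within[OF _ c, where S = usphere])
    then have "sdiff X x u = X' u" by (rule vector_derivative_unique_at)
    then show ?thesis using u(3) lin linear_cmul by metis
  qed
qed

lemma tproj_props:
  assumes "norm x = 1"
  shows "tproj x v \<in> tangent x" "v \<in> tangent x \<Longrightarrow> tproj x v = v" "e \<bullet> tproj x v = tproj x e \<bullet> v"
    "tproj x x = 0" "linear (tproj x)"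
proof -
  have "x \<bullet> x = 1" using assms by (simp add: norm_eq_1)
  then show "tproj x v \<in> tangent x" "v \<in> tangent x \<Longrightarrow> tproj x v = v" "e \<bullet> tproj x v = tproj x e \<bullet> v" "tproj x x = 0"
    unfolding tproj_def tangent_def by (auto simp: inner_diff_left inner_diff_right inner_commute)
  show "linear (tproj x)"
    unfolding tproj_def by (rule linearI) (auto simp: inner_add_right algebra_simps)
qed

lemma sgrad_eq:
  fixes f :: "'a::euclidean_space \<Rightarrow> real"
  assumes x: "x \<in> usphere" and f: "(f has_derivative (\<lambda>w. v \<bullet> w)) (at x within usphere)" and v: "v \<in> tangent x"
  shows "sgrad f x = v"
  unfolding sgrad_def
proof (rule the_equality)
  show "v \<in> tangent x \<and> (\<forall>w\<in>tangent x. v \<bullet> w = sdiff f x w)"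
    using v sdiff_eq[OF x f] by simp
next
  fix u assume u: "u \<in> tangent x \<and> (\<forall>w\<in>tangent x. u \<bullet> w = sdiff f x w)"
  have "u - v \<in> tangent x" using u v unfolding tangent_def by (simp add: inner_diff_right)
  then have "u \<bullet> (u - v) = v \<bullet> (u - v)" using u sdiff_eq[OF x f] by simp
  then have "(u - v) \<bullet> (u - v) = 0" by (simp add: inner_diff_left)
  then show "u = v" by simp
qed

lemma has_derivative_on_usphere:
  fixes f :: "'a::euclidean_space \<Rightarrow> real"
  assumes "smooth usphere f" "x \<in> usphere"
  shows "(f has_derivative (\<lambda>w. egrad f x \<bullet> w)) (at x within usphere)"
proof (rule has_derivative_transform[OF assms(2)])
  show "(hom_ext f has_derivative (\<lambda>w. egrad f x \<bullet> w)) (at x within usphere)"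
    by (rule has_derivative_at_withinI[OF hom_ext_has_derivative[OF assms(1)]]) (use assms(2) in auto)
qed (simp add: hom_ext_on_usphere)

lemma sgrad_eq_egrad:
  assumes "smooth usphere f" "x \<in> usphere"
  shows "sgrad f x = egrad f x"
proof (rule sgrad_eq[OF assms(2) has_derivative_on_usphere[OF assms]])
  have "x \<noteq> 0" using assms(2) by auto
  then show "egrad f x \<in> tangent x"
    using inner_egrad_self[OF assms(1)] unfolding tangent_def by simp
qed

lemma laplacian_eq:
  fixes f :: "'a::euclidean_space \<Rightarrow> real"
  assumes x: "x \<in> usphere" and X: "(sgrad f has_derivative X') (at x within usphere)"
  shows "laplacian f x = - (\<Sum>e\<in>Basis. tproj x e \<bullet> X' (tproj x e))"
proof -
  have n: "norm x = 1" using x by simp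
  have "e \<bullet> covd (sgrad f) x (tproj x e) = tproj x e \<bullet> X' (tproj x e)" for e
    unfolding covd_def sdiff_eq[OF x X tproj_props(1)[OF n]] by (rule tproj_props(3)[OF n])
  then show ?thesis unfolding laplacian_def sdiv_def by simp
qed

lemma sgrad_has_derivative:
  assumes "smooth usphere f" "x \<in> usphere"
  shows "(sgrad f has_derivative ehess f x) (at x within usphere)"
proof (rule has_derivative_transform[OF assms(2)])
  show "(egrad f has_derivative ehess f x) (at x within usphere)"
    by (rule has_derivative_at_withinI[OF egrad_has_derivative(1)[OF assms(1)]]) (use assms(2) in auto)
qed (simp add: sgrad_eq_egrad[OF assms(1)])

text \<open>Complete the basis of the tangent space by \<open>x\<close>, whose contribution the projection annihilates.\<close>

lemma trace_tproj:
  fixes M :: "'a::euclidean_space \<Rightarrow> 'a"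
  assumes x: "norm x = 1" and M: "linear M"
    and B: "finite B" "pairwise orthogonal B" "\<And>b. b \<in> B \<Longrightarrow> norm b = 1" "B \<subseteq> tangent x" "span B = tangent x"
  shows "(\<Sum>e\<in>Basis. tproj x e \<bullet> M (tproj x e)) = (\<Sum>b\<in>B. b \<bullet> M b)"
proof -
  have xB: "x \<notin> B" using B(4) x unfolding tangent_def by (auto simp: norm_eq_1)
  have lin: "linear (\<lambda>v. tproj x (M (tproj x v)))"
    using linear_compose[OF linear_compose[OF tproj_props(5)[OF x] M] tproj_props(5)[OF x]] by (simp add: o_def)
  have "v \<in> span (insert x B)" for v
  proof -
    have "v - (x \<bullet> v) *\<^sub>R x \<in> span B" using tproj_props(1)[OF x, of v] B(5) unfolding tproj_def by simp
    then show ?thesis unfolding span_insert by blast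
  qed
  then have sp: "span (insert x B) = UNIV" by blast
  have orth: "pairwise orthogonal (insert x B)"
    using B(2,4) by (auto simp: pairwise_insert orthogonal_def tangent_def inner_commute)
  have "(\<Sum>e\<in>Basis. tproj x e \<bullet> M (tproj x e)) = (\<Sum>e\<in>Basis. e \<bullet> tproj x (M (tproj x e)))"
    by (simp add: tproj_props(3)[OF x])
  also have "\<dots> = (\<Sum>b\<in>insert x B. b \<bullet> tproj x (M (tproj x b)))"
    by (rule trace_orthonormal_basis[OF lin]) (use B orth sp x in auto)
  also have "\<dots> = (\<Sum>b\<in>B. b \<bullet> tproj x (M (tproj x b)))"
    using B(1) xB tproj_props(3,4)[OF x] by simp
  also have "\<dots> = (\<Sum>b\<in>B. b \<bullet> M b)"
    using tproj_props(2,3)[OF x] B(4) by (intro sum.cong) auto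
  finally show ?thesis .
qed

text \<open>The chain rule \<open>\<Delta>(y \<circ> F) = y'(F) \<Delta>F - y''(F) |\<nabla>F|\<^sup>2\<close>. It is local, and \<open>y\<close> is differentiated
within \<open>{a..b}\<close> so that it also applies at the focal sets, where \<open>F\<close> takes the end values.\<close>

lemma laplacian_compose:
  fixes F :: "'a::euclidean_space \<Rightarrow> real"
  assumes F: "smooth usphere F" and range: "\<And>x. x \<in> usphere \<Longrightarrow> F x \<in> {a..b}" and x: "x \<in> usphere"
    and O: "open O'" "F x \<in> O'"
    and y: "\<And>t. t \<in> O' \<inter> {a..b} \<Longrightarrow> (y has_real_derivative yd t) (at t within {a..b})"
    and yd: "(yd has_real_derivative ydd) (at (F x) within {a..b})"
    and f: "\<And>z. z \<in> usphere \<Longrightarrow> F z \<in> O' \<Longrightarrow> f z = y (F z)"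
  shows "laplacian f x = yd (F x) * laplacian F x - ydd * (norm (sgrad F x))\<^sup>2"
proof -
  have n: "norm x = 1" "x \<noteq> 0" using x by auto
  have contF: "continuous_on usphere F"
    using has_derivative_on_usphere[OF F] has_derivative_continuous continuous_on_eq_continuous_within by blast
  obtain W where W: "open W" "x \<in> W" "\<And>z. z \<in> usphere \<Longrightarrow> z \<in> W \<Longrightarrow> F z \<in> O'"
    using contF O x unfolding continuous_on_open_invariant
    by (metis IntI IntD1 IntD2 vimage_eq)
  obtain d where d: "d > 0" "ball x d \<subseteq> W" using W open_contains_ball by blast
  have near: "F z \<in> O'" if "z \<in> usphere" "dist z x < d" for z
    using that d W(3) by (auto simp: dist_commute subset_iff)
  have Fsub: "F ` usphere \<subseteq> {a..b}" using range by blast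
  have comp: "((\<lambda>z. h (F z)) has_derivative (\<lambda>w. hd * (egrad F z \<bullet> w))) (at z within usphere)"
    if "z \<in> usphere" "(h has_real_derivative hd) (at (F z) within {a..b})" for h hd z
  proof -
    have "(h has_derivative (*) hd) (at (F z) within F ` usphere)"
      using that(2) Fsub unfolding has_field_derivative_def by (rule has_derivative_subset)
    then show ?thesis
      using has_derivative_in_compose[OF has_derivative_on_usphere[OF F that(1)]] by blast
  qed
  have grad: "sgrad f z = yd (F z) *\<^sub>R egrad F z" if z: "z \<in> usphere" "dist z x < d" for z
  proof (rule sgrad_eq[OF z(1)])
    have "((\<lambda>z. y (F z)) has_derivative (\<lambda>w. yd (F z) * (egrad F z \<bullet> w))) (at z within usphere)"
      using near[OF z] range[OF z(1)] by (intro comp[OF z(1)] y) auto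
    then have "((\<lambda>z. y (F z)) has_derivative (\<lambda>w. yd (F z) *\<^sub>R egrad F z \<bullet> w)) (at z within usphere)"
      by simp
    then show "(f has_derivative (\<lambda>w. yd (F z) *\<^sub>R egrad F z \<bullet> w)) (at z within usphere)"
    proof (rule has_derivative_transform_within)
      show "0 < d - dist z x" using z by simp
      show "y (F u) = f u" if "u \<in> usphere" "dist u z < d - dist z x" for u
        using that dist_triangle[of u x z] by (intro f[symmetric] near) auto
    qed (use z in auto)
    have "z \<noteq> 0" using z(1) by auto
    then show "yd (F z) *\<^sub>R egrad F z \<in> tangent z"
      using inner_egrad_self[OF F] unfolding tangent_def by simp
  qed
  have "((\<lambda>z. yd (F z) *\<^sub>R egrad F z) has_derivative
      (\<lambda>w. yd (F x) *\<^sub>R ehess F x w + (ydd * (egrad F x \<bullet> w)) *\<^sub>R egrad F x)) (at x within usphere)"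
    by (intro has_derivative_scaleR comp[OF x yd] has_derivative_at_withinI[OF egrad_has_derivative(1)[OF F n(2)]])
  then have "(sgrad f has_derivative
      (\<lambda>w. yd (F x) *\<^sub>R ehess F x w + (ydd * (egrad F x \<bullet> w)) *\<^sub>R egrad F x)) (at x within usphere)"
    by (rule has_derivative_transform_within[OF _ d(1) x]) (use grad in auto)
  then have L: "laplacian f x = - (\<Sum>e\<in>Basis. tproj x e \<bullet>
      (yd (F x) *\<^sub>R ehess F x (tproj x e) + (ydd * (egrad F x \<bullet> tproj x e)) *\<^sub>R egrad F x))"
    by (rule laplacian_eq[OF x])
  have LF: "laplacian F x = - (\<Sum>e\<in>Basis. tproj x e \<bullet> ehess F x (tproj x e))"
    by (rule laplacian_eq[OF x sgrad_has_derivative[OF F x]])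
  have "tproj x (egrad F x) = egrad F x"
    using inner_egrad_self[OF F n(2)] by (intro tproj_props(2)[OF n(1)]) (simp add: tangent_def)
  then have "egrad F x \<bullet> tproj x e = e \<bullet> egrad F x" for e
    using tproj_props(3)[OF n(1), of "egrad F x" e] by (simp add: inner_commute)
  then have sq: "(\<Sum>e\<in>Basis. (egrad F x \<bullet> tproj x e) * (tproj x e \<bullet> egrad F x)) = (norm (egrad F x))\<^sup>2"
    unfolding power2_norm_eq_inner euclidean_inner[of "egrad F x" "egrad F x"] by (simp add: inner_commute)
  have "(\<Sum>e\<in>Basis. tproj x e \<bullet>
      (yd (F x) *\<^sub>R ehess F x (tproj x e) + (ydd * (egrad F x \<bullet> tproj x e)) *\<^sub>R egrad F x))
    = yd (F x) * (\<Sum>e\<in>Basis. tproj x e \<bullet> ehess F x (tproj x e))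
      + ydd * (\<Sum>e\<in>Basis. (egrad F x \<bullet> tproj x e) * (tproj x e \<bullet> egrad F x))"
    by (simp add: inner_add_right sum.distrib sum_distrib_left mult.assoc)
  then show ?thesis
    unfolding L LF sgrad_eq_egrad[OF F x] sq by simp
qed

section \<open>The critical values of an isoparametric function\<close>

lemma great_circle_connects:
  fixes x y :: "'a::euclidean_space"
  assumes x: "norm x = 1" and y: "norm y = 1" and dim: "DIM('a) \<ge> 2"
  obtains w where "norm w = 1" "x \<bullet> w = 0" "y = great_circle x w (arccos (x \<bullet> y))"
proof -
  define p where "p = tproj x y"
  have xx: "x \<bullet> x = 1" and yy: "y \<bullet> y = 1" using x y by (auto simp: norm_eq_1)
  have xp: "x \<bullet> p = 0" unfolding p_def tproj_def by (simp add: inner_diff_right xx)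
  have bound: "\<bar>x \<bullet> y\<bar> \<le> 1" using Cauchy_Schwarz_ineq2[of x y] x y by simp
  have ca: "cos (arccos (x \<bullet> y)) = x \<bullet> y" using bound by simp
  have "p \<bullet> p = 1 - (x \<bullet> y)\<^sup>2"
    unfolding p_def tproj_def
    by (simp add: inner_diff_left inner_diff_right xx yy inner_commute power2_eq_square algebra_simps)
  then have np: "norm p = sin (arccos (x \<bullet> y))"
    using bound by (simp add: norm_eq_sqrt_inner sin_arccos_abs)
  have y_eq: "y = (x \<bullet> y) *\<^sub>R x + p" unfolding p_def tproj_def by simp
  show thesis
  proof (cases "p = 0")
    case True
    obtain w where w: "w \<noteq> 0" "orthogonal x w" using dim orthogonal_to_vector_exists by blast
    show thesis
      by (rule that[of "w /\<^sub>R norm w"])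
        (use w True y_eq np ca in \<open>auto simp: great_circle_def orthogonal_def\<close>)
  next
    case False
    show thesis
    proof (rule that[of "p /\<^sub>R norm p"])
      show "norm (p /\<^sub>R norm p) = 1" "x \<bullet> (p /\<^sub>R norm p) = 0" using False xp by auto
      show "y = great_circle x (p /\<^sub>R norm p) (arccos (x \<bullet> y))"
        unfolding great_circle_def np[symmetric] ca using y_eq False by simp
    qed
  qed
qed

lemma smooth_along_great_circle:
  fixes f :: "'a::euclidean_space \<Rightarrow> real"
  assumes f: "smooth usphere f" and n: "norm x = 1" "norm w = 1" "x \<bullet> w = 0"
  shows "((\<lambda>s. f (great_circle x w s)) has_real_derivative
      egrad f (great_circle x w s) \<bullet> great_circle w (- x) s) (at s)"
    and "((\<lambda>s. egrad f (great_circle x w s) \<bullet> great_circle w (- x) s) has_real_derivative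
      ehess f (great_circle x w s) (great_circle w (- x) s) \<bullet> great_circle w (- x) s) (at s)"
proof -
  let ?c = "great_circle x w" and ?c' = "great_circle w (- x)"
  note S = great_circle_in_usphere[OF n]
  have "((\<lambda>s. f (?c s)) has_vector_derivative egrad f (?c s) \<bullet> ?c' s) (at s)"
    by (rule has_vector_derivative_compose_within[OF has_derivative_on_usphere[OF f S(1)]
          great_circle_has_vector_derivative S(1)])
  then show "((\<lambda>s. f (?c s)) has_real_derivative egrad f (?c s) \<bullet> ?c' s) (at s)"
    by (simp add: has_real_derivative_iff_has_vector_derivative)
  have "((\<lambda>s. egrad f (?c s)) has_derivative (\<lambda>h. ehess f (?c s) (h *\<^sub>R ?c' s))) (at s)"
    by (rule has_derivative_compose[OF great_circle_has_derivative egrad_has_derivative(1)[OF f S(2)]])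
  moreover have "(?c' has_derivative (\<lambda>h. h *\<^sub>R great_circle (- x) (- w) s)) (at s)"
    by (rule great_circle_has_derivative)
  ultimately have "((\<lambda>s. egrad f (?c s) \<bullet> ?c' s) has_derivative
      (\<lambda>h. egrad f (?c s) \<bullet> (h *\<^sub>R great_circle (- x) (- w) s) + ehess f (?c s) (h *\<^sub>R ?c' s) \<bullet> ?c' s)) (at s)"
    by (rule has_derivative_inner)
  moreover have "great_circle (- x) (- w) s = - ?c s" unfolding great_circle_def by simp
  moreover have "egrad f (?c s) \<bullet> ?c s = 0" using inner_egrad_self[OF f S(2)] by (simp add: inner_commute)
  moreover have "ehess f (?c s) (h *\<^sub>R ?c' s) = h *\<^sub>R ehess f (?c s) (?c' s)" for h
    using linear_ehess[OF f S(2)] by (rule linear_cmul)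
  ultimately have "((\<lambda>s. egrad f (?c s) \<bullet> ?c' s) has_derivative (\<lambda>h. ehess f (?c s) (?c' s) \<bullet> ?c' s * h)) (at s)"
    by (simp add: mult.commute)
  then show "((\<lambda>s. egrad f (?c s) \<bullet> ?c' s) has_real_derivative ehess f (?c s) (?c' s) \<bullet> ?c' s) (at s)"
    unfolding has_field_derivative_def .
qed

text \<open>\<open>Ad\<close> is the derivative of \<open>A\<close>, one-sided at the end points. The dimension assumption says that the
sphere is at least two-dimensional.\<close>

locale isoparametric_foliation =
  fixes F :: "'a::euclidean_space \<Rightarrow> real" and a b :: real and A Ad B :: "real \<Rightarrow> real"
  assumes ab: "a < b" and smooth_F: "smooth usphere F" and range_F: "F ` usphere = {a..b}"
    and smooth_A: "smooth {a..b} A" and smooth_Ad: "smooth {a..b} Ad" and smooth_B: "smooth {a..b} B"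
    and A_deriv: "\<And>t. t \<in> {a..b} \<Longrightarrow> (A has_real_derivative Ad t) (at t within {a..b})"
    and norm_sgrad: "\<And>x. x \<in> usphere \<Longrightarrow> (norm (sgrad F x))\<^sup>2 = A (F x)"
    and laplacian_F: "\<And>x. x \<in> usphere \<Longrightarrow> laplacian F x = B (F x)"
    and dim3: "DIM('a) \<ge> 3"
begin

abbreviation "G \<equiv> egrad F"
abbreviation "H \<equiv> ehess F"

lemma F_range: "x \<in> usphere \<Longrightarrow> F x \<in> {a..b}"
  using range_F by blast

lemma norm_G: "x \<in> usphere \<Longrightarrow> (norm (G x))\<^sup>2 = A (F x)"
  using norm_sgrad sgrad_eq_egrad[OF smooth_F] by simp

lemma G_tangent: "x \<in> usphere \<Longrightarrow> x \<bullet> G x = 0" "x \<in> usphere \<Longrightarrow> G x \<in> tangent x"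
proof -
  show "x \<bullet> G x = 0" if "x \<in> usphere"
    using that inner_egrad_self[OF smooth_F, of x] by fastforce
  then show "x \<in> usphere \<Longrightarrow> G x \<in> tangent x" unfolding tangent_def by simp
qed

lemma nonzero_on_usphere: "x \<in> usphere \<Longrightarrow> x \<noteq> 0" for x :: 'a
  by auto

lemma linear_H: "x \<in> usphere \<Longrightarrow> linear (H x)"
  using linear_ehess[OF smooth_F nonzero_on_usphere] .

lemma H_sym: "x \<in> usphere \<Longrightarrow> H x v \<bullet> w = v \<bullet> H x w"
  using ehess_symmetric[OF smooth_F nonzero_on_usphere] .

lemma A_nonneg: "t \<in> {a..b} \<Longrightarrow> A t \<ge> 0"
  using range_F norm_G by (metis imageE zero_le_power2)

lemma F_along_great_circle:
  assumes "norm x = 1" "norm w = 1" "x \<bullet> w = 0"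
  shows "((\<lambda>s. F (great_circle x w s)) has_real_derivative
      G (great_circle x w s) \<bullet> great_circle w (- x) s) (at s)"
    and "((\<lambda>s. G (great_circle x w s) \<bullet> great_circle w (- x) s) has_real_derivative
      H (great_circle x w s) (great_circle w (- x) s) \<bullet> great_circle w (- x) s) (at s)"
  by (rule smooth_along_great_circle[OF smooth_F assms])+

lemma interval_chain:
  assumes "(h has_real_derivative h') (at (f s) within {a..b})" "(f has_real_derivative fd) (at s)"
    and "\<And>t. f t \<in> {a..b}"
  shows "((\<lambda>t. h (f t)) has_real_derivative h' * fd) (at s)"
proof -
  have "(h has_derivative (*) h') (at (f s) within f ` UNIV)"
    using assms(1,3) unfolding has_field_derivative_def by (auto intro: has_derivative_subset)
  then have "((\<lambda>t. h (f t)) has_derivative (\<lambda>x. h' * (fd * x))) (at s)"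
    using has_derivative_in_compose[of f "(*) fd" s UNIV h] assms(2) unfolding has_field_derivative_def by simp
  then show ?thesis unfolding has_field_derivative_def by (simp add: mult.assoc[abs_def] fun_eq_iff)
qed

text \<open>Differentiate \<open>|\<nabla>F|\<^sup>2 = A \<circ> F\<close> along a great circle with velocity \<open>v\<close>.\<close>

lemma G_H:
  assumes x: "x \<in> usphere" and v: "v \<in> tangent x"
  shows "G x \<bullet> H x v = Ad (F x) / 2 * (G x \<bullet> v)"
proof (cases "v = 0")
  case True
  then show ?thesis using linear_H[OF x] by (simp add: linear_0)
next
  case False
  then obtain w where w: "norm w = 1" "x \<bullet> w = 0" "v = norm v *\<^sub>R w"
    using tangent_scaled_unit[OF v] by metis
  have x1: "norm x = 1" using x by simp
  note S = great_circle_in_usphere[OF x1 w(1,2)]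
  let ?c = "great_circle x w"
  have "((\<lambda>s. A (F (?c s))) has_real_derivative Ad (F (?c 0)) * (G (?c 0) \<bullet> great_circle w (- x) 0)) (at 0)"
    by (rule interval_chain[OF A_deriv F_along_great_circle(1)[OF x1 w(1,2)]]) (use F_range S x in auto)
  then have d1: "((\<lambda>s. A (F (?c s))) has_derivative (*) (Ad (F x) * (G x \<bullet> w))) (at 0)"
    unfolding has_field_derivative_def by simp
  have "((\<lambda>s. G (?c s) \<bullet> G (?c s)) has_derivative
      (\<lambda>h. G (?c 0) \<bullet> H (?c 0) (h *\<^sub>R great_circle w (- x) 0) + H (?c 0) (h *\<^sub>R great_circle w (- x) 0) \<bullet> G (?c 0))) (at 0)"
    by (intro has_derivative_inner has_derivative_compose[OF great_circle_has_derivative egrad_has_derivative(1)[OF smooth_F S(2)]])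
  then have d2: "((\<lambda>s. A (F (?c s))) has_derivative
      (\<lambda>h. G x \<bullet> H x (h *\<^sub>R w) + H x (h *\<^sub>R w) \<bullet> G x)) (at 0)"
    using norm_G[OF S(1)] by (simp add: power2_norm_eq_inner)
  from fun_cong[OF has_derivative_unique[OF d1 d2], of 1]
  have "Ad (F x) * (G x \<bullet> w) = 2 * (G x \<bullet> H x w)"
    by (simp add: inner_commute)
  moreover have "H x v = norm v *\<^sub>R H x w" using w(3) linear_H[OF x] linear_cmul by metis
  moreover have "G x \<bullet> v = norm v * (G x \<bullet> w)" using w(3) by (metis inner_scaleR_right)
  ultimately show ?thesis by simp
qed

lemma H_bounded: obtains K where "K \<ge> 0" "\<And>x v. x \<in> usphere \<Longrightarrow> norm (H x v) \<le> K * norm v"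
proof -
  have "\<exists>k. \<forall>x\<in>usphere. norm (H x e) \<le> k" for e
  proof -
    have "continuous_on usphere (\<lambda>x. H x e)"
      by (rule continuous_on_subset[OF egrad_has_derivative(2)[OF smooth_F]]) auto
    then have "bounded ((\<lambda>x. H x e) ` usphere)"
      by (intro compact_imp_bounded compact_continuous_image) auto
    then show ?thesis unfolding bounded_iff by auto
  qed
  then obtain k where k: "\<And>e x. x \<in> usphere \<Longrightarrow> norm (H x e) \<le> k e" by metis
  define K where "K = (\<Sum>e\<in>(Basis::'a set). \<bar>k e\<bar>)"
  have "norm (H x v) \<le> K * norm v" if x: "x \<in> usphere" for x v
  proof -
    have "H x v = H x (\<Sum>e\<in>Basis. (v \<bullet> e) *\<^sub>R e)" by (simp add: euclidean_representation)
    also have "\<dots> = (\<Sum>e\<in>Basis. (v \<bullet> e) *\<^sub>R H x e)"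
      using linear_H[OF x] by (simp add: linear_sum linear_cmul)
    also have "norm \<dots> \<le> (\<Sum>e\<in>Basis. norm ((v \<bullet> e) *\<^sub>R H x e))" by (rule norm_sum)
    also have "\<dots> \<le> (\<Sum>e\<in>Basis. \<bar>k e\<bar> * norm v)"
    proof (rule sum_mono)
      fix e :: 'a assume e: "e \<in> Basis"
      have "\<bar>v \<bullet> e\<bar> * norm (H x e) \<le> norm v * \<bar>k e\<bar>"
        using Basis_le_norm[OF e, of v] k[OF x, of e] by (intro mult_mono) auto
      then show "norm ((v \<bullet> e) *\<^sub>R H x e) \<le> \<bar>k e\<bar> * norm v" by (simp add: mult.commute)
    qed
    finally show ?thesis unfolding K_def by (simp add: sum_distrib_right)
  qed
  moreover have "K \<ge> 0" unfolding K_def by (simp add: sum_nonneg)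
  ultimately show thesis using that by blast
qed

lemma A_quadratic_bound:
  assumes t0: "t0 \<in> {a..b}" and z: "A t0 = 0" "Ad t0 = 0"
  obtains M where "M \<ge> 0" "\<And>t. t \<in> {a..b} \<Longrightarrow> A t \<le> M\<^sup>2 * (t - t0)\<^sup>2"
proof -
  obtain Add where Add: "smooth {a..b} Add" "\<forall>t\<in>{a..b}. (Ad has_real_derivative Add t) (at t within {a..b})"
    using smooth_interval_deriv[OF ab smooth_Ad] by blast
  have "continuous_on {a..b} Add" using smooth_interval_imp_Ck_on[OF ab Add(1), of 0] by simp
  then have "bounded (Add ` {a..b})" by (intro compact_imp_bounded compact_continuous_image) auto
  then obtain M0 where "\<forall>t\<in>{a..b}. \<bar>Add t\<bar> \<le> M0" unfolding bounded_iff by auto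
  then obtain M where M: "M \<ge> 0" "\<And>t. t \<in> {a..b} \<Longrightarrow> \<bar>Add t\<bar> \<le> M" using t0 by (meson abs_ge_zero order_trans)
  have Ad_bound: "\<bar>Ad t\<bar> \<le> M * \<bar>t - t0\<bar>" if t: "t \<in> {a..b}" for t
    using field_differentiable_bound[of "{a..b}" Ad Add M t t0] Add(2) M t t0 z(2) by auto
  have "A t \<le> M * (t - t0)\<^sup>2" if t: "t \<in> {a..b}" for t
  proof -
    let ?S = "{min t0 t..max t0 t}"
    have sub: "?S \<subseteq> {a..b}" using t t0 by auto
    have "\<bar>A t - A t0\<bar> \<le> (M * \<bar>t - t0\<bar>) * \<bar>t - t0\<bar>"
    proof (rule field_differentiable_bound[of ?S A Ad, unfolded real_norm_def])
      fix s assume s: "s \<in> ?S"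
      then show "(A has_real_derivative Ad s) (at s within ?S)" using sub A_deriv DERIV_subset by blast
      have "\<bar>s - t0\<bar> \<le> \<bar>t - t0\<bar>" using s by auto
      then have "M * \<bar>s - t0\<bar> \<le> M * \<bar>t - t0\<bar>" using M(1) by (rule mult_left_mono)
      moreover have "\<bar>Ad s\<bar> \<le> M * \<bar>s - t0\<bar>" using s sub by (intro Ad_bound) blast
      ultimately show "\<bar>Ad s\<bar> \<le> M * \<bar>t - t0\<bar>" by linarith
    qed auto
    then show ?thesis using z(1) by (simp add: power2_eq_square mult.assoc)
  qed
  moreover have "M = (sqrt M)\<^sup>2" using M(1) by simp
  ultimately show thesis using that[of "sqrt M"] M(1) by auto
qed

text \<open>At a double zero \<open>t0\<close> of \<open>A\<close> one has \<open>|\<nabla>F| \<le> M |F - t0|\<close>. By Gronwall's inequality \<open>F\<close> would be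
constant along every great circle through a point of level \<open>t0\<close>, hence constant.\<close>

lemma A_simple_zero:
  assumes t0: "t0 \<in> {a..b}" and z: "A t0 = 0"
  shows "Ad t0 \<noteq> 0"
proof
  assume z': "Ad t0 = 0"
  obtain M where M: "M \<ge> 0" "\<And>t. t \<in> {a..b} \<Longrightarrow> A t \<le> M\<^sup>2 * (t - t0)\<^sup>2"
    using A_quadratic_bound[OF t0 z z'] by blast
  obtain x where x: "x \<in> usphere" "F x = t0" using range_F t0 by (metis imageE)
  \<comment> \<open>every point of the sphere is joined to \<open>x\<close> by a great circle\<close>
  have const: "F y = t0" if y: "y \<in> usphere" for y
  proof -
    have x1: "norm x = 1" and y1: "norm y = 1" using x y by auto
    obtain w where w: "norm w = 1" "x \<bullet> w = 0" "y = great_circle x w (arccos (x \<bullet> y))"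
      using great_circle_connects[OF x1 y1] dim3 by (metis numeral_3_eq_3 Suc_leD numeral_2_eq_2)
    let ?c = "great_circle x w" and ?c' = "great_circle w (- x)" and ?r = "arccos (x \<bullet> y)"
    note S = great_circle_in_usphere[OF x1 w(1,2)]
    have n': "norm (?c' s) = 1" for s
      by (rule great_circle_in_usphere(3)) (use x1 w in \<open>auto simp: inner_commute\<close>)
    have r: "?r \<ge> 0" using Cauchy_Schwarz_ineq2[of x y] x1 y1 by (intro arccos_lbound) auto
    have "F (?c ?r) - t0 = 0"
    proof (rule linear_differential_inequality_zero[where l = 0 and r = ?r and K = M and ?s0.0 = 0
          and s = ?r and f = "\<lambda>s. F (?c s) - t0" and fd = "\<lambda>s. G (?c s) \<bullet> ?c' s"])
      fix s
      show "((\<lambda>s. F (?c s) - t0) has_real_derivative G (?c s) \<bullet> ?c' s) (at s)"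
        using F_along_great_circle(1)[OF x1 w(1,2)] by (auto intro!: derivative_eq_intros)
      have "(norm (G (?c s)))\<^sup>2 \<le> (M * \<bar>F (?c s) - t0\<bar>)\<^sup>2"
        using M(2)[OF F_range[OF S(1)]] norm_G[OF S(1), of s] by (simp add: power_mult_distrib)
      then have "norm (G (?c s)) \<le> M * \<bar>F (?c s) - t0\<bar>"
        by (rule power2_le_imp_le) (use M(1) in simp)
      then show "\<bar>G (?c s) \<bullet> ?c' s\<bar> \<le> M * \<bar>F (?c s) - t0\<bar>"
        using Cauchy_Schwarz_ineq2[of "G (?c s)" "?c' s"] n'[of s] by simp
    qed (use r x in auto)
    then show ?thesis using w(3) by simp
  qed
  have "a \<in> F ` usphere" "b \<in> F ` usphere" using range_F ab by auto
  then show False using const ab by auto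
qed

text \<open>An interior zero of the nonnegative function \<open>A\<close> would be a double zero.\<close>

lemma A_pos: "a < t \<Longrightarrow> t < b \<Longrightarrow> A t > 0"
proof (rule ccontr)
  assume t: "a < t" "t < b" and "\<not> A t > 0"
  then have z: "A t = 0" using A_nonneg[of t] by simp
  have "(A has_real_derivative Ad t) (at t)"
    using A_deriv[of t] t at_within_Icc_at[OF t] by auto
  moreover have "\<forall>y. \<bar>t - y\<bar> < min (t - a) (b - t) \<longrightarrow> A t \<le> A y"
    unfolding z using t by (auto intro!: A_nonneg)
  moreover have "min (t - a) (b - t) > 0" using t by simp
  ultimately have "Ad t = 0" using DERIV_local_min by blast
  then show False using A_simple_zero[OF _ z] t by simp
qed

lemma G_zero_at_extremum:
  assumes x: "x \<in> usphere" and e: "F x = a \<or> F x = b"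
  shows "G x = 0"
proof (rule ccontr)
  assume nz: "G x \<noteq> 0"
  have x1: "norm x = 1" using x by simp
  define w where "w = G x /\<^sub>R norm (G x)"
  have w: "norm w = 1" "x \<bullet> w = 0" unfolding w_def using nz G_tangent(1)[OF x] by auto
  have d: "((\<lambda>s. F (great_circle x w s)) has_real_derivative G x \<bullet> w) (at 0)"
    using F_along_great_circle(1)[OF x1 w, of 0] by simp
  have R: "F (great_circle x w s) \<in> {a..b}" for s using F_range great_circle_in_usphere(1)[OF x1 w] .
  have "G x \<bullet> w = 0"
    using e
  proof
    assume "F x = a"
    then show ?thesis using R by (intro DERIV_local_min[OF d, of 1]) auto
  next
    assume "F x = b"
    then show ?thesis using R by (intro DERIV_local_max[OF d, of 1]) auto
  qed
  then show False using nz unfolding w_def by simp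
qed

lemma A_ends: "A a = 0" "A b = 0"
proof -
  have "a \<in> F ` usphere" "b \<in> F ` usphere" using range_F ab by auto
  then obtain x y where "x \<in> usphere" "F x = a" "y \<in> usphere" "F y = b" by blast
  then show "A a = 0" "A b = 0"
    using norm_G[of x] norm_G[of y] G_zero_at_extremum[of x] G_zero_at_extremum[of y] by auto
qed

lemma Ad_ends: "Ad a > 0" "Ad b < 0"
proof -
  have "\<not> Ad a < 0"
  proof
    assume "Ad a < 0"
    then obtain d where d: "d > 0" "\<And>h. h > 0 \<Longrightarrow> a + h \<in> {a..b} \<Longrightarrow> h < d \<Longrightarrow> A (a + h) < A a"
      using has_real_derivative_neg_dec_right[OF A_deriv[of a]] ab by auto
    define h where "h = min (d / 2) (b - a)"
    have "h > 0" "a + h \<in> {a..b}" "h < d" unfolding h_def using d ab by auto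
    then show False using d(2)[of h] A_nonneg[of "a + h"] A_ends by auto
  qed
  moreover have "\<not> Ad b > 0"
  proof
    assume "Ad b > 0"
    then obtain d where d: "d > 0" "\<And>h. h > 0 \<Longrightarrow> b - h \<in> {a..b} \<Longrightarrow> h < d \<Longrightarrow> A (b - h) < A b"
      using has_real_derivative_pos_inc_left[OF A_deriv[of b]] ab by auto
    define h where "h = min (d / 2) (b - a)"
    have "h > 0" "b - h \<in> {a..b}" "h < d" unfolding h_def using d ab by auto
    then show False using d(2)[of h] A_nonneg[of "b - h"] A_ends by auto
  qed
  moreover have "Ad a \<noteq> 0" "Ad b \<noteq> 0" using A_simple_zero A_ends ab by auto
  ultimately show "Ad a > 0" "Ad b < 0" by linarith+
qed

end

section \<open>Normal great circles\<close>

context isoparametric_foliation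
begin

definition regular :: "'a \<Rightarrow> bool" where
  "regular x \<longleftrightarrow> x \<in> usphere \<and> a < F x \<and> F x < b"

text \<open>The unit normal of the level sets, as a field on a neighbourhood in the ambient space.\<close>

definition nrm :: "'a \<Rightarrow> 'a" where
  "nrm x = G x /\<^sub>R norm (G x)"

lemma regularD:
  assumes "regular x"
  shows "x \<in> usphere" "norm x = 1" "a < F x" "F x < b" "A (F x) > 0" "norm (G x) = sqrt (A (F x))" "G x \<noteq> 0"
    "norm (nrm x) = 1" "x \<bullet> nrm x = 0" "G x = sqrt (A (F x)) *\<^sub>R nrm x"
proof -
  show x: "x \<in> usphere" "norm x = 1" "a < F x" "F x < b" using assms unfolding regular_def by auto
  then show A: "A (F x) > 0" using A_pos by blast
  show n: "norm (G x) = sqrt (A (F x))" using norm_G[OF x(1)] by (simp add: real_sqrt_unique)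
  show nz: "G x \<noteq> 0" using A n by auto
  show "norm (nrm x) = 1" "x \<bullet> nrm x = 0" "G x = sqrt (A (F x)) *\<^sub>R nrm x"
    unfolding nrm_def using nz G_tangent(1)[OF x(1)] by (auto simp flip: n)
qed

text \<open>The defect \<open>q = A(F) - (F')\<^sup>2\<close> along a great circle is \<open>|W|\<^sup>2\<close>, where \<open>W\<close> is the component of the
gradient orthogonal to the circle. The symmetry of the Hessian and \<open>G_H\<close> give
\<open>F' q' = A'(F) q - 2 \<langle>H W, W\<rangle>\<close>, a linear differential inequality for \<open>q\<close> as long as \<open>F' > 0\<close>.\<close>

lemma normal_defect_zero:
  assumes n: "norm x = 1" "norm w = 1" "x \<bullet> w = 0"
    and pos: "\<And>s. s \<in> {l..r} \<Longrightarrow> G (great_circle x w s) \<bullet> great_circle w (- x) s > 0"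
    and s0: "s0 \<in> {l..r}" "A (F (great_circle x w s0)) = (G (great_circle x w s0) \<bullet> great_circle w (- x) s0)\<^sup>2"
    and s: "s \<in> {l..r}"
  shows "A (F (great_circle x w s)) = (G (great_circle x w s) \<bullet> great_circle w (- x) s)\<^sup>2"
proof -
  let ?c = "great_circle x w" and ?c' = "great_circle w (- x)"
  note S = great_circle_in_usphere[OF n]
  define fd where "fd s = G (?c s) \<bullet> ?c' s" for s
  define fdd where "fdd s = H (?c s) (?c' s) \<bullet> ?c' s" for s
  have D: "((\<lambda>s. F (?c s)) has_real_derivative fd s) (at s)" "(fd has_real_derivative fdd s) (at s)" for s
    using F_along_great_circle[OF n] unfolding fd_def fdd_def by auto
  define q where "q s = A (F (?c s)) - (fd s)\<^sup>2" for s
  have Dq: "(q has_real_derivative (Ad (F (?c s)) * fd s - 2 * fd s * fdd s)) (at s)" for s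
  proof -
    have "((\<lambda>s. A (F (?c s))) has_real_derivative Ad (F (?c s)) * fd s) (at s)"
      by (rule interval_chain[OF A_deriv D(1)]) (use F_range[OF S(1)] in auto)
    then show ?thesis unfolding q_def
      by (auto intro!: derivative_eq_intros D(2))
  qed
  have cc: "?c' s \<bullet> ?c' s = 1" "?c s \<bullet> ?c' s = 0" for s
    using inner_great_circle(1)[of w "- x" s s] inner_great_circle(2)[OF n] n by (auto simp: inner_commute)
  obtain K where K: "K \<ge> 0" "\<And>x v. x \<in> usphere \<Longrightarrow> norm (H x v) \<le> K * norm v" using H_bounded by blast
  have "continuous_on {a..b} Ad" using smooth_interval_imp_Ck_on[OF ab smooth_Ad, of 0] by simp
  then have "bounded (Ad ` {a..b})" by (intro compact_imp_bounded compact_continuous_image) auto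
  then obtain M where "\<forall>t\<in>{a..b}. \<bar>Ad t\<bar> \<le> M" unfolding bounded_iff by auto
  then have M: "\<And>t. t \<in> {a..b} \<Longrightarrow> \<bar>Ad t\<bar> \<le> M" by blast
  have key: "fd s * \<bar>Ad (F (?c s)) * fd s - 2 * fd s * fdd s\<bar> \<le> (M + 2 * K) * \<bar>q s\<bar>"
    if s: "s \<in> {l..r}" for s
  proof -
    define W where "W = G (?c s) - fd s *\<^sub>R ?c' s"
    have GG: "G (?c s) \<bullet> G (?c s) = A (F (?c s))" using norm_G[OF S(1)] by (simp add: power2_norm_eq_inner)
    have WW: "W \<bullet> W = q s"
      unfolding W_def q_def using cc(1)[of s] GG
      by (simp add: inner_diff_left inner_diff_right inner_commute power2_eq_square algebra_simps flip: fd_def)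
        (simp add: fd_def inner_commute)
    have GW: "G (?c s) \<bullet> W = q s"
      unfolding W_def q_def using GG by (simp add: inner_diff_right power2_eq_square fd_def)
    have tW: "W \<in> tangent (?c s)" "?c' s \<in> tangent (?c s)"
      unfolding W_def tangent_def using cc(2) G_tangent(1)[OF S(1)] by (auto simp: inner_diff_right)
    have GHW: "G (?c s) \<bullet> H (?c s) W = Ad (F (?c s)) / 2 * q s"
      using G_H[OF S(1) tW(1)] GW by simp
    have GHc: "G (?c s) \<bullet> H (?c s) (?c' s) = Ad (F (?c s)) / 2 * fd s"
      using G_H[OF S(1) tW(2)] unfolding fd_def .
    have Wu: "W \<bullet> u = G (?c s) \<bullet> u - fd s * (?c' s \<bullet> u)" for u
      unfolding W_def by (simp add: inner_diff_left)
    have "W \<bullet> H (?c s) W = H (?c s) W \<bullet> G (?c s) - fd s * (H (?c s) W \<bullet> ?c' s)"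
      unfolding Wu[of "H (?c s) W"] by (simp only: inner_commute)
    also have "H (?c s) W \<bullet> ?c' s = W \<bullet> H (?c s) (?c' s)" by (rule H_sym[OF S(1)])
    also have "\<dots> = Ad (F (?c s)) / 2 * fd s - fd s * fdd s"
      unfolding Wu GHc fdd_def by (simp only: inner_commute)
    finally have "fd s * (Ad (F (?c s)) * fd s - 2 * fd s * fdd s) = Ad (F (?c s)) * q s - 2 * (W \<bullet> H (?c s) W)"
      using GHW by (simp add: inner_commute algebra_simps)
    moreover have "\<bar>W \<bullet> H (?c s) W\<bar> \<le> K * q s"
    proof -
      have "\<bar>W \<bullet> H (?c s) W\<bar> \<le> norm W * norm (H (?c s) W)" by (rule Cauchy_Schwarz_ineq2)
      also have "\<dots> \<le> norm W * (K * norm W)" using K(2)[OF S(1)] by (intro mult_left_mono) auto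
      also have "\<dots> = K * (W \<bullet> W)" by (simp add: power2_norm_eq_inner[symmetric] power2_eq_square)
      finally show ?thesis by (simp add: WW)
    qed
    moreover have q0: "q s \<ge> 0" using WW inner_ge_zero[of W] by simp
    moreover have "\<bar>Ad (F (?c s)) * q s\<bar> \<le> M * q s"
      using M[OF F_range[OF S(1)], of s] q0 by (simp add: abs_mult mult_right_mono)
    ultimately have "\<bar>fd s * (Ad (F (?c s)) * fd s - 2 * fd s * fdd s)\<bar> \<le> (M + 2 * K) * \<bar>q s\<bar>"
      by (simp add: distrib_right)
    moreover have "fd s > 0" using pos[OF s] unfolding fd_def .
    ultimately show ?thesis by (simp add: abs_mult)
  qed
  have "continuous_on {l..r} fd" by (rule DERIV_continuous_on[OF has_field_derivative_at_within[OF D(2)]])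
  then obtain s1 where s1: "s1 \<in> {l..r}" "\<And>s. s \<in> {l..r} \<Longrightarrow> fd s1 \<le> fd s"
    using continuous_attains_inf[of "{l..r}" fd] s by auto
  have d: "fd s1 > 0" using pos[OF s1(1)] unfolding fd_def .
  have "q s = 0"
  proof (rule linear_differential_inequality_zero[where l = l and r = r and ?s0.0 = s0 and f = q
        and fd = "\<lambda>s. Ad (F (?c s)) * fd s - 2 * fd s * fdd s" and K = "(M + 2 * K) / fd s1"])
    show "(q has_real_derivative Ad (F (?c s)) * fd s - 2 * fd s * fdd s) (at s)" for s by (rule Dq)
    show "\<bar>Ad (F (?c s)) * fd s - 2 * fd s * fdd s\<bar> \<le> (M + 2 * K) / fd s1 * \<bar>q s\<bar>" if "s \<in> {l..r}" for s
    proof -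
      have "fd s1 * \<bar>Ad (F (?c s)) * fd s - 2 * fd s * fdd s\<bar> \<le> fd s * \<bar>Ad (F (?c s)) * fd s - 2 * fd s * fdd s\<bar>"
        using s1(2)[OF that] by (intro mult_right_mono) auto
      also have "\<dots> \<le> (M + 2 * K) * \<bar>q s\<bar>" by (rule key[OF that])
      finally show ?thesis using d by (simp add: field_simps)
    qed
  qed (use s0 s in \<open>auto simp: q_def fd_def\<close>)
  then show ?thesis unfolding q_def fd_def by simp
qed

lemma first_zeros_around:
  fixes h :: "real \<Rightarrow> real"
  assumes h: "continuous_on UNIV h" "h 0 > 0" and z: "u < 0" "h u = 0" "0 < v" "h v = 0"
  obtains l r where "l < 0" "0 < r" "h l = 0" "h r = 0" "\<And>s. l < s \<Longrightarrow> s < r \<Longrightarrow> h s > 0"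
proof -
  have right: "\<exists>r>0. k r = 0 \<and> (\<forall>s. 0 \<le> s \<and> s < r \<longrightarrow> k s > 0)"
    if k: "continuous_on UNIV k" "k 0 > 0" "0 < t" "k t = 0" for k :: "real \<Rightarrow> real" and t
  proof -
    let ?Z = "{0..t} \<inter> k -` {0}"
    have "continuous_on {0..t} k" using k(1) continuous_on_subset by blast
    then have "closed ?Z" by (intro continuous_closed_preimage) auto
    then have "compact ?Z" by (metis bounded_closed_interval bounded_Int compact_eq_bounded_closed)
    moreover have "t \<in> ?Z" using k by auto
    then have "?Z \<noteq> {}" by blast
    ultimately obtain r where r: "r \<in> ?Z" "\<And>s. s \<in> ?Z \<Longrightarrow> r \<le> s"
      using compact_attains_inf by metis
    have "r \<noteq> 0" using r(1) k(2) by auto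
    moreover have "k s > 0" if s: "0 \<le> s" "s < r" for s
    proof (rule ccontr)
      assume "\<not> k s > 0"
      moreover have "continuous_on {0..s} k" using k(1) continuous_on_subset by blast
      ultimately obtain u where "0 \<le> u" "u \<le> s" "k u = 0" using IVT2'[of k s 0 0] s k(2) by auto
      then have "u \<in> ?Z" using s r(1) by auto
      then show False using r(2)[of u] \<open>u \<le> s\<close> s by simp
    qed
    ultimately show ?thesis using r(1) by (intro exI[of _ r]) auto
  qed
  obtain r where r: "r > 0" "h r = 0" "\<And>s. 0 \<le> s \<Longrightarrow> s < r \<Longrightarrow> h s > 0" using right[OF h z(3,4)] by auto
  have "continuous_on UNIV (\<lambda>s. h (- s))"
    by (rule continuous_on_compose2[OF h(1)]) (auto intro: continuous_intros)
  then obtain l where l: "l > 0" "h (- l) = 0" "\<And>s. 0 \<le> s \<Longrightarrow> s < l \<Longrightarrow> h (- s) > 0"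
    using right[of "\<lambda>s. h (- s)" "- u"] h(2) z(1,2) by auto
  have "h s > 0" if "- l < s" "s < r" for s
    using l(3)[of "- s"] r(3)[of s] that by (cases "s \<ge> 0") auto
  then show thesis using that[of "- l" r] l r by auto
qed

text \<open>A great circle that starts normally stays normal while \<open>F\<close> increases along it. It stops increasing
only where \<open>A(F) = (F')\<^sup>2 = 0\<close>, that is at the values \<open>a\<close> and \<open>b\<close>. These are reached because \<open>F\<close> is
periodic along the circle.\<close>

lemma normal_geodesic:
  assumes x: "regular x"
  obtains l r where "l < 0" "0 < r" "F (great_circle x (nrm x) l) = a" "F (great_circle x (nrm x) r) = b"
    "\<And>s. l < s \<Longrightarrow> s < r \<Longrightarrow> regular (great_circle x (nrm x) s)"
    "\<And>s. l < s \<Longrightarrow> s < r \<Longrightarrow> nrm (great_circle x (nrm x) s) = great_circle (nrm x) (- x) s"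
    "\<And>s. l < s \<Longrightarrow> s < r \<Longrightarrow> G (great_circle x (nrm x) s) \<bullet> great_circle (nrm x) (- x) s
       = sqrt (A (F (great_circle x (nrm x) s)))"
    "G (great_circle x (nrm x) l) \<bullet> great_circle (nrm x) (- x) l = 0"
    "G (great_circle x (nrm x) r) \<bullet> great_circle (nrm x) (- x) r = 0"
proof -
  note R = regularD[OF x]
  let ?c = "great_circle x (nrm x)" and ?c' = "great_circle (nrm x) (- x)"
  have n: "norm x = 1" "norm (nrm x) = 1" "x \<bullet> nrm x = 0" using R by auto
  note S = great_circle_in_usphere[OF n]
  define f where "f s = F (?c s)" for s
  define fd where "fd s = G (?c s) \<bullet> ?c' s" for s
  have D: "(f has_real_derivative fd s) (at s)" for s
    using F_along_great_circle(1)[OF n] unfolding f_def fd_def by auto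
  have contfd: "continuous_on T fd" for T
    unfolding fd_def
    by (rule DERIV_continuous_on[OF has_field_derivative_at_within[OF F_along_great_circle(2)[OF n]]])
  have contf: "continuous_on T f" for T
    by (rule DERIV_continuous_on[OF has_field_derivative_at_within[OF D]])
  have nn: "nrm x \<bullet> nrm x = 1" using n(2) by (simp add: norm_eq_1)
  have fd0: "fd 0 = sqrt (A (F x))"
    unfolding fd_def using nn by (simp add: R(10))
  have per: "f (2 * pi) = f 0" "f (- 2 * pi) = f 0" unfolding f_def great_circle_def by simp_all
  have "\<exists>v>0. v < 2 * pi \<and> f (2 * pi) - f 0 = (2 * pi - 0) * fd v"
    using D by (intro MVT2) auto
  then obtain v where v: "v > 0" "fd v = 0" using per by auto
  have "\<exists>u>- 2 * pi. u < 0 \<and> f 0 - f (- 2 * pi) = (0 - (- 2 * pi)) * fd u"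
    using D by (intro MVT2) auto
  then obtain u where u: "u < 0" "fd u = 0" using per by auto
  obtain l r where lr: "l < 0" "0 < r" "fd l = 0" "fd r = 0" and pos: "\<And>s. l < s \<Longrightarrow> s < r \<Longrightarrow> fd s > 0"
    using first_zeros_around[OF contfd _ u v] fd0 R(5) by auto
  \<comment> \<open>the defect vanishes at \<open>s = 0\<close> because the circle starts normally\<close>
  have q: "A (f s) = (fd s)\<^sup>2" if s: "l < s" "s < r" for s
    unfolding f_def fd_def
  proof (rule normal_defect_zero[OF n, of "min 0 s" "max 0 s" 0])
    show "G (?c t) \<bullet> ?c' t > 0" if "t \<in> {min 0 s..max 0 s}" for t
      using pos[of t] that s lr unfolding fd_def by auto
    show "A (F (?c 0)) = (G (?c 0) \<bullet> ?c' 0)\<^sup>2"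
      using fd0 R(5) unfolding fd_def by simp
  qed auto
  have contA: "continuous_on {a..b} A" using smooth_interval_imp_Ck_on[OF ab smooth_A, of 0] by simp
  have frange: "f s \<in> {a..b}" for s unfolding f_def using F_range[OF S(1)] .
  have qc: "A (f s) = (fd s)\<^sup>2" if s: "l \<le> s" "s \<le> r" for s
  proof -
    have "closed {s \<in> {l..r}. A (f s) - (fd s)\<^sup>2 = 0}"
      by (rule continuous_closed_preimage_constant)
        (auto intro!: continuous_intros continuous_on_compose2[OF contA] contf contfd simp: frange[unfolded atLeastAtMost_iff])
    moreover have "{l<..<r} \<subseteq> {s \<in> {l..r}. A (f s) - (fd s)\<^sup>2 = 0}" using q by auto
    ultimately have "closure {l<..<r} \<subseteq> {s \<in> {l..r}. A (f s) - (fd s)\<^sup>2 = 0}" by (rule closure_minimal[rotated])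
    moreover have "l < r" using lr by simp
    ultimately show ?thesis using s by (auto simp: subset_iff)
  qed
  have mono: "f s < f t" if st: "l \<le> s" "s < t" "t \<le> r" for s t
  proof (rule DERIV_pos_imp_increasing_open[OF st(2)])
    show "\<exists>y. (f has_real_derivative y) (at u) \<and> 0 < y" if "s < u" "u < t" for u
      using D[of u] pos[of u] that st by auto
  qed (rule contf)
  have zero_end: "t = a \<or> t = b" if "t \<in> {a..b}" "A t = 0" for t
    using that A_pos[of t] by force
  have "f l = a \<or> f l = b" "f r = a \<or> f r = b" using zero_end[OF frange] qc[of l] qc[of r] lr by auto
  moreover have "f l < f r" using mono lr by simp
  ultimately have ends: "f l = a" "f r = b" using frange ab by force+
  have reg: "regular (?c s)" if "l < s" "s < r" for s
    using mono[of l s] mono[of s r] that ends S(1) unfolding regular_def f_def by auto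
  have fdsqrt: "fd s = sqrt (A (f s))" if "l < s" "s < r" for s
    using pos[OF that] q[OF that] by simp
  have "nrm (?c s) = ?c' s" if s: "l < s" "s < r" for s
  proof -
    have c1: "?c' s \<bullet> ?c' s = 1"
      using inner_great_circle(1)[of "nrm x" "- x" s s] n by (auto simp: inner_commute)
    have "(nrm (?c s) - ?c' s) \<bullet> (nrm (?c s) - ?c' s) = 2 - 2 * (nrm (?c s) \<bullet> ?c' s)"
      using c1 regularD(8)[OF reg[OF s]] by (simp add: inner_diff_left inner_diff_right inner_commute norm_eq_1)
    moreover have "nrm (?c s) \<bullet> ?c' s = 1"
      using fdsqrt[OF s] regularD(5,6,7)[OF reg[OF s]] unfolding fd_def f_def nrm_def by simp
    ultimately show ?thesis by simp
  qed
  then show thesis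
    using that[of l r] lr ends reg fdsqrt unfolding f_def fd_def by blast
qed

end

section \<open>The distance from a focal set\<close>

context isoparametric_foliation
begin

text \<open>The times at which the normal great circle through \<open>x\<close> meets the two focal sets next to \<open>x\<close>; in
between it is an integral curve of the unit normal field.\<close>

definition flow_interval :: "'a \<Rightarrow> real \<Rightarrow> real \<Rightarrow> bool" where
  "flow_interval x l r \<longleftrightarrow> l < 0 \<and> 0 < r \<and> F (great_circle x (nrm x) l) = a \<and> F (great_circle x (nrm x) r) = b \<and>
     (\<forall>s. l < s \<and> s < r \<longrightarrow> regular (great_circle x (nrm x) s) \<and>
        nrm (great_circle x (nrm x) s) = great_circle (nrm x) (- x) s \<and>
        G (great_circle x (nrm x) s) \<bullet> great_circle (nrm x) (- x) s = sqrt (A (F (great_circle x (nrm x) s)))) \<and>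
     G (great_circle x (nrm x) l) \<bullet> great_circle (nrm x) (- x) l = 0 \<and>
     G (great_circle x (nrm x) r) \<bullet> great_circle (nrm x) (- x) r = 0"

lemma flow_interval_exists: "regular x \<Longrightarrow> \<exists>l r. flow_interval x l r"
  using normal_geodesic[of x] unfolding flow_interval_def by metis

definition base_point :: 'a where "base_point = (SOME x. regular x)"
definition base_start :: real where "base_start = (SOME l. \<exists>r. flow_interval base_point l r)"
definition base_end :: real where "base_end = (SOME r. flow_interval base_point base_start r)"
definition D :: real where "D = base_end - base_start"

text \<open>The values of \<open>F\<close> along one normal great circle, which starts on the level \<open>a\<close> at time \<open>0\<close> and
reaches the level \<open>b\<close> at time \<open>D\<close>.\<close>

definition profile :: "real \<Rightarrow> real" where
  "profile s = F (great_circle base_point (nrm base_point) (s + base_start))"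
definition profile_d :: "real \<Rightarrow> real" where
  "profile_d s = G (great_circle base_point (nrm base_point) (s + base_start)) \<bullet> great_circle (nrm base_point) (- base_point) (s + base_start)"
definition profile_dd :: "real \<Rightarrow> real" where
  "profile_dd s = H (great_circle base_point (nrm base_point) (s + base_start)) (great_circle (nrm base_point) (- base_point) (s + base_start))
      \<bullet> great_circle (nrm base_point) (- base_point) (s + base_start)"

text \<open>The distance from the level \<open>a\<close> as a function of the value of \<open>F\<close>; see \<open>sdist_set_eq_V\<close>.\<close>

definition V :: "real \<Rightarrow> real" where "V = the_inv_into {0..D} profile"

lemma regular_base: "regular base_point"
proof -
  have "(a + b) / 2 \<in> F ` usphere" using range_F ab by auto
  then obtain x where "x \<in> usphere" "F x = (a + b) / 2" by auto
  then have "regular x" unfolding regular_def using ab by auto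
  then show ?thesis unfolding base_point_def by (rule someI)
qed

lemma base_interval: "flow_interval base_point base_start base_end"
proof -
  have "\<exists>r. flow_interval base_point base_start r"
    unfolding base_start_def using flow_interval_exists[OF regular_base] by (rule someI_ex)
  then show ?thesis unfolding base_end_def by (rule someI_ex)
qed

lemma D_pos: "D > 0"
  using base_interval unfolding flow_interval_def D_def by simp

lemma profile_deriv: "(profile has_real_derivative profile_d s) (at s)" "(profile_d has_real_derivative profile_dd s) (at s)"
proof -
  note R = regularD[OF regular_base]
  have "((\<lambda>s. s + base_start) has_real_derivative 1) (at s)" by (auto intro!: derivative_eq_intros)
  then show "(profile has_real_derivative profile_d s) (at s)" "(profile_d has_real_derivative profile_dd s) (at s)"
    unfolding profile_def[abs_def] profile_d_def[abs_def] profile_dd_def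
    using DERIV_chain2[OF F_along_great_circle(1)[OF R(2,8,9)], of "\<lambda>s. s + base_start" 1 s]
      DERIV_chain2[OF F_along_great_circle(2)[OF R(2,8,9)], of "\<lambda>s. s + base_start" 1 s] by auto
qed

lemma profile_range: "profile s \<in> {a..b}"
  unfolding profile_def using F_range great_circle_in_usphere(1) regularD[OF regular_base] by blast

lemma profile_ends: "profile 0 = a" "profile D = b" "profile_d 0 = 0" "profile_d D = 0"
  using base_interval unfolding flow_interval_def profile_def profile_d_def D_def by auto

lemma profile_inside:
  assumes "0 < s" "s < D"
  shows "a < profile s" "profile s < b" "profile_d s = sqrt (A (profile s))" "profile_d s > 0"
proof -
  have s: "base_start < s + base_start" "s + base_start < base_end" using assms unfolding D_def by auto
  then have "regular (great_circle base_point (nrm base_point) (s + base_start))" "profile_d s = sqrt (A (profile s))"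
    using base_interval unfolding flow_interval_def profile_def profile_d_def by blast+
  then show "a < profile s" "profile s < b" "profile_d s = sqrt (A (profile s))" "profile_d s > 0"
    using regularD(3,4,5) unfolding profile_def by auto
qed

lemma continuous_profile: "continuous_on T profile" "continuous_on T profile_d"
  by (rule DERIV_continuous_on[OF has_field_derivative_at_within[OF profile_deriv(1)]],
      rule DERIV_continuous_on[OF has_field_derivative_at_within[OF profile_deriv(2)]])

lemma continuous_profile_dd: "continuous_on T profile_dd"
proof -
  note R = regularD[OF regular_base]
  let ?c = "\<lambda>s. great_circle base_point (nrm base_point) (s + base_start)"
  have S: "?c s \<in> usphere" "?c s \<noteq> 0" for s using great_circle_in_usphere[OF R(2,8,9)] by auto
  have c: "continuous_on T ?c" unfolding great_circle_def by (intro continuous_intros)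
  have Hc: "continuous_on T (\<lambda>s. H (?c s) v)" for v
    by (rule continuous_on_compose2[OF egrad_has_derivative(2)[OF smooth_F] c]) (use S in auto)
  have "H (?c s) (great_circle (nrm base_point) (- base_point) (s + base_start))
      = cos (s + base_start) *\<^sub>R H (?c s) (nrm base_point) - sin (s + base_start) *\<^sub>R H (?c s) base_point" for s
    using linear_H[OF S(1)] by (simp add: great_circle_def[of "nrm base_point"] linear_diff linear_cmul)
  then have "profile_dd = (\<lambda>s. (cos (s + base_start) *\<^sub>R H (?c s) (nrm base_point) - sin (s + base_start) *\<^sub>R H (?c s) base_point)
      \<bullet> great_circle (nrm base_point) (- base_point) (s + base_start))"
    unfolding profile_dd_def[abs_def] by simp
  moreover have "continuous_on T \<dots>"
    by (intro continuous_intros Hc) (simp add: great_circle_def, intro continuous_intros)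
  ultimately show ?thesis by simp
qed

lemma continuous_Ad: "continuous_on {a..b} Ad" "continuous_on {a..b} A"
  using smooth_interval_imp_Ck_on[OF ab smooth_Ad, of 0] smooth_interval_imp_Ck_on[OF ab smooth_A, of 0] by auto

lemma closed_interval_density:
  fixes h :: "real \<Rightarrow> real"
  assumes "l < r" "continuous_on {l..r} h" "\<And>s. l < s \<Longrightarrow> s < r \<Longrightarrow> h s = c" "s \<in> {l..r}"
  shows "h s = c"
proof -
  have "closed {s \<in> {l..r}. h s = c}"
    by (rule continuous_closed_preimage_constant[OF assms(2)]) simp
  moreover have "{l<..<r} \<subseteq> {s \<in> {l..r}. h s = c}" using assms(3) by auto
  ultimately have "closure {l<..<r} \<subseteq> {s \<in> {l..r}. h s = c}" by (rule closure_minimal[rotated])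
  then show ?thesis using assms(1,4) by (auto simp: subset_iff)
qed

text \<open>Differentiate \<open>(profile')\<^sup>2 = A(profile)\<close> and divide by \<open>profile'\<close>; the end points follow by continuity.\<close>

lemma profile_dd_eq:
  assumes "s \<in> {0..D}"
  shows "profile_dd s = Ad (profile s) / 2"
proof -
  have "profile_dd s - Ad (profile s) / 2 = 0"
  proof (rule closed_interval_density[OF D_pos _ _ assms])
    show "continuous_on {0..D} (\<lambda>s. profile_dd s - Ad (profile s) / 2)"
      by (intro continuous_intros continuous_profile_dd continuous_on_compose2[OF continuous_Ad(1) continuous_profile(1)])
        (use profile_range in auto)
    fix s assume s: "0 < s" "s < D"
    have "((\<lambda>s. A (profile s)) has_real_derivative Ad (profile s) * profile_d s) (at s)"
      by (rule interval_chain[OF A_deriv profile_deriv(1)]) (rule profile_range)+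
    moreover have "((\<lambda>s. A (profile s)) has_real_derivative 2 * profile_d s * profile_dd s) (at s)"
    proof (rule has_field_derivative_transform_within_open[where S = "{0<..<D}"])
      show "((\<lambda>s. (profile_d s)\<^sup>2) has_real_derivative 2 * profile_d s * profile_dd s) (at s)"
        by (auto intro!: derivative_eq_intros profile_deriv(2))
      show "(profile_d u)\<^sup>2 = A (profile u)" if "u \<in> {0<..<D}" for u
        using profile_inside[of u] that A_nonneg[OF profile_range[of u]] by simp
    qed (use s in auto)
    ultimately have "Ad (profile s) * profile_d s = 2 * profile_d s * profile_dd s" by (rule DERIV_unique)
    then show "profile_dd s - Ad (profile s) / 2 = 0" using profile_inside(4)[OF s] by simp
  qed
  then show ?thesis by simp
qed

lemma profile_strict_mono: "0 \<le> s \<Longrightarrow> s < t \<Longrightarrow> t \<le> D \<Longrightarrow> profile s < profile t"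
proof -
  assume st: "0 \<le> s" "s < t" "t \<le> D"
  show "profile s < profile t"
  proof (rule DERIV_pos_imp_increasing_open[OF st(2)])
    show "\<exists>y. (profile has_real_derivative y) (at u) \<and> 0 < y" if "s < u" "u < t" for u
      using profile_deriv(1)[of u] profile_inside(4)[of u] that st by auto
  qed (rule continuous_profile)
qed

lemma inj_profile: "inj_on profile {0..D}"
proof (rule inj_onI)
  fix x y assume "x \<in> {0..D}" "y \<in> {0..D}" "profile x = profile y"
  then show "x = y" using profile_strict_mono[of x y] profile_strict_mono[of y x] by (cases x y rule: linorder_cases) auto
qed

lemma profile_image: "profile ` {0..D} = {a..b}"
proof
  show "profile ` {0..D} \<subseteq> {a..b}" using profile_range by blast
  show "{a..b} \<subseteq> profile ` {0..D}"
  proof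
    fix t assume "t \<in> {a..b}"
    then show "t \<in> profile ` {0..D}"
      using IVT'[of profile 0 t D] profile_ends D_pos continuous_profile(1)[of "{0..D}"] by auto
  qed
qed

lemma V_profile: "s \<in> {0..D} \<Longrightarrow> V (profile s) = s"
  unfolding V_def by (rule the_inv_into_f_f[OF inj_profile])

lemma profile_V: "t \<in> {a..b} \<Longrightarrow> profile (V t) = t"
  unfolding V_def by (rule f_the_inv_into_f[OF inj_profile]) (simp add: profile_image)

lemma V_range: "t \<in> {a..b} \<Longrightarrow> V t \<in> {0..D}"
  unfolding V_def by (rule the_inv_into_into[OF inj_profile]) (auto simp: profile_image)

lemma V_ends: "V a = 0" "V b = D"
  using V_profile[of 0] V_profile[of D] profile_ends D_pos by auto

lemma V_inside: "a < t \<Longrightarrow> t < b \<Longrightarrow> 0 < V t" "a < t \<Longrightarrow> t < b \<Longrightarrow> V t < D"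
  using V_range[of t] profile_V[of t] profile_ends by (fastforce simp: le_less)+

lemma continuous_V: "continuous_on {a..b} V"
  using continuous_on_inv[of "{0..D}" profile V] continuous_profile(1) V_profile by (simp add: profile_image)

lemma V_deriv:
  assumes t: "a < t" "t < b"
  shows "(V has_real_derivative 1 / sqrt (A t)) (at t)"
proof -
  have "isCont V t"
    using continuous_V t by (metis atLeastAtMost_iff continuous_on_interior greaterThanLessThan_iff interior_atLeastAtMost_real)
  moreover have "profile_d (V t) = sqrt (A t)"
    using profile_inside(3)[OF V_inside[OF t]] profile_V[of t] t by simp
  ultimately show ?thesis
    using DERIV_inverse_function[where f = profile and g = V and x = t and D = "sqrt (A t)" and a = a and b = b] profile_deriv(1)[of "V t"] profile_V A_pos[OF t] t
    by (simp add: inverse_eq_divide)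
qed

text \<open>Along every normal great circle \<open>V \<circ> F\<close> has derivative \<open>1\<close>, so all of them take the same time \<open>D\<close>
from the level \<open>a\<close> to the level \<open>b\<close>.\<close>

lemma flow_time:
  assumes x: "regular x" and I: "flow_interval x l r"
  shows "l = - V (F x)" "r = D - V (F x)" "\<And>s. s \<in> {l..r} \<Longrightarrow> V (F (great_circle x (nrm x) s)) = V (F x) + s"
proof -
  note R = regularD[OF x]
  let ?c = "great_circle x (nrm x)"
  have lr: "l < 0" "0 < r" "F (?c l) = a" "F (?c r) = b"
    and inner: "\<And>s. l < s \<Longrightarrow> s < r \<Longrightarrow> regular (?c s)"
      "\<And>s. l < s \<Longrightarrow> s < r \<Longrightarrow> G (?c s) \<bullet> great_circle (nrm x) (- x) s = sqrt (A (F (?c s)))"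
    using I unfolding flow_interval_def by auto
  note S = great_circle_in_usphere[OF R(2,8,9)]
  have const: "V (F (?c s)) - s = V (F (?c l)) - l" if s: "s \<in> {l..r}" for s
  proof (rule DERIV_isconst2[of l r])
    have "continuous_on {l..r} (\<lambda>s. F (?c s))"
      by (rule DERIV_continuous_on[OF has_field_derivative_at_within[OF F_along_great_circle(1)[OF R(2,8,9)]]])
    then show "continuous_on {l..r} (\<lambda>s. V (F (?c s)) - s)"
      by (intro continuous_intros continuous_on_compose2[OF continuous_V]) (use F_range[OF S(1)] in auto)
    fix s assume s: "l < s" "s < r"
    have "(V has_real_derivative 1 / sqrt (A (F (?c s)))) (at (F (?c s)))"
      using regularD(3,4)[OF inner(1)[OF s]] by (rule V_deriv)
    from DERIV_chain2[OF this F_along_great_circle(1)[OF R(2,8,9)]]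
    have "((\<lambda>s. V (F (?c s))) has_real_derivative 1) (at s)"
      using inner(2)[OF s] regularD(5)[OF inner(1)[OF s]] by simp
    then show "((\<lambda>s. V (F (?c s)) - s) has_real_derivative 0) (at s)"
      by (auto intro!: derivative_eq_intros)
  qed (use s lr in auto)
  have 0: "V (F x) = - l" using const[of 0] lr V_ends by simp
  then show "l = - V (F x)" by simp
  show "r = D - V (F x)" using const[of r] lr V_ends 0 by simp
  show "V (F (?c s)) = V (F x) + s" if "s \<in> {l..r}" for s using const[OF that] lr V_ends 0 by simp
qed

lemma flow:
  assumes x: "regular x"
  shows "0 < V (F x)" "V (F x) < D"
    "V (F x) + s \<in> {0..D} \<Longrightarrow> F (great_circle x (nrm x) s) = profile (V (F x) + s)"
    "0 < V (F x) + s \<Longrightarrow> V (F x) + s < D \<Longrightarrow> regular (great_circle x (nrm x) s)"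
    "0 < V (F x) + s \<Longrightarrow> V (F x) + s < D \<Longrightarrow> nrm (great_circle x (nrm x) s) = great_circle (nrm x) (- x) s"
proof -
  note R = regularD[OF x]
  let ?c = "great_circle x (nrm x)"
  obtain l r where I: "flow_interval x l r" using flow_interval_exists[OF x] by blast
  note T = flow_time[OF x I]
  show "0 < V (F x)" "V (F x) < D" using V_inside R by auto
  show "F (?c s) = profile (V (F x) + s)" if "V (F x) + s \<in> {0..D}"
  proof -
    have "s \<in> {l..r}" using that T(1,2) by auto
    then show ?thesis using T(3) profile_V[of "F (?c s)"] F_range great_circle_in_usphere(1)[OF R(2,8,9)] by metis
  qed
  show "regular (?c s)" "nrm (?c s) = great_circle (nrm x) (- x) s" if "0 < V (F x) + s" "V (F x) + s < D"
    using I that T(1,2) unfolding flow_interval_def by auto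
qed

text \<open>\<open>V \<circ> F\<close> grows at most with unit speed along a great circle at regular points. Since \<open>V\<close> is not
differentiable at the end points, the estimate is made between the last visit to the level \<open>a\<close> and
the first later time at which the final value is attained.\<close>

lemma V_le_sdist:
  assumes x: "x \<in> usphere" and y: "y \<in> level_set F a"
  shows "V (F x) \<le> sdist x y"
proof -
  have y': "norm y = 1" "F y = a" and x': "norm x = 1" using x y unfolding level_set_def by auto
  have sd: "sdist x y = arccos (y \<bullet> x)" unfolding sdist_def by (simp add: inner_commute)
  obtain w where w: "norm w = 1" "y \<bullet> w = 0" "x = great_circle y w (sdist x y)"
    using great_circle_connects[OF y'(1) x'] dim3 unfolding sd by (metis numeral_3_eq_3 Suc_leD numeral_2_eq_2)
  define L where "L = sdist x y"
  have L0: "L \<ge> 0"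
    unfolding L_def sd using Cauchy_Schwarz_ineq2[of y x] x' y' by (intro arccos_lbound) auto
  let ?c = "great_circle y w"
  note S = great_circle_in_usphere[OF y'(1) w(1,2)]
  define k where "k s = V (F (?c s))" for s
  have contk: "continuous_on {0..L} k"
  proof -
    have "continuous_on {0..L} (\<lambda>s. F (?c s))"
      by (rule DERIV_continuous_on[OF has_field_derivative_at_within[OF F_along_great_circle(1)[OF y'(1) w(1,2)]]])
    then show ?thesis unfolding k_def
      by (intro continuous_on_compose2[OF continuous_V]) (use F_range[OF S(1)] in auto)
  qed
  have k0: "k 0 = 0" "k L = V (F x)" unfolding k_def L_def using w(3) y' V_ends by auto
  have krange: "k s \<in> {0..D}" for s unfolding k_def using V_range F_range S(1) by blast
  have kreg: "regular (?c s)" if "0 < k s" "k s < D" for s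
  proof -
    have "F (?c s) \<noteq> a" "F (?c s) \<noteq> b" using that V_ends unfolding k_def by auto
    then show ?thesis using F_range[OF S(1)[of s]] S(1)[of s] unfolding regular_def by force
  qed
  show ?thesis
  proof (cases "k L = 0")
    case True
    then show ?thesis using k0 L0 unfolding L_def by simp
  next
    case False
    then have kL: "k L > 0" "k L \<le> D" using krange[of L] by auto
    let ?Z0 = "{0..L} \<inter> k -` {0}"
    have "closed ?Z0" by (intro continuous_closed_preimage[OF contk]) auto
    then have "compact ?Z0" by (metis bounded_closed_interval bounded_Int compact_eq_bounded_closed)
    moreover have "0 \<in> ?Z0" using k0 L0 by auto
    ultimately obtain t0 where t0: "t0 \<in> ?Z0" "\<And>s. s \<in> ?Z0 \<Longrightarrow> s \<le> t0"
      using compact_attains_sup[of ?Z0] by blast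
    let ?Z1 = "{t0..L} \<inter> k -` {k L}"
    have "continuous_on {t0..L} k" using contk t0(1) by (auto intro: continuous_on_subset)
    then have "closed ?Z1" by (intro continuous_closed_preimage) auto
    then have "compact ?Z1" by (metis bounded_closed_interval bounded_Int compact_eq_bounded_closed)
    moreover have "L \<in> ?Z1" using t0(1) by auto
    ultimately obtain t1 where t1: "t1 \<in> ?Z1" "\<And>s. s \<in> ?Z1 \<Longrightarrow> t1 \<le> s"
      using compact_attains_inf[of ?Z1] by blast
    have tt: "0 \<le> t0" "t0 < t1" "t1 \<le> L" "k t0 = 0" "k t1 = k L" using t0(1) t1(1) kL by (auto simp: le_less)
    have inside: "0 < k s \<and> k s < D" if s: "t0 < s" "s < t1" for s
    proof
      have "k s \<noteq> 0" using t0(2)[of s] s tt by auto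
      then show "0 < k s" using krange[of s] by auto
      show "k s < D"
      proof (rule ccontr)
        assume "\<not> k s < D"
        moreover have "continuous_on {t0..s} k" using contk s tt by (auto intro: continuous_on_subset)
        ultimately obtain u where "t0 \<le> u" "u \<le> s" "k u = k L"
          using IVT'[of k t0 "k L" s] kL tt s by auto
        then show False using t1(2)[of u] s tt by auto
      qed
    qed
    have "\<exists>l z. t0 < z \<and> z < t1 \<and> (k has_real_derivative l) (at z) \<and> k t1 - k t0 = (t1 - t0) * l"
    proof (rule MVT[OF tt(2)])
      show "continuous_on {t0..t1} k" using contk tt by (auto intro: continuous_on_subset)
      show "k differentiable (at s)" if s: "t0 < s" "s < t1" for s
        using DERIV_chain2[OF V_deriv[OF regularD(3,4)[OF kreg]] F_along_great_circle(1)[OF y'(1) w(1,2)]] inside[OF s]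
        unfolding k_def real_differentiable_def by blast
    qed
    then obtain l z where z: "t0 < z" "z < t1" "(k has_real_derivative l) (at z)" "k t1 - k t0 = (t1 - t0) * l" by blast
    have R: "regular (?c z)" using inside[OF z(1,2)] kreg by blast
    have "(k has_real_derivative (1 / sqrt (A (F (?c z)))) * (G (?c z) \<bullet> great_circle w (- y) z)) (at z)"
      unfolding k_def
      by (rule DERIV_chain2[OF V_deriv[OF regularD(3,4)[OF R]] F_along_great_circle(1)[OF y'(1) w(1,2)]])
    then have l: "l = (1 / sqrt (A (F (?c z)))) * (G (?c z) \<bullet> great_circle w (- y) z)"
      using z(3) DERIV_unique by blast
    have "norm (great_circle w (- y) z) = 1"
      by (rule great_circle_in_usphere(3)) (use y' w in \<open>auto simp: inner_commute\<close>)
    then have "G (?c z) \<bullet> great_circle w (- y) z \<le> sqrt (A (F (?c z)))"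
      using norm_cauchy_schwarz[of "G (?c z)" "great_circle w (- y) z"] regularD(6)[OF R] by simp
    then have "l \<le> 1" unfolding l using regularD(5)[OF R] by (simp add: field_simps)
    then have "(t1 - t0) * l \<le> (t1 - t0) * 1" using tt by (intro mult_left_mono) auto
    then have "k L \<le> t1 - t0" using z(4) tt by simp
    then show ?thesis using tt k0 unfolding L_def by simp
  qed
qed

lemma level_a_nonempty: "level_set F a \<noteq> {}"
proof -
  have "a \<in> F ` usphere" using range_F ab by auto
  then show ?thesis unfolding level_set_def by auto
qed

lemma sdist_nonneg: "x \<in> usphere \<Longrightarrow> y \<in> level_set F a \<Longrightarrow> 0 \<le> sdist x y"
  using Cauchy_Schwarz_ineq2[of x y] unfolding sdist_def level_set_def by (intro arccos_lbound) auto

lemma V_le_sdist_set: "x \<in> usphere \<Longrightarrow> V (F x) \<le> sdist_set x (level_set F a)"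
  unfolding sdist_set_def by (rule cINF_greatest[OF level_a_nonempty V_le_sdist])

text \<open>The distance is realized by the normal great circle through \<open>x\<close>.\<close>

lemma sdist_set_eq_V:
  assumes x: "x \<in> usphere" and b: "F x < b"
  shows "sdist_set x (level_set F a) = V (F x)"
proof -
  have bdd: "bdd_below (sdist x ` level_set F a)"
    using sdist_nonneg[OF x] by (rule bdd_belowI2)
  have "\<exists>y\<in>level_set F a. sdist x y \<le> V (F x)"
  proof (cases "F x = a")
    case True
    then have "x \<in> level_set F a" "sdist x x = 0"
      using x unfolding level_set_def sdist_def by (auto simp: norm_eq_1)
    then show ?thesis unfolding True V_ends by (intro bexI[of _ x]) simp_all
  next
    case False
    then have r: "regular x" using x b F_range[OF x] unfolding regular_def by auto
    note R = regularD[OF r]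
    let ?s = "- V (F x)"
    have V: "0 < V (F x)" "V (F x) < D" using flow(1,2)[OF r] by auto
    have "F (great_circle x (nrm x) ?s) = a"
      using flow(3)[OF r, of ?s] D_pos profile_ends by simp
    then have "great_circle x (nrm x) ?s \<in> level_set F a"
      using great_circle_in_usphere(1)[OF R(2,8,9)] unfolding level_set_def by simp
    moreover have "sdist x (great_circle x (nrm x) ?s) = arccos (cos (V (F x)))"
      unfolding sdist_def using inner_great_circle(1)[OF R(2,8,9), of 0 ?s] by simp
    moreover have "arccos (cos v) \<le> v" if "v \<ge> 0" for v :: real
    proof (cases "v \<le> pi")
      case True
      then show ?thesis using that by (simp add: arccos_cos)
    next
      case False
      then show ?thesis using arccos_ubound[of "cos v"] by simp
    qed
    ultimately show ?thesis using V by (metis less_imp_le)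
  qed
  then obtain y where "y \<in> level_set F a" "sdist x y \<le> V (F x)" by blast
  then have "sdist_set x (level_set F a) \<le> V (F x)"
    unfolding sdist_set_def by (rule cINF_lower2[OF bdd])
  then show ?thesis using V_le_sdist_set[OF x] by simp
qed

end

section \<open>Shape operators of parallel level sets\<close>

text \<open>Otherwise the derivative would have a nonzero component along a vector orthogonal to \<open>L\<close>, whereas
the component of \<open>f\<close> along it is constantly zero.\<close>

lemma vector_derivative_in_subspace:
  fixes f :: "real \<Rightarrow> 'a::euclidean_space"
  assumes f: "(f has_vector_derivative v) (at t)" and L: "subspace L"
    and d: "d > 0" "\<And>s. \<bar>s - t\<bar> < d \<Longrightarrow> f s \<in> L"
  shows "v \<in> L"
proof (rule ccontr)
  assume "v \<notin> L"
  obtain p where p: "p \<in> span L" "\<And>u. u \<in> span L \<Longrightarrow> orthogonal (v - p) u"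
    using orthogonal_subspace_decomp_exists[of L v] by (metis add_diff_cancel_left')
  define q where "q = v - p"
  have sp: "span L = L" using L span_eq_iff by blast
  have q0: "q \<noteq> 0" using p(1) \<open>v \<notin> L\<close> sp unfolding q_def by auto
  have qL: "q \<bullet> u = 0" if "u \<in> L" for u using p(2) that sp unfolding q_def orthogonal_def by auto
  have "((\<lambda>s. q \<bullet> f s) has_vector_derivative q \<bullet> v) (at t)"
    by (rule bounded_linear.has_vector_derivative[OF bounded_linear_inner_right f])
  then have "((\<lambda>s. 0) has_vector_derivative q \<bullet> v) (at t)"
    by (rule has_vector_derivative_transform_within_open[where S = "ball t d"])
      (use d qL in \<open>auto simp: dist_real_def abs_minus_commute\<close>)
  then have "q \<bullet> v = 0" using vector_derivative_unique_at has_vector_derivative_const by blast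
  moreover have "q \<bullet> p = 0" using qL p(1) sp by simp
  ultimately have "q \<bullet> q = 0" unfolding q_def by (simp add: inner_diff_right)
  then show False using q0 by simp
qed

context isoparametric_foliation
begin

lemma nrm_has_derivative:
  assumes x: "regular x"
  obtains N where "(nrm has_derivative N) (at x)" "\<And>v. G x \<bullet> H x v = 0 \<Longrightarrow> N v = H x v /\<^sub>R norm (G x)"
proof -
  note R = regularD[OF x]
  have dG: "(G has_derivative H x) (at x)" by (rule egrad_has_derivative(1)[OF smooth_F nonzero_on_usphere[OF R(1)]])
  have dn: "((\<lambda>y. norm (G y)) has_derivative (\<lambda>v. H x v \<bullet> sgn (G x))) (at x)"
    using has_derivative_compose[OF dG has_derivative_norm[OF R(7)]] by (simp add: inner_commute)
  have "norm (G x) \<noteq> 0" using R(7) by simp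
  from has_derivative_scaleR[OF Deriv.has_derivative_inverse[OF this dn] dG]
  have "(nrm has_derivative (\<lambda>v. inverse (norm (G x)) *\<^sub>R H x v
      + - (inverse (norm (G x)) * (H x v \<bullet> sgn (G x)) * inverse (norm (G x))) *\<^sub>R G x)) (at x)"
    unfolding nrm_def[abs_def] by simp
  then show thesis
    by (rule that) (simp add: sgn_div_norm inner_commute)
qed

text \<open>The tangent space at \<open>x\<close> of the level set through \<open>x\<close>.\<close>

definition normal_space :: "'a \<Rightarrow> 'a set" where
  "normal_space x = {v. x \<bullet> v = 0 \<and> nrm x \<bullet> v = 0}"

lemma subspace_normal_space: "subspace (normal_space x)"
  unfolding normal_space_def subspace_def by (auto simp: inner_add_right)

lemma H_normal_space:
  assumes x: "regular x" and v: "v \<in> normal_space x"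
  shows "G x \<bullet> H x v = 0" "x \<bullet> H x v = 0" "H x v \<in> normal_space x"
proof -
  note R = regularD[OF x]
  have v': "v \<in> tangent x" "G x \<bullet> v = 0" using v R(10) unfolding normal_space_def tangent_def by auto
  show GH: "G x \<bullet> H x v = 0" using G_H[OF R(1) v'(1)] v'(2) by simp
  show xH: "x \<bullet> H x v = 0"
    using inner_ehess_self[OF smooth_F nonzero_on_usphere[OF R(1)], of v] v'(2) by (simp add: inner_commute)
  show "H x v \<in> normal_space x" unfolding normal_space_def nrm_def using GH xH by simp
qed

lemma dim_normal_space:
  assumes x: "regular x"
  shows "dim (normal_space x) = DIM('a) - 2"
proof -
  note R = regularD[OF x]
  have ne: "x \<noteq> nrm x" using R(2,9) norm_eq_1[of x] by auto
  have "pairwise orthogonal {x, nrm x}" using R(9) by (auto simp: pairwise_def orthogonal_def inner_commute)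
  moreover have "0 \<notin> {x, nrm x}" using R(2,8) by auto
  ultimately have "independent {x, nrm x}" by (rule pairwise_orthogonal_independent)
  then have d2: "dim (span {x, nrm x}) = 2" using dim_span_eq_card_independent ne by fastforce
  have "{y \<in> UNIV. \<forall>u\<in>span {x, nrm x}. orthogonal u y} = normal_space x"
  proof -
    have "(\<forall>u\<in>span {x, nrm x}. orthogonal u y) \<longleftrightarrow> y \<in> normal_space x" for y
    proof
      assume "\<forall>u\<in>span {x, nrm x}. orthogonal u y"
      then show "y \<in> normal_space x" unfolding normal_space_def orthogonal_def by (auto simp: span_base)
    next
      assume "y \<in> normal_space x"
      then have "orthogonal y u" if "u \<in> {x, nrm x}" for u
        using that unfolding normal_space_def orthogonal_def by (auto simp: inner_commute)
      then show "\<forall>u\<in>span {x, nrm x}. orthogonal u y"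
        using orthogonal_to_span orthogonal_commute by blast
    qed
    then show ?thesis by simp
  qed
  then show ?thesis
    using dim_subspace_orthogonal_to_vectors[of "span {x, nrm x}" UNIV] d2 by simp
qed

text \<open>An orthonormal basis of principal directions with the principal curvatures \<open>\<kappa>\<close>, expressed through
the Hessian: on this space the shape operator is \<open>- H x / |G x|\<close>.\<close>

definition principal_basis :: "'a \<Rightarrow> 'a set \<Rightarrow> ('a \<Rightarrow> real) \<Rightarrow> bool" where
  "principal_basis x Q \<kappa> \<longleftrightarrow> finite Q \<and> span Q = normal_space x \<and> card Q = DIM('a) - 2 \<and> pairwise orthogonal Q \<and>
     (\<forall>v\<in>Q. norm v = 1 \<and> H x v = (- norm (G x) * \<kappa> v) *\<^sub>R v)"

lemma principal_basis_exists:
  assumes x: "regular x"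
  shows "\<exists>Q \<kappa>. principal_basis x Q \<kappa>"
proof -
  note R = regularD[OF x]
  obtain Q c where Q: "finite Q" "span Q = normal_space x" "card Q = dim (normal_space x)" "pairwise orthogonal Q"
    "\<forall>v\<in>Q. norm v = 1 \<and> H x v = c v *\<^sub>R v"
    using symmetric_eigenbasis[OF subspace_normal_space linear_H[OF R(1)] H_normal_space(3)[OF x] H_sym[OF R(1)]]
    by metis
  then have "principal_basis x Q (\<lambda>v. - c v / norm (G x))"
    using R(7) unfolding principal_basis_def dim_normal_space[OF x] by simp
  then show ?thesis by blast
qed

lemma principal_basis_subset: "principal_basis x Q \<kappa> \<Longrightarrow> v \<in> Q \<Longrightarrow> v \<in> normal_space x"
  unfolding principal_basis_def using span_base by blast

lemma principal_curvatures_eq: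
  assumes x: "regular x" and Q: "principal_basis x Q \<kappa>"
  shows "principal_curvatures F x = \<kappa> ` Q"
proof -
  note R = regularD[OF x]
  obtain N where N: "(nrm has_derivative N) (at x)" "\<And>v. G x \<bullet> H x v = 0 \<Longrightarrow> N v = H x v /\<^sub>R norm (G x)"
    using nrm_has_derivative[OF x] by blast
  have un: "unit_normal F z = nrm z" if "z \<in> usphere" for z
    unfolding unit_normal_def nrm_def sgrad_eq_egrad[OF smooth_F that] ..
  have D: "(unit_normal F has_derivative N) (at x within usphere)"
    by (rule has_derivative_transform[OF R(1) un has_derivative_at_withinI[OF N(1)]])
  have covd: "covd (unit_normal F) x v = H x v /\<^sub>R norm (G x)" if v: "v \<in> normal_space x" for v
  proof -
    have "v \<in> tangent x" using v unfolding normal_space_def tangent_def by simp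
    then have "sdiff (unit_normal F) x v = N v" by (rule sdiff_eq[OF R(1) D])
    also have "N v = H x v /\<^sub>R norm (G x)" using N(2) H_normal_space(1)[OF x v] by blast
    finally have "covd (unit_normal F) x v = tproj x (H x v /\<^sub>R norm (G x))" unfolding covd_def by simp
    also have "\<dots> = H x v /\<^sub>R norm (G x)"
      by (rule tproj_props(2)[OF R(2)]) (simp add: tangent_def H_normal_space(2)[OF x v])
    finally show ?thesis .
  qed
  show ?thesis
  proof
    show "\<kappa> ` Q \<subseteq> principal_curvatures F x"
    proof
      fix k assume "k \<in> \<kappa> ` Q"
      then obtain v where v: "v \<in> Q" "k = \<kappa> v" by blast
      have vn: "v \<in> normal_space x" by (rule principal_basis_subset[OF Q v(1)])
      have "norm v = 1" "H x v = (- norm (G x) * \<kappa> v) *\<^sub>R v" using Q v unfolding principal_basis_def by auto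
      then have "v \<noteq> 0" "- covd (unit_normal F) x v = k *\<^sub>R v"
        unfolding covd[OF vn] v(2) using R(7) by auto
      then show "k \<in> principal_curvatures F x"
        using vn un[OF R(1)] unfolding principal_curvatures_def normal_space_def tangent_def
        by (auto simp: inner_commute)
    qed
    show "principal_curvatures F x \<subseteq> \<kappa> ` Q"
    proof
      fix k assume "k \<in> principal_curvatures F x"
      then obtain v where v: "v \<in> normal_space x" "v \<noteq> 0" "- covd (unit_normal F) x v = k *\<^sub>R v"
        using un[OF R(1)] unfolding principal_curvatures_def normal_space_def tangent_def
        by (auto simp: inner_commute)
      have Hv: "H x v = (- norm (G x) * k) *\<^sub>R v"
      proof -
        have "norm (G x) *\<^sub>R (- covd (unit_normal F) x v) = norm (G x) *\<^sub>R (k *\<^sub>R v)" using v(3) by simp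
        then have "- H x v = (norm (G x) * k) *\<^sub>R v" unfolding covd[OF v(1)] using R(7) by simp
        then show ?thesis by (metis minus_mult_left scaleR_minus_left minus_equation_iff)
      qed
      have "v = (\<Sum>b\<in>Q. (v \<bullet> b) *\<^sub>R b)"
        using Q v(1) unfolding principal_basis_def by (intro orthonormal_basis_expansion) auto
      then obtain b where b: "b \<in> Q" "v \<bullet> b \<noteq> 0" using v(2) by (metis (no_types, lifting) scaleR_eq_0_iff sum.neutral)
      have "H x v \<bullet> b = v \<bullet> H x b" by (rule H_sym[OF R(1)])
      moreover have "H x b = (- norm (G x) * \<kappa> b) *\<^sub>R b" using Q b(1) unfolding principal_basis_def by blast
      ultimately have "k = \<kappa> b" using b(2) R(7) unfolding Hv by simp
      then show "k \<in> \<kappa> ` Q" using b(1) by blast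
    qed
  qed
qed

text \<open>Evaluate the trace of the Hessian in a basis of the tangent space of the sphere that consists of \<open>Q\<close>
and the unit normal; the normal direction contributes \<open>A'(F)/2\<close> by \<open>G_H\<close>.\<close>

lemma laplacian_trace:
  assumes y: "regular y" and Q: "finite Q" "span Q = normal_space y" "pairwise orthogonal Q" "\<And>v. v \<in> Q \<Longrightarrow> norm v = 1"
  shows "- B (F y) = (\<Sum>v\<in>Q. v \<bullet> H y v) + Ad (F y) / 2"
proof -
  note R = regularD[OF y]
  have Qn: "v \<in> normal_space y" if "v \<in> Q" for v using that Q(2) span_base by blast
  have nn: "nrm y \<bullet> nrm y = 1" using R(8) by (simp add: norm_eq_1)
  have nQ: "nrm y \<notin> Q" using Qn nn unfolding normal_space_def by force
  have nt: "nrm y \<in> tangent y" using R(9) unfolding tangent_def by simp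
  have "span (insert (nrm y) Q) = tangent y"
  proof
    have "subspace (tangent y)" unfolding tangent_def subspace_def by (auto simp: inner_add_right)
    then show "span (insert (nrm y) Q) \<subseteq> tangent y"
      using nt Qn by (intro span_minimal) (auto simp: normal_space_def tangent_def)
    show "tangent y \<subseteq> span (insert (nrm y) Q)"
    proof
      fix v assume v: "v \<in> tangent y"
      have "v - (nrm y \<bullet> v) *\<^sub>R nrm y \<in> span Q"
        unfolding Q(2) normal_space_def using v R(9) nn by (simp add: tangent_def inner_diff_right)
      then show "v \<in> span (insert (nrm y) Q)" unfolding span_insert by blast
    qed
  qed
  moreover have "pairwise orthogonal (insert (nrm y) Q)"
    using Q(3) Qn by (auto simp: pairwise_insert orthogonal_def normal_space_def inner_commute)
  moreover have "insert (nrm y) Q \<subseteq> tangent y" using nt Qn by (auto simp: normal_space_def tangent_def)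
  ultimately have "(\<Sum>e\<in>Basis. tproj y e \<bullet> H y (tproj y e)) = (\<Sum>b\<in>insert (nrm y) Q. b \<bullet> H y b)"
    using Q R(8) by (intro trace_tproj[OF R(2) linear_H[OF R(1)]]) auto
  also have "\<dots> = nrm y \<bullet> H y (nrm y) + (\<Sum>v\<in>Q. v \<bullet> H y v)"
    using Q(1) nQ by simp
  also have "nrm y \<bullet> H y (nrm y) = Ad (F y) / 2"
  proof -
    have "sqrt (A (F y)) * (nrm y \<bullet> H y (nrm y)) = Ad (F y) / 2 * sqrt (A (F y))"
      using G_H[OF R(1) nt] nn unfolding R(10) by simp
    then show ?thesis using R(5) by simp
  qed
  finally show ?thesis
    using laplacian_eq[OF R(1) sgrad_has_derivative[OF smooth_F R(1)]] laplacian_F[OF R(1)] by simp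
qed

lemma F_V_continuous_along:
  assumes "norm x = 1" "norm w = 1" "x \<bullet> w = 0"
  shows "continuous_on UNIV (\<lambda>r. F (great_circle x w r))" "continuous_on UNIV (\<lambda>r. V (F (great_circle x w r)))"
proof -
  show c: "continuous_on UNIV (\<lambda>r. F (great_circle x w r))"
    by (rule DERIV_continuous_on[OF has_field_derivative_at_within[OF F_along_great_circle(1)[OF assms]]])
  show "continuous_on UNIV (\<lambda>r. V (F (great_circle x w r)))"
    by (rule continuous_on_compose2[OF continuous_V c]) (use F_range[OF great_circle_in_usphere(1)[OF assms]] in auto)
qed

lemma regular_nearby:
  assumes x: "regular x" and w: "norm w = 1" "x \<bullet> w = 0"
  shows "eventually (\<lambda>r. regular (great_circle x w r)) (nhds 0)"
proof -
  note R = regularD[OF x]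
  have "open ((\<lambda>r. F (great_circle x w r)) -` {a<..<b})"
    using F_V_continuous_along(1)[OF R(2) w] by (intro open_vimage) auto
  then have "eventually (\<lambda>r. F (great_circle x w r) \<in> {a<..<b}) (nhds 0)"
    using eventually_nhds_in_open[of "(\<lambda>r. F (great_circle x w r)) -` {a<..<b}" 0] R by simp
  then show ?thesis
    by eventually_elim (use great_circle_in_usphere(1)[OF R(2) w] in \<open>auto simp: regular_def\<close>)
qed

lemma nrm_vector_derivative_along:
  assumes x: "regular x" and w: "w \<in> normal_space x" "norm w = 1" "H x w = (- norm (G x) * k) *\<^sub>R w"
  shows "((\<lambda>r. nrm (great_circle x w r)) has_vector_derivative (- k) *\<^sub>R w) (at 0)"
proof -
  note R = regularD[OF x]
  obtain N where N: "(nrm has_derivative N) (at x)" "\<And>v. G x \<bullet> H x v = 0 \<Longrightarrow> N v = H x v /\<^sub>R norm (G x)"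
    using nrm_has_derivative[OF x] by blast
  have "N w = (- k) *\<^sub>R w" using N(2)[OF H_normal_space(1)[OF x w(1)]] R(7) unfolding w(3) by simp
  moreover have "((\<lambda>r. nrm (great_circle x w r)) has_vector_derivative N w) (at 0)"
  proof (rule has_vector_derivative_compose_within[where S = UNIV and X = nrm and X' = N and c = "great_circle x w"])
    show "(nrm has_derivative N) (at (great_circle x w 0))" using N(1) by simp
    show "(great_circle x w has_vector_derivative w) (at 0)"
      using great_circle_has_vector_derivative[of x w 0] by simp
  qed simp
  ultimately show ?thesis by simp
qed

text \<open>Let \<open>x\<close> move along the great circle with velocity \<open>w\<close> and differentiate the statement that the
normal at the point reached after time \<open>s\<close> is the velocity of the normal circle. The point reached
moves with velocity \<open>(cos s - k sin s) w\<close>, and its normal changes by \<open>(- sin s - k cos s) w\<close>.\<close>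

lemma shape_operator_flow:
  assumes x: "regular x" and w: "w \<in> normal_space x" "norm w = 1" "H x w = (- norm (G x) * k) *\<^sub>R w"
    and s: "0 < V (F x) + s" "V (F x) + s < D" and y: "y = great_circle x (nrm x) s"
  shows "(cos s - k * sin s) *\<^sub>R H y w = (norm (G y) * (- sin s - k * cos s)) *\<^sub>R w" "w \<in> normal_space y"
proof -
  note R = regularD[OF x]
  let ?y = "great_circle x w"
  have xw: "x \<bullet> w = 0" "nrm x \<bullet> w = 0" using w(1) unfolding normal_space_def by auto
  have yr: "regular y" and ny: "nrm y = great_circle (nrm x) (- x) s" using flow(4,5)[OF x s] y by auto
  show wy: "w \<in> normal_space y"
  proof -
    have "nrm y \<bullet> w = 0" unfolding ny using xw by (simp add: great_circle_def inner_diff_left)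
    moreover have "y \<bullet> w = 0" unfolding y using xw by (simp add: great_circle_def inner_add_left)
    ultimately show ?thesis unfolding normal_space_def by simp
  qed
  obtain N where N: "(nrm has_derivative N) (at y)" "\<And>v. G y \<bullet> H y v = 0 \<Longrightarrow> N v = H y v /\<^sub>R norm (G y)"
    using nrm_has_derivative[OF yr] by blast
  have dn: "((\<lambda>r. nrm (?y r)) has_vector_derivative (- k) *\<^sub>R w) (at 0)"
    by (rule nrm_vector_derivative_along[OF x w])
  have dy: "(?y has_vector_derivative w) (at 0)" using great_circle_has_vector_derivative[of x w 0] by simp
  define p where "p = cos s - k * sin s"
  have dP: "((\<lambda>r. great_circle (?y r) (nrm (?y r)) s) has_vector_derivative p *\<^sub>R w) (at 0)"
  proof -
    have "((\<lambda>r. cos s *\<^sub>R ?y r + sin s *\<^sub>R nrm (?y r)) has_vector_derivative cos s *\<^sub>R w + sin s *\<^sub>R ((- k) *\<^sub>R w)) (at 0)"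
      by (intro has_vector_derivative_add bounded_linear.has_vector_derivative[OF bounded_linear_scaleR_right] dn dy)
    then show ?thesis unfolding great_circle_def[of _ _ s] p_def by (simp add: algebra_simps)
  qed
  have lhs: "((\<lambda>r. nrm (great_circle (?y r) (nrm (?y r)) s)) has_vector_derivative N (p *\<^sub>R w)) (at 0)"
    by (rule has_vector_derivative_compose_within[where S = UNIV and X = nrm, OF _ dP]) (use N(1) y in auto)
  have "((\<lambda>r. cos s *\<^sub>R nrm (?y r) - sin s *\<^sub>R ?y r) has_vector_derivative cos s *\<^sub>R ((- k) *\<^sub>R w) - sin s *\<^sub>R w) (at 0)"
    by (intro has_vector_derivative_diff bounded_linear.has_vector_derivative[OF bounded_linear_scaleR_right] dn dy)
  moreover have "cos s *\<^sub>R ((- k) *\<^sub>R w) - sin s *\<^sub>R w = (- sin s - k * cos s) *\<^sub>R w"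
    by (simp add: scaleR_left_diff_distrib mult.commute)
  ultimately have rhs: "((\<lambda>r. great_circle (nrm (?y r)) (- ?y r) s) has_vector_derivative (- sin s - k * cos s) *\<^sub>R w) (at 0)"
    unfolding great_circle_def[of _ _ s] by simp
  have ev1: "eventually (\<lambda>r. regular (?y r)) (nhds 0)" by (rule regular_nearby[OF x w(2) xw(1)])
  have "open ((\<lambda>r. V (F (?y r))) -` {- s<..<D - s})"
    using F_V_continuous_along(2)[OF R(2) w(2) xw(1)] by (intro open_vimage) auto
  then have "eventually (\<lambda>r. V (F (?y r)) \<in> {- s<..<D - s}) (nhds 0)"
    using eventually_nhds_in_open[of "(\<lambda>r. V (F (?y r))) -` {- s<..<D - s}" 0] s by simp
  with ev1 have "eventually (\<lambda>r. nrm (great_circle (?y r) (nrm (?y r)) s) = great_circle (nrm (?y r)) (- ?y r) s) (nhds 0)"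
    by eventually_elim (use flow(5) in auto)
  then obtain U where U: "open U" "0 \<in> U"
    "\<forall>r\<in>U. nrm (great_circle (?y r) (nrm (?y r)) s) = great_circle (nrm (?y r)) (- ?y r) s"
    unfolding eventually_nhds by blast
  have "((\<lambda>r. great_circle (nrm (?y r)) (- ?y r) s) has_vector_derivative N (p *\<^sub>R w)) (at 0)"
    by (rule has_vector_derivative_transform_within_open[OF lhs U(1,2)]) (use U(3) in auto)
  then have "N (p *\<^sub>R w) = (- sin s - k * cos s) *\<^sub>R w" using rhs vector_derivative_unique_at by blast
  moreover have "N (p *\<^sub>R w) = H y (p *\<^sub>R w) /\<^sub>R norm (G y)"
    by (rule N(2)[OF H_normal_space(1)[OF yr]]) (use wy subspace_normal_space subspace_scale in blast)
  moreover have "H y (p *\<^sub>R w) = p *\<^sub>R H y w" using linear_H[OF regularD(1)[OF yr]] by (rule linear_cmul)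
  ultimately have "p *\<^sub>R H y w /\<^sub>R norm (G y) = (- sin s - k * cos s) *\<^sub>R w" by simp
  then have "norm (G y) *\<^sub>R (p *\<^sub>R H y w /\<^sub>R norm (G y)) = norm (G y) *\<^sub>R ((- sin s - k * cos s) *\<^sub>R w)" by simp
  moreover have "norm (G y) *\<^sub>R (u /\<^sub>R norm (G y)) = u" for u :: 'a using regularD(7)[OF yr] by simp
  ultimately show "(cos s - k * sin s) *\<^sub>R H y w = (norm (G y) * (- sin s - k * cos s)) *\<^sub>R w"
    unfolding p_def by (metis scaleR_scaleR)
qed

lemma normal_space_flow:
  assumes x: "regular x" and s: "0 < V (F x) + s" "V (F x) + s < D"
  shows "normal_space (great_circle x (nrm x) s) = normal_space x"
proof -
  have ny: "nrm (great_circle x (nrm x) s) = great_circle (nrm x) (- x) s" using flow(5)[OF x s] .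
  have rot: "cos s * (cos s * p + sin s * q) - sin s * (cos s * q - sin s * p) = ((sin s)\<^sup>2 + (cos s)\<^sup>2) * p"
    "sin s * (cos s * p + sin s * q) + cos s * (cos s * q - sin s * p) = ((sin s)\<^sup>2 + (cos s)\<^sup>2) * q" for p q :: real
    by algebra+
  have e: "great_circle x (nrm x) s \<bullet> v = cos s * (x \<bullet> v) + sin s * (nrm x \<bullet> v)"
    "great_circle (nrm x) (- x) s \<bullet> v = cos s * (nrm x \<bullet> v) - sin s * (x \<bullet> v)" for v
    unfolding great_circle_def by (simp_all add: inner_add_left inner_diff_left)
  have "v \<in> normal_space (great_circle x (nrm x) s) \<longleftrightarrow> v \<in> normal_space x" for v
  proof
    assume "v \<in> normal_space (great_circle x (nrm x) s)"
    then have z: "cos s * (x \<bullet> v) + sin s * (nrm x \<bullet> v) = 0" "cos s * (nrm x \<bullet> v) - sin s * (x \<bullet> v) = 0"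
      unfolding normal_space_def ny mem_Collect_eq e by auto
    have "x \<bullet> v = 0" using rot(1)[of "x \<bullet> v" "nrm x \<bullet> v"] unfolding z sin_cos_squared_add by simp
    moreover have "nrm x \<bullet> v = 0"
      using rot(2)[of "x \<bullet> v" "nrm x \<bullet> v"] unfolding z sin_cos_squared_add by simp
    ultimately show "v \<in> normal_space x" unfolding normal_space_def by simp
  next
    assume "v \<in> normal_space x"
    then show "v \<in> normal_space (great_circle x (nrm x) s)"
      unfolding normal_space_def ny mem_Collect_eq e by simp
  qed
  then show ?thesis by blast
qed

text \<open>If \<open>cos s - \<kappa> sin s\<close> vanished then so would \<open>sin s + \<kappa> cos s\<close> by \<open>shape_operator_flow\<close>, although the
sum of their squares is \<open>1 + \<kappa>\<^sup>2\<close>. The second claim is the trace formula at the point reached.\<close>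

lemma mean_curvature:
  assumes x: "regular x" and Q: "principal_basis x Q \<kappa>"
    and s: "0 < V (F x) + s" "V (F x) + s < D"
  shows "\<And>w. w \<in> Q \<Longrightarrow> cos s - \<kappa> w * sin s \<noteq> 0"
    and "sqrt (A (profile (V (F x) + s))) * (\<Sum>w\<in>Q. (- sin s - \<kappa> w * cos s) / (cos s - \<kappa> w * sin s))
      = - B (profile (V (F x) + s)) - Ad (profile (V (F x) + s)) / 2"
proof -
  define y where "y = great_circle x (nrm x) s"
  have yr: "regular y" unfolding y_def by (rule flow(4)[OF x s])
  note Ry = regularD[OF yr]
  have Fy: "F y = profile (V (F x) + s)" unfolding y_def using s by (intro flow(3)[OF x]) auto
  have Qp: "norm w = 1" "H x w = (- norm (G x) * \<kappa> w) *\<^sub>R w" "w \<in> normal_space x" if "w \<in> Q" for w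
    using Q that principal_basis_subset[OF Q that] unfolding principal_basis_def by auto
  have sh: "(cos s - \<kappa> w * sin s) *\<^sub>R H y w = (norm (G y) * (- sin s - \<kappa> w * cos s)) *\<^sub>R w" if "w \<in> Q" for w
    using shape_operator_flow(1)[OF x Qp(3)[OF that] Qp(1)[OF that] Qp(2)[OF that] s y_def] .
  show nz: "cos s - \<kappa> w * sin s \<noteq> 0" if w: "w \<in> Q" for w
  proof
    assume z: "cos s - \<kappa> w * sin s = 0"
    have "w \<noteq> 0" using Qp(1)[OF w] by auto
    then have "- sin s - \<kappa> w * cos s = 0" using sh[OF w] Ry(7) unfolding z by auto
    then have "sin s * (cos s - \<kappa> w * sin s) - cos s * (- sin s - \<kappa> w * cos s) = 0 \<and> sin s = - \<kappa> w * cos s \<and> cos s = \<kappa> w * sin s"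
      using z by simp
    then have "(sin s)\<^sup>2 + (cos s)\<^sup>2 = \<kappa> w * (sin s * cos s) - \<kappa> w * (cos s * sin s)"
      by (metis (no_types, opaque_lifting) add.commute diff_conv_add_uminus mult.commute mult.left_commute mult_minus_left power2_eq_square)
    then show False using sin_cos_squared_add[of s] by (simp add: mult.commute)
  qed
  have wH: "w \<bullet> H y w = norm (G y) * ((- sin s - \<kappa> w * cos s) / (cos s - \<kappa> w * sin s))" if w: "w \<in> Q" for w
  proof -
    have "w \<bullet> w = 1" using Qp(1)[OF w] by (simp add: norm_eq_1)
    moreover have "(cos s - \<kappa> w * sin s) * (w \<bullet> H y w) = (norm (G y) * (- sin s - \<kappa> w * cos s)) * (w \<bullet> w)"
      using arg_cong[OF sh[OF w], of "\<lambda>u. w \<bullet> u"] by simp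
    ultimately show ?thesis using nz[OF w] by (simp add: field_simps)
  qed
  have "- B (F y) = (\<Sum>w\<in>Q. w \<bullet> H y w) + Ad (F y) / 2"
  proof (rule laplacian_trace[OF yr])
    show "span Q = normal_space y"
      using Q normal_space_flow[OF x s] unfolding principal_basis_def y_def by simp
  qed (use Q in \<open>auto simp: principal_basis_def\<close>)
  then show "sqrt (A (profile (V (F x) + s))) * (\<Sum>w\<in>Q. (- sin s - \<kappa> w * cos s) / (cos s - \<kappa> w * sin s))
      = - B (profile (V (F x) + s)) - Ad (profile (V (F x) + s)) / 2"
    using wH Ry(6) unfolding Fy by (simp add: sum_distrib_left)
qed

text \<open>Consider the map that moves each regular point along its normal circle to the focal set. If no
factor vanished, its derivative would be injective on the \<open>n - 1\<close> principal directions. A chart that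
flattens the focal set to \<open>L\<close> takes the image of this derivative into \<open>L\<close>, of dimension at most
\<open>n - 2\<close>.\<close>

lemma focal_point_exists:
  assumes x: "regular x" and Q: "principal_basis x Q \<kappa>"
    and e: "e \<in> {0..D}" and codim: "codim_ge_2 (level_set F (profile e))"
  shows "\<exists>w\<in>Q. cos (e - V (F x)) - \<kappa> w * sin (e - V (F x)) = 0"
proof (rule ccontr)
  define \<tau> where "\<tau> = e - V (F x)"
  assume "\<not> (\<exists>w\<in>Q. cos (e - V (F x)) - \<kappa> w * sin (e - V (F x)) = 0)"
  then have nz: "cos \<tau> - \<kappa> w * sin \<tau> \<noteq> 0" if "w \<in> Q" for w using that unfolding \<tau>_def by blast
  note R = regularD[OF x]
  define m where "m = great_circle x (nrm x) \<tau>"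
  define foot where "foot y = great_circle y (nrm y) (e - V (F y))" for y
  have foot: "foot y \<in> level_set F (profile e)" if "regular y" for y
    using flow(3)[OF that, of "e - V (F y)"] e great_circle_in_usphere(1)[OF regularD(2,8,9)[OF that]]
    unfolding foot_def level_set_def by simp
  have fm: "foot x = m" unfolding foot_def m_def \<tau>_def ..
  then have "m \<in> level_set F (profile e)" using foot[OF x] by simp
  then obtain d where d: "submanifold_at d (level_set F (profile e)) m" "d + 2 \<le> DIM('a) - 1"
    using codim unfolding codim_ge_2_def by blast
  from d(1) obtain U W L and \<phi> \<psi> :: "'a \<Rightarrow> 'a" where U: "m \<in> U" "smooth_open U \<phi>" "smooth_open W \<psi>" "homeomorphism U W \<phi> \<psi>"
    and L: "subspace L" "dim L = d" "\<phi> ` (level_set F (profile e) \<inter> U) = W \<inter> L"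
    unfolding submanifold_at_def by blast
  have oU: "open U" "open W" and C1: "Ck_open 1 U \<phi>" "Ck_open 1 W \<psi>" using U unfolding smooth_open_def by auto
  have mW: "\<phi> m \<in> W" using U(1,4) unfolding homeomorphism_def by blast
  obtain \<phi>' where \<phi>': "(\<phi> has_derivative \<phi>') (at m)"
    using C1(1) U(1) oU(1) by (auto simp: differentiable_on_eq_differentiable_at differentiable_def)
  obtain \<psi>' where \<psi>': "(\<psi> has_derivative \<psi>') (at (\<phi> m))"
    using C1(2) mW oU(2) by (auto simp: differentiable_on_eq_differentiable_at differentiable_def)
  have "((\<lambda>z. \<psi> (\<phi> z)) has_derivative (\<lambda>v. \<psi>' (\<phi>' v))) (at m)" by (rule has_derivative_compose[OF \<phi>' \<psi>'])
  moreover have "((\<lambda>z. \<psi> (\<phi> z)) has_derivative (\<lambda>v. v)) (at m)"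
    by (rule has_derivative_transform_within_open[OF has_derivative_ident oU(1) U(1)])
      (use U(4) in \<open>auto simp: homeomorphism_def\<close>)
  ultimately have inv: "\<psi>' (\<phi>' v) = v" for v using has_derivative_unique by metis
  have lin: "linear \<phi>'" using \<phi>' has_derivative_linear by blast
  have Qp: "norm w = 1" "H x w = (- norm (G x) * \<kappa> w) *\<^sub>R w" "w \<in> normal_space x" if "w \<in> Q" for w
    using Q that principal_basis_subset[OF Q that] unfolding principal_basis_def by auto
  have inL: "\<phi>' w \<in> L" if w: "w \<in> Q" for w
  proof -
    have xw: "x \<bullet> w = 0" "nrm x \<bullet> w = 0" using Qp(3)[OF w] unfolding normal_space_def by auto
    let ?y = "great_circle x w"
    have dn: "((\<lambda>r. nrm (?y r)) has_vector_derivative (- \<kappa> w) *\<^sub>R w) (at 0)"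
      by (rule nrm_vector_derivative_along[OF x Qp(3)[OF w] Qp(1)[OF w] Qp(2)[OF w]])
    have dy: "(?y has_vector_derivative w) (at 0)" using great_circle_has_vector_derivative[of x w 0] by simp
    \<comment> \<open>the time to the focal set, constant to first order because \<open>w\<close> is tangent to the level set\<close>
    define t where "t r = e - V (F (?y r))" for r
    have t0: "t 0 = \<tau>" unfolding t_def \<tau>_def by simp
    have "(V has_real_derivative 1 / sqrt (A (F (?y 0)))) (at (F (?y 0)))"
      using V_deriv[OF R(3,4)] by simp
    from DERIV_chain2[OF this F_along_great_circle(1)[OF R(2) Qp(1)[OF w] xw(1)]]
    have "((\<lambda>r. V (F (?y r))) has_real_derivative 0) (at 0)"
      using xw(2) R(10) by simp
    then have dt: "(t has_real_derivative 0) (at 0)" unfolding t_def by (auto intro!: derivative_eq_intros)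
    have "((\<lambda>r. cos (t r)) has_real_derivative 0) (at 0)" "((\<lambda>r. sin (t r)) has_real_derivative 0) (at 0)"
      using dt by (auto intro!: derivative_eq_intros)
    then have "((\<lambda>r. cos (t r) *\<^sub>R ?y r + sin (t r) *\<^sub>R nrm (?y r)) has_vector_derivative
        (cos (t 0) *\<^sub>R w + 0 *\<^sub>R ?y 0) + (sin (t 0) *\<^sub>R ((- \<kappa> w) *\<^sub>R w) + 0 *\<^sub>R nrm (?y 0))) (at 0)"
      by (intro has_vector_derivative_add has_vector_derivative_scaleR dn dy)
    moreover have "(cos (t 0) *\<^sub>R w + 0 *\<^sub>R ?y 0) + (sin (t 0) *\<^sub>R ((- \<kappa> w) *\<^sub>R w) + 0 *\<^sub>R nrm (?y 0))
        = (cos \<tau> - \<kappa> w * sin \<tau>) *\<^sub>R w"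
      unfolding t0 by (simp add: scaleR_left_diff_distrib mult.commute)
    ultimately have df: "((\<lambda>r. foot (?y r)) has_vector_derivative (cos \<tau> - \<kappa> w * sin \<tau>) *\<^sub>R w) (at 0)"
      unfolding foot_def great_circle_def[of "great_circle x w _"] t_def by simp
    have "((\<lambda>r. \<phi> (foot (?y r))) has_vector_derivative \<phi>' ((cos \<tau> - \<kappa> w * sin \<tau>) *\<^sub>R w)) (at 0)"
      by (rule has_vector_derivative_compose_within[where S = UNIV and X = \<phi>, OF _ df]) (use \<phi>' fm in auto)
    moreover have "eventually (\<lambda>r. \<phi> (foot (?y r)) \<in> L) (nhds 0)"
    proof -
      have "isCont (\<lambda>r. foot (?y r)) 0" using df has_vector_derivative_continuous by blast
      then have "filterlim (\<lambda>r. foot (?y r)) (nhds m) (nhds 0)"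
        using fm by (simp add: isCont_def tendsto_nhds_iff)
      then have "eventually (\<lambda>r. foot (?y r) \<in> U) (nhds 0)"
        using oU(1) U(1) by (rule topological_tendstoD)
      with regular_nearby[OF x Qp(1)[OF w] xw(1)] show ?thesis
        by eventually_elim (use foot L(3) in blast)
    qed
    then obtain \<epsilon> where "\<epsilon> > 0" "\<And>r. \<bar>r - 0\<bar> < \<epsilon> \<Longrightarrow> \<phi> (foot (?y r)) \<in> L"
      unfolding eventually_nhds_metric by (auto simp: dist_real_def)
    ultimately have "\<phi>' ((cos \<tau> - \<kappa> w * sin \<tau>) *\<^sub>R w) \<in> L"
      using vector_derivative_in_subspace[OF _ L(1)] by blast
    then have "(cos \<tau> - \<kappa> w * sin \<tau>) *\<^sub>R \<phi>' w \<in> L" using linear_cmul[OF lin] by simp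
    then have "inverse (cos \<tau> - \<kappa> w * sin \<tau>) *\<^sub>R ((cos \<tau> - \<kappa> w * sin \<tau>) *\<^sub>R \<phi>' w) \<in> L"
      using L(1) subspace_scale by blast
    then show ?thesis using nz[OF w] by simp
  qed
  have "inj_on \<phi>' (span Q)" by (rule inj_on_inverseI[of _ \<psi>']) (rule inv)
  then have "dim (\<phi>' ` Q) = dim Q" using lin by (rule dim_image_eq[rotated])
  moreover have "dim (\<phi>' ` Q) \<le> dim L" by (rule dim_subset) (use inL in auto)
  moreover have "dim Q = DIM('a) - 2"
    using Q dim_normal_space[OF x] dim_span[of Q] unfolding principal_basis_def by simp
  ultimately show False using d(2) L(2) dim3 by linarith
qed

end

section \<open>The mean curvature of the level sets\<close>

text \<open>The principal curvature \<open>k = cot \<theta>\<close> belongs to the angle \<open>\<theta> = \<pi>/2 - arctan k\<close>, which lies in \<open>(0, \<pi>)\<close>.\<close>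

lemma linear_trig_arctan:
  fixes k s :: real
  shows "cos s - k * sin s = - sqrt (1 + k\<^sup>2) * sin (s - (pi / 2 - arctan k))"
    "- sin s - k * cos s = - sqrt (1 + k\<^sup>2) * cos (s - (pi / 2 - arctan k))"
proof -
  have pos: "sqrt (1 + k\<^sup>2) > 0" by (simp add: add_pos_nonneg)
  have "s - (pi / 2 - arctan k) = (s + arctan k) - pi / 2" by simp
  then have "sin (s - (pi / 2 - arctan k)) = - cos (s + arctan k)" "cos (s - (pi / 2 - arctan k)) = sin (s + arctan k)"
    by (simp_all only: sin_diff cos_diff cos_pi_half sin_pi_half)
  then have "sin (s - (pi / 2 - arctan k)) = - ((cos s - k * sin s) / sqrt (1 + k\<^sup>2))"
    "cos (s - (pi / 2 - arctan k)) = (sin s + k * cos s) / sqrt (1 + k\<^sup>2)"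
    by (simp_all add: cos_add sin_add cos_arctan sin_arctan diff_divide_distrib add_divide_distrib mult.commute)
  then show "cos s - k * sin s = - sqrt (1 + k\<^sup>2) * sin (s - (pi / 2 - arctan k))"
    "- sin s - k * cos s = - sqrt (1 + k\<^sup>2) * cos (s - (pi / 2 - arctan k))"
    using pos by simp_all
qed

lemma sin_prod_deriv:
  fixes v :: real
  assumes "finite I"
  shows "(sin_prod I z has_real_derivative sin_prod' I z v) (at v)"
proof -
  have "((\<lambda>v. \<Prod>i\<in>I. sin (v - z i)) has_real_derivative (\<Sum>i\<in>I. cos (v - z i) * (\<Prod>j\<in>I - {i}. sin (v - z j)))) (at v)"
    by (rule has_field_derivative_prod) (auto intro!: derivative_eq_intros)
  then show ?thesis unfolding sin_prod_def[abs_def] sin_prod'_def by simp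
qed

locale proper_isoparametric_foliation = isoparametric_foliation +
  fixes g :: nat
  assumes codim: "codim_ge_2 (level_set F a)" "codim_ge_2 (level_set F b)"
    and num: "\<And>x. regular x \<Longrightarrow> card (principal_curvatures F x) = g"
begin

text \<open>By \<open>mean_curvature\<close> this is \<open>|\<nabla>F|\<close> times the negative of the sum of the principal curvatures. It is
a smooth function of the value of \<open>F\<close> up to the end points, which is what makes the even extension
in \<open>focal_reflection\<close> possible.\<close>

definition C :: "real \<Rightarrow> real" where "C t = - B t - Ad t / 2"

lemma Ck_on_C: "Ck_on k {a..b} C" and Ck_on_A: "Ck_on k {a..b} A" and Ck_on_Ad: "Ck_on k {a..b} Ad"
proof -
  show "Ck_on k {a..b} A" and Ad: "Ck_on k {a..b} Ad"
    using smooth_interval_imp_Ck_on[OF ab] smooth_A smooth_Ad by auto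
  have "Ck_on k {a..b} (\<lambda>t. - B t - Ad t * (1 / 2))"
    by (intro Ck_on_diff Ck_on_minus Ck_on_mult Ad Ck_on_const smooth_interval_imp_Ck_on[OF ab smooth_B])
  then show "Ck_on k {a..b} C" unfolding C_def[abs_def] by simp
qed

text \<open>In the distance \<open>v\<close> from the level \<open>a\<close>, a principal direction of curvature \<open>cot \<theta>\<close> at the base point
contributes \<open>cot (v - z)\<close>, where \<open>z\<close> is the sum of \<open>\<theta>\<close> and the distance of the base point. The
angles \<open>\<theta>\<close> lie in an interval of length \<open>\<pi>\<close>, so distinct curvatures remain distinct modulo \<open>\<pi>\<close>.\<close>

lemma mean_curvature_cotangents:
  obtains I :: "'a set" and z where "finite I" "card I = DIM('a) - 2" "card (z ` I) = g"
    "\<And>i j. i \<in> I \<Longrightarrow> j \<in> I \<Longrightarrow> sin (z i - z j) = 0 \<Longrightarrow> z i = z j"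
    "\<And>v i. v \<in> {0<..<D} \<Longrightarrow> i \<in> I \<Longrightarrow> sin (v - z i) \<noteq> 0"
    "\<And>v. v \<in> {0<..<D} \<Longrightarrow> profile_d v * (\<Sum>i\<in>I. cot (v - z i)) = C (profile v)"
    "zero_mult I z 0 > 0" "zero_mult I z D > 0"
proof -
  obtain Q \<kappa> where Q: "principal_basis base_point Q \<kappa>" using principal_basis_exists[OF regular_base] by blast
  define v0 where "v0 = V (F base_point)"
  define z where "z w = (pi / 2 - arctan (\<kappa> w)) + v0" for w
  have shift: "v - z w = (v - v0) - (pi / 2 - arctan (\<kappa> w))" for v w unfolding z_def by simp
  have Qf: "finite Q" "card Q = DIM('a) - 2" using Q unfolding principal_basis_def by auto
  have pos: "sqrt (1 + k\<^sup>2) > 0" for k :: real by (simp add: add_pos_nonneg)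
  have "inj_on (\<lambda>k. (pi / 2 - arctan k) + v0) (\<kappa> ` Q)" by (rule inj_onI) (simp add: arctan_eq_iff)
  then have "card ((\<lambda>k. (pi / 2 - arctan k) + v0) ` \<kappa> ` Q) = card (\<kappa> ` Q)" by (rule card_image)
  moreover have "(\<lambda>k. (pi / 2 - arctan k) + v0) ` \<kappa> ` Q = z ` Q" unfolding z_def by auto
  ultimately have card: "card (z ` Q) = g"
    using num[OF regular_base] principal_curvatures_eq[OF regular_base Q] by simp
  have inj: "z i = z j" if "sin (z i - z j) = 0" for i j
  proof -
    have "z i - z j = arctan (\<kappa> j) - arctan (\<kappa> i)" unfolding z_def by simp
    moreover have "- (pi / 2) < arctan (\<kappa> i)" "arctan (\<kappa> i) < pi / 2" "- (pi / 2) < arctan (\<kappa> j)" "arctan (\<kappa> j) < pi / 2"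
      by (rule arctan_lbound arctan_ubound)+
    ultimately have "- pi < z i - z j" "z i - z j < pi" by linarith+
    then show ?thesis using sin_eq_0_pi[of "z i - z j"] that by simp
  qed
  have nz: "sin (v - z w) \<noteq> 0" if "v \<in> {0<..<D}" "w \<in> Q" for v w
  proof -
    have "cos (v - v0) - \<kappa> w * sin (v - v0) \<noteq> 0"
      using mean_curvature(1)[OF regular_base Q _ _ that(2), of "v - v0"] that(1) unfolding v0_def by simp
    then show ?thesis unfolding shift linear_trig_arctan(1) by auto
  qed
  have trace: "profile_d v * (\<Sum>w\<in>Q. cot (v - z w)) = C (profile v)" if v: "v \<in> {0<..<D}" for v
  proof -
    have "(- sin (v - v0) - \<kappa> w * cos (v - v0)) / (cos (v - v0) - \<kappa> w * sin (v - v0)) = cot (v - z w)" for w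
      unfolding linear_trig_arctan shift cot_def using pos[of "\<kappa> w"] by simp
    then show ?thesis
      using mean_curvature(2)[OF regular_base Q, of "v - v0"] profile_inside(3)[of v] v
      unfolding v0_def[symmetric] C_def by simp
  qed
  have foc: "zero_mult Q z e > 0" if e: "e \<in> {0..D}" "codim_ge_2 (level_set F (profile e))" for e
  proof -
    obtain w where w: "w \<in> Q" "cos (e - v0) - \<kappa> w * sin (e - v0) = 0"
      using focal_point_exists[OF regular_base Q e] unfolding v0_def by blast
    then have "sin (e - z w) = 0" unfolding shift linear_trig_arctan(1) using pos[of "\<kappa> w"] by simp
    then have "w \<in> {i \<in> Q. sin (e - z i) = 0}" using w by simp
    then show ?thesis unfolding zero_mult_def card_gt_0_iff using Qf by auto
  qed
  show thesis
    by (rule that[OF Qf card inj nz trace foc foc]) (use D_pos codim profile_ends in auto)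
qed

text \<open>Apply \<open>focal_reflection\<close> at distance \<open>0\<close>, and at distance \<open>D\<close> to the reversed profile.\<close>

lemma mean_curvature_formula:
  obtains \<alpha> and I :: "'a set" and z where "g > 0" "real g * D = pi" "\<bar>\<alpha>\<bar> < real (DIM('a) - 2)" "finite I"
    "\<And>v i. v \<in> {0<..<D} \<Longrightarrow> i \<in> I \<Longrightarrow> sin (v - z i) \<noteq> 0"
    "\<And>v. v \<in> {0<..<D} \<Longrightarrow> profile_d v * (\<Sum>i\<in>I. cot (v - z i)) = C (profile v)"
    "\<And>v. v \<in> {0<..<D} \<Longrightarrow>
       (\<Sum>i\<in>I. cot (v - z i)) * sin (real g * v) = \<alpha> + real (DIM('a) - 2) * cos (real g * v)"
    "sin_prod I z (0::real) = 0" "sin_prod I z D = 0"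
proof -
  obtain I :: "'a set" and z where I: "finite I" "card I = DIM('a) - 2" "card (z ` I) = g"
    and inj: "\<And>i j. i \<in> I \<Longrightarrow> j \<in> I \<Longrightarrow> sin (z i - z j) = 0 \<Longrightarrow> z i = z j"
    and nz: "\<And>v i. v \<in> {0<..<D} \<Longrightarrow> i \<in> I \<Longrightarrow> sin (v - z i) \<noteq> 0"
    and trace: "\<And>v. v \<in> {0<..<D} \<Longrightarrow> profile_d v * (\<Sum>i\<in>I. cot (v - z i)) = C (profile v)"
    and foc: "zero_mult I z 0 > 0" "zero_mult I z D > 0"
    by (rule mean_curvature_cotangents) (rule that)
  have Ck_half: "Ck_on k {a..b} (\<lambda>t. Ad t / 2)" for k
    using Ck_on_mult[OF Ck_on_Ad Ck_on_const, of k "1 / 2"] by simp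
  have refl0: "zero_mult I z (- \<zeta>) = zero_mult I z \<zeta>" for \<zeta>
  proof (rule focal_reflection[where f = profile and fd = profile_d and fdd = profile_dd and d = D and a = a and b = b
        and g = "\<lambda>t. Ad t / 2" and C = C])
    show "profile_dd s = Ad (profile s) / 2" if "s \<in> {0..<D}" for s using profile_dd_eq that by simp
    show "profile_dd 0 \<noteq> 0" using profile_dd_eq[of 0] profile_ends Ad_ends D_pos by simp
  qed (use profile_deriv D_pos profile_range Ck_half Ck_on_C profile_ends I nz trace in auto)
  have neg_trace: "(\<Sum>i\<in>I. cot (s - (D - z i))) = - (\<Sum>i\<in>I. cot ((D - s) - z i))" for s
  proof -
    have "cot (s - (D - z i)) = - cot ((D - s) - z i)" for i
      using cot_minus[of "(D - s) - z i"] by (simp add: algebra_simps)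
    then show ?thesis by (simp add: sum_negf)
  qed
  have "zero_mult I (\<lambda>i. D - z i) (- \<zeta>) = zero_mult I (\<lambda>i. D - z i) \<zeta>" for \<zeta>
  proof (rule focal_reflection[where f = "\<lambda>s. profile (D - s)" and fd = "\<lambda>s. - profile_d (D - s)" and fdd = "\<lambda>s. profile_dd (D - s)"
        and d = D and a = a and b = b and g = "\<lambda>t. Ad t / 2" and C = C])
    have d: "((\<lambda>s. D - s) has_real_derivative - 1) (at s)" for s by (auto intro!: derivative_eq_intros)
    show "((\<lambda>s. profile (D - s)) has_real_derivative - profile_d (D - s)) (at s)" for s
      using DERIV_chain2[OF profile_deriv(1) d] by simp
    show "((\<lambda>s. - profile_d (D - s)) has_real_derivative profile_dd (D - s)) (at s)" for s
      using DERIV_minus[OF DERIV_chain2[OF profile_deriv(2) d]] by simp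
    show "profile_dd (D - s) = Ad (profile (D - s)) / 2" if "s \<in> {0..<D}" for s using profile_dd_eq that by simp
    show "profile_dd (D - 0) \<noteq> 0" using profile_dd_eq[of D] profile_ends Ad_ends D_pos by simp
    show "sin (s - (D - z i)) \<noteq> 0" if "s \<in> {0<..<D}" "i \<in> I" for s i
      using nz[of "D - s" i] that sin_minus[of "(D - s) - z i"] by (auto simp: algebra_simps)
    show "- profile_d (D - s) * (\<Sum>i\<in>I. cot (s - (D - z i))) = C (profile (D - s))" if "s \<in> {0<..<D}" for s
      unfolding neg_trace using trace[of "D - s"] that by simp
  qed (use D_pos profile_range Ck_half Ck_on_C profile_ends I in auto)
  moreover have "zero_mult I (\<lambda>i. D - z i) \<zeta> = zero_mult I z (D - \<zeta>)" for \<zeta>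
  proof -
    have "(sin (\<zeta> - (D - z i)) = 0) = (sin ((D - \<zeta>) - z i) = 0)" for i
      using sin_minus[of "(D - \<zeta>) - z i"] by (simp add: algebra_simps)
    then show ?thesis unfolding zero_mult_def by simp
  qed
  ultimately have reflD: "zero_mult I z (D + \<zeta>) = zero_mult I z (D - \<zeta>)" for \<zeta> by (metis diff_minus_eq_add)
  have inside: "zero_mult I z \<zeta> = 0" if "0 < \<zeta>" "\<zeta> < D" for \<zeta>
  proof -
    have "{i \<in> I. sin (\<zeta> - z i) = 0} = {}" using nz[of \<zeta>] that by auto
    then show ?thesis unfolding zero_mult_def by (metis card.empty)
  qed
  obtain \<alpha> where al: "card (z ` I) > 0" "real (card (z ` I)) * D = pi" "\<bar>\<alpha>\<bar> < real (card I)"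
    "\<And>v. sin (real (card (z ` I)) * v) \<noteq> 0 \<Longrightarrow>
      (\<Sum>i\<in>I. cot (v - z i)) * sin (real (card (z ` I)) * v) = \<alpha> + real (card I) * cos (real (card (z ` I)) * v)"
    by (rule focal_structure[OF I(1) D_pos refl0 reflD inside foc inj]) (assumption | rule that)+
  have "(\<Sum>i\<in>I. cot (v - z i)) * sin (real g * v) = \<alpha> + real (DIM('a) - 2) * cos (real g * v)" if v: "v \<in> {0<..<D}" for v
  proof -
    have "0 < real g * v" "real g * v < real g * D" using al(1) v unfolding I(3) by auto
    then have "sin (real g * v) > 0" using al(2) unfolding I(3) by (intro sin_gt_zero) auto
    then show ?thesis using al(4)[of v] unfolding I(2,3) by simp
  qed
  moreover have "sin_prod I z \<zeta> = 0" if "zero_mult I z \<zeta> > 0" for \<zeta> :: real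
    using that I(1) unfolding zero_mult_def card_gt_0_iff sin_prod_def by auto
  ultimately show thesis
    using that[of \<alpha> I z] al(1-3) I nz trace foc by simp
qed

end

section \<open>The Jacobi operator and the cosine of the distance\<close>

text \<open>The operator of Jacobi polynomials: for \<open>w = cos (p v)\<close> and \<open>sin (p v) h v = \<alpha> + \<beta> cos (p v)\<close>, the
function \<open>poly q w\<close> of \<open>v\<close> is taken by \<open>\<psi>'' + h \<psi>'\<close> to \<open>poly (jacobi_op p \<alpha> \<beta> q) w\<close>.\<close>

definition jacobi_op :: "real \<Rightarrow> real \<Rightarrow> real \<Rightarrow> real poly \<Rightarrow> real poly" where
  "jacobi_op p \<alpha> \<beta> q = [:p\<^sup>2, 0, - (p\<^sup>2):] * pderiv (pderiv q) - [:p * \<alpha>, p\<^sup>2 + p * \<beta>:] * pderiv q"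

lemma coeff_jacobi_op:
  "coeff (jacobi_op p \<alpha> \<beta> q) i = p\<^sup>2 * (real i + 2) * (real i + 1) * coeff q (i + 2)
     - p * \<alpha> * (real i + 1) * coeff q (i + 1) - p * real i * (p * real i + \<beta>) * coeff q i"
proof -
  have lin: "coeff ([:x, y:] * r) i = x * coeff r i + (if i = 0 then 0 else y * coeff r (i - 1))" for x y and r :: "real poly"
    by (cases i) (simp_all add: mult_pCons_left)
  have quad: "coeff ([:x, 0, y:] * r) i = x * coeff r i + (if i < 2 then 0 else y * coeff r (i - 2))" for x y and r :: "real poly"
    by (cases i; cases "i - 1") (simp_all add: mult_pCons_left numeral_2_eq_2)
  show ?thesis
  proof (cases i)
    case 0
    then show ?thesis unfolding jacobi_op_def coeff_diff lin quad by (simp add: coeff_pderiv numeral_2_eq_2 algebra_simps)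
  next
    case (Suc j)
    then show ?thesis unfolding jacobi_op_def coeff_diff lin quad
      by (cases j) (simp_all add: coeff_pderiv numeral_2_eq_2 algebra_simps power2_eq_square)
  qed
qed

lemma jacobi_op_add: "jacobi_op p \<alpha> \<beta> (q + r) = jacobi_op p \<alpha> \<beta> q + jacobi_op p \<alpha> \<beta> r"
  by (simp add: poly_eq_iff coeff_jacobi_op algebra_simps)

text \<open>The operator is triangular in the monomials with diagonal entries \<open>- p j (p j + \<beta>)\<close>, so the
equation is solved by eliminating the leading coefficient.\<close>

lemma jacobi_op_solvable:
  assumes "\<And>j. j < m \<Longrightarrow> \<mu> \<noteq> p * real j * (p * real j + \<beta>)" "\<And>i. i \<ge> m \<Longrightarrow> coeff R i = 0"
  shows "\<exists>Q. (\<forall>i\<ge>m. coeff Q i = 0) \<and> jacobi_op p \<alpha> \<beta> Q + smult \<mu> Q = R"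
  using assms
proof (induction m arbitrary: R)
  case 0
  then have "R = 0" by (simp add: poly_eq_iff)
  then show ?case by (intro exI[of _ 0]) (simp add: jacobi_op_def)
next
  case (Suc m)
  define c where "c = coeff R m / (\<mu> - p * real m * (p * real m + \<beta>))"
  define R' where "R' = R - (jacobi_op p \<alpha> \<beta> (monom c m) + smult \<mu> (monom c m))"
  have ne: "\<mu> - p * real m * (p * real m + \<beta>) \<noteq> 0" using Suc.prems(1)[of m] by simp
  have "coeff R' i = 0" if "i \<ge> m" for i
  proof (cases "i = m")
    case True
    have "c * (\<mu> - p * real m * (p * real m + \<beta>)) = coeff R m" unfolding c_def using ne by simp
    then show ?thesis unfolding R'_def True by (simp add: coeff_jacobi_op algebra_simps)
  next
    case False
    then show ?thesis using that Suc.prems(2)[of i] unfolding R'_def by (simp add: coeff_jacobi_op)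
  qed
  then obtain Q where Q: "\<forall>i\<ge>m. coeff Q i = 0" "jacobi_op p \<alpha> \<beta> Q + smult \<mu> Q = R'"
    using Suc.IH[of R'] Suc.prems(1) by auto
  have "jacobi_op p \<alpha> \<beta> (Q + monom c m) + smult \<mu> (Q + monom c m) = R"
    using Q(2) unfolding R'_def jacobi_op_add smult_add_right by (simp add: algebra_simps)
  moreover have "\<forall>i\<ge>Suc m. coeff (Q + monom c m) i = 0" using Q(1) by simp
  ultimately show ?case by blast
qed

text \<open>The diagonal entries increase in absolute value with \<open>k\<close>. Hence the lower-order terms that the
operator produces from the monomial of degree \<open>k\<close> can be compensated.\<close>

lemma jacobi_eigenpolynomial:
  assumes p: "p > 0" and \<beta>: "\<beta> \<ge> 0"
  shows "\<exists>q. q \<noteq> 0 \<and> jacobi_op p \<alpha> \<beta> q = smult (- (p * real k * (p * real k + \<beta>))) q"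
proof -
  define \<mu> where "\<mu> = p * real k * (p * real k + \<beta>)"
  define R where "R = jacobi_op p \<alpha> \<beta> (monom 1 k) + smult \<mu> (monom 1 k)"
  have "coeff R i = 0" if "i \<ge> k" for i
    using that unfolding R_def \<mu>_def by (cases "i = k") (simp_all add: coeff_jacobi_op)
  moreover have "\<mu> \<noteq> p * real j * (p * real j + \<beta>)" if "j < k" for j
  proof -
    have "p * real j < p * real k" using p that by simp
    from mult_strict_mono'[OF this, of "p * real j + \<beta>" "p * real k + \<beta>"]
    have "p * real j * (p * real j + \<beta>) < \<mu>" unfolding \<mu>_def using that p \<beta> by simp
    then show ?thesis by simp
  qed
  ultimately obtain Q where Q: "\<forall>i\<ge>k. coeff Q i = 0" "jacobi_op p \<alpha> \<beta> Q + smult \<mu> Q = R"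
    using jacobi_op_solvable[of k \<mu> p \<beta> R \<alpha>] by blast
  define q where "q = monom 1 k - Q"
  have "monom 1 k = q + Q" unfolding q_def by simp
  then have "jacobi_op p \<alpha> \<beta> q + smult \<mu> q = 0"
    using Q(2) unfolding R_def by (simp add: jacobi_op_add smult_add_right)
  then have "jacobi_op p \<alpha> \<beta> q = smult (- \<mu>) q" by (simp add: eq_neg_iff_add_eq_0)
  moreover have "coeff q k = 1" unfolding q_def using Q(1) by simp
  then have "q \<noteq> 0" by auto
  ultimately show ?thesis unfolding \<mu>_def by blast
qed

lemma derivative_extends_to_closed_interval:
  fixes f :: "real \<Rightarrow> real"
  assumes ab: "a < b" and f: "continuous_on {a..b} f" and fd: "continuous_on {a..b} fd"
    and deriv: "\<And>t. a < t \<Longrightarrow> t < b \<Longrightarrow> (f has_real_derivative fd t) (at t)" and t: "t \<in> {a..b}"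
  shows "(f has_real_derivative fd t) (at t within {a..b})"
proof -
  have eq: "integral {a..x} fd = f x - f a" if x: "x \<in> {a..b}" for x
  proof (rule integral_unique, rule fundamental_theorem_of_calculus_interior)
    show "continuous_on {a..x} f" using f x by (auto intro: continuous_on_subset)
    show "(f has_vector_derivative fd u) (at u)" if "u \<in> {a<..<x}" for u
      using deriv[of u] that x by (simp add: has_real_derivative_iff_has_vector_derivative)
  qed (use x in auto)
  have "((\<lambda>x. integral {a..x} fd) has_real_derivative fd t) (at t within {a..b})"
    by (rule integral_has_real_derivative[OF fd t])
  then have "((\<lambda>x. integral {a..x} fd + f a) has_real_derivative fd t) (at t within {a..b})"
    by (auto intro!: derivative_eq_intros)
  then show ?thesis
    by (rule has_field_derivative_transform_within[where d = 1]) (use eq t in auto)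
qed

text \<open>The derivative within the interval is unique also at its end points, where this is applied.\<close>

lemma derivative_zero_of_vanishing:
  fixes h :: "real \<Rightarrow> real"
  assumes "l < r" "s \<in> {l..r}" "(h has_real_derivative d) (at s)" "\<And>u. u \<in> {l..r} \<Longrightarrow> h u = 0"
  shows "d = 0"
proof -
  have "(h has_real_derivative d) (at s within {l..r})" using assms(3) by (rule has_field_derivative_at_within)
  moreover have "(h has_real_derivative 0) (at s within {l..r})"
    by (rule has_field_derivative_transform_within[where f = "\<lambda>_. 0" and d = 1]) (use assms(2,4) in auto)
  ultimately show ?thesis
    using vector_derivative_unique_within_closed_interval[OF assms(1)] assms(2)
    by (metis cbox_interval has_real_derivative_iff_has_vector_derivative)
qed

context proper_isoparametric_foliation
begin

definition cosV :: "real \<Rightarrow> real" where "cosV t = cos (real g * V t)"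

text \<open>The function \<open>cosV\<close> is smooth on \<open>(a, b)\<close>, but \<open>V\<close> behaves like a square root at the end points. With
\<open>Y = A cosV'\<close> one has \<open>Y' = - g\<^sup>2 cosV + A' cosV' / 2\<close>, and the mean curvature formula reads
\<open>C cosV' = - g (\<alpha> + (n - 1) cosV)\<close>. The combination \<open>(A + C\<^sup>2) cosV' = Y + C (C cosV')\<close> makes this a
linear system with smooth coefficients for \<open>(cosV, Y)\<close>, because \<open>A + C\<^sup>2\<close> is positive also at the
end points. The system then yields derivatives of all orders up to the end points.\<close>

lemma cosV_structure:
  obtains \<alpha> cd cdd and I :: "'a set" and z where
    "g > 0" "real g * D = pi" "finite I"
    "C b < 0"
    "\<And>k. Ck_on k {a..b} cosV"
    "\<And>t. t \<in> {a..b} \<Longrightarrow> (cosV has_real_derivative cd t) (at t within {a..b})"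
    "\<And>t. t \<in> {a..b} \<Longrightarrow> (cd has_real_derivative cdd t) (at t within {a..b})"
    "\<And>t. t \<in> {a..b} \<Longrightarrow> A t * (cd t)\<^sup>2 = (real g)\<^sup>2 * (1 - (cosV t)\<^sup>2)"
    "\<And>t. t \<in> {a..b} \<Longrightarrow> A t * cdd t - B t * cd t
        = - (real g * \<alpha> + ((real g)\<^sup>2 + real g * real (DIM('a) - 2)) * cosV t)"
    "\<And>v i. v \<in> {0<..<D} \<Longrightarrow> i \<in> I \<Longrightarrow> sin (v - z i) \<noteq> 0"
    "\<And>v. v \<in> {0<..<D} \<Longrightarrow> profile_d v * (\<Sum>i\<in>I. cot (v - z i)) = C (profile v)"
    "\<And>v. v \<in> {0<..<D} \<Longrightarrow>
       (\<Sum>i\<in>I. cot (v - z i)) * sin (real g * v) = \<alpha> + real (DIM('a) - 2) * cos (real g * v)"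
    "sin_prod I z (0::real) = 0" "sin_prod I z D = 0"
proof -
  obtain \<alpha> and I :: "'a set" and z where raw: "g > 0" "real g * D = pi" "\<bar>\<alpha>\<bar> < real (DIM('a) - 2)" "finite I"
    and nz: "\<And>v i. v \<in> {0<..<D} \<Longrightarrow> i \<in> I \<Longrightarrow> sin (v - z i) \<noteq> 0"
    and trace: "\<And>v. v \<in> {0<..<D} \<Longrightarrow> profile_d v * (\<Sum>i\<in>I. cot (v - z i)) = C (profile v)"
    and raw_cots: "\<And>v. v \<in> {0<..<D} \<Longrightarrow> (\<Sum>i\<in>I. cot (v - z i)) * sin (real g * v)
       = \<alpha> + real (DIM('a) - 2) * cos (real g * v)"
    and w0: "sin_prod I z (0::real) = 0" "sin_prod I z D = 0"
    by (rule mean_curvature_formula) (rule that)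
  define \<beta> where "\<beta> = real (DIM('a) - 2)"
  define p where "p = real g"
  note g = raw[folded p_def \<beta>_def] and cots = raw_cots[folded p_def \<beta>_def]
  have p: "p > 0" unfolding p_def using raw(1) by simp
  have sinpos: "sin (p * v) > 0" if "v \<in> {0<..<D}" for v
  proof (rule sin_gt_zero)
    show "0 < p * v" using p that by simp
    have "p * v < p * D" using p that by simp
    then show "p * v < pi" using g(2) by simp
  qed
  have Vin: "V t \<in> {0<..<D}" if "a < t" "t < b" for t using V_inside that by auto
  have sinC: "sin (p * v) * C (profile v) = profile_d v * (\<alpha> + \<beta> * cos (p * v))" if v: "v \<in> {0..D}" for v
  proof (cases "v = 0 \<or> v = D")
    case True
    then show ?thesis using g(2) profile_ends by auto
  next
    case False
    then have "v \<in> {0<..<D}" using v by auto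
    then show ?thesis using trace[of v] cots[of v] by (metis mult.assoc mult.commute)
  qed
  obtain Cd where Cd: "\<And>t. t \<in> {a..b} \<Longrightarrow> (C has_real_derivative Cd t) (at t within {a..b})"
  proof -
    obtain C' where "\<forall>x\<in>{a..b}. (C has_derivative C' x) (at x within {a..b})"
      using Ck_on_C[of "Suc 0"] by auto
    then have "\<forall>x\<in>{a..b}. \<exists>d. (C has_real_derivative d) (at x within {a..b})"
      using differentiableI real_differentiableE by (metis real_differentiable_def)
    then show thesis using that by metis
  qed
  \<comment> \<open>\<open>\<Phi>\<close> vanishes on \<open>[0, D]\<close>, and its derivatives at the two ends give \<open>C a\<close> and \<open>C b\<close>\<close>
  define \<Phi> where "\<Phi> v = sin (p * v) * C (profile v) - profile_d v * (\<alpha> + \<beta> * cos (p * v))" for v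
  have D\<Phi>: "(\<Phi> has_real_derivative (p * cos (p * v) * C (profile v) + Cd (profile v) * profile_d v * sin (p * v))
      - (profile_dd v * (\<alpha> + \<beta> * cos (p * v)) - \<beta> * p * sin (p * v) * profile_d v)) (at v)" for v
  proof -
    have dC: "((\<lambda>v. C (profile v)) has_real_derivative Cd (profile v) * profile_d v) (at v)"
      by (rule interval_chain[OF Cd profile_deriv(1)]) (rule profile_range)+
    show ?thesis unfolding \<Phi>_def
      by (auto intro!: derivative_eq_intros dC profile_deriv(2) simp: algebra_simps)
  qed
  have C_ends: "p * C a = Ad a / 2 * (\<alpha> + \<beta>)" "p * C b = - (Ad b / 2 * (\<alpha> - \<beta>))"
  proof -
    have z: "\<Phi> u = 0" if "u \<in> {0..D}" for u using sinC[OF that] unfolding \<Phi>_def by simp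
    show "p * C a = Ad a / 2 * (\<alpha> + \<beta>)"
      using derivative_zero_of_vanishing[OF D_pos _ D\<Phi> z, of 0] D_pos profile_ends profile_dd_eq[of 0] by simp
    show "p * C b = - (Ad b / 2 * (\<alpha> - \<beta>))"
      using derivative_zero_of_vanishing[OF D_pos _ D\<Phi> z, of D] D_pos profile_ends profile_dd_eq[of D] g(2) by simp
  qed
  have Ca: "C a > 0"
  proof -
    have "Ad a / 2 * (\<alpha> + \<beta>) > 0" using Ad_ends g(3) by (intro mult_pos_pos) auto
    then show ?thesis using C_ends(1) p by (metis zero_less_mult_pos)
  qed
  have Cb: "C b < 0"
  proof -
    have "Ad b / 2 * (\<alpha> - \<beta>) > 0" using Ad_ends g(3) by (intro mult_neg_neg) auto
    then have "p * C b < 0" using C_ends(2) by simp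
    then show ?thesis using p by (simp add: mult_less_0_iff)
  qed
  \<comment> \<open>\<open>Y = A \<cdot> cosV'\<close>, and the linear system satisfied by \<open>cosV\<close> and \<open>Y\<close>\<close>
  define Y where "Y t = - p * sin (p * V t) * sqrt (A t)" for t
  define cd where "cd t = (Y t - p * C t * (\<alpha> + \<beta> * cosV t)) / (A t + (C t)\<^sup>2)" for t
  define Yd where "Yd t = - (p\<^sup>2) * cosV t + Ad t / 2 * cd t" for t
  have den: "A t + (C t)\<^sup>2 > 0" if t: "t \<in> {a..b}" for t
  proof (cases "t = a \<or> t = b")
    case True
    then show ?thesis using Ca Cb A_ends by auto
  next
    case False
    then show ?thesis using A_pos[of t] t by (simp add: add_pos_nonneg)
  qed
  have sqA: "(sqrt (A t))\<^sup>2 = A t" if "t \<in> {a..b}" for t using A_nonneg[OF that] by simp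
  have inner: "Y t = A t * (- p * sin (p * V t) / sqrt (A t))"
    "C t * (- p * sin (p * V t) / sqrt (A t)) = - p * (\<alpha> + \<beta> * cosV t)"
    "cd t = - p * sin (p * V t) / sqrt (A t)" if t: "a < t" "t < b" for t
  proof -
    have A: "A t > 0" using A_pos t by blast
    show y: "Y t = A t * (- p * sin (p * V t) / sqrt (A t))"
      unfolding Y_def using A by (simp add: field_simps)
    have "profile (V t) = t" "profile_d (V t) = sqrt (A t)"
      using profile_V[of t] profile_inside(3)[of "V t"] Vin[OF t] t by auto
    then have s: "sin (p * V t) * C t = sqrt (A t) * (\<alpha> + \<beta> * cosV t)"
      using sinC[of "V t"] Vin[OF t] unfolding cosV_def p_def by simp
    show c: "C t * (- p * sin (p * V t) / sqrt (A t)) = - p * (\<alpha> + \<beta> * cosV t)"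
    proof -
      have "C t * (- p * sin (p * V t) / sqrt (A t)) = - p * (sin (p * V t) * C t) / sqrt (A t)" by simp
      then show ?thesis unfolding s using A by simp
    qed
    have "Y t - p * C t * (\<alpha> + \<beta> * cosV t) = (A t + (C t)\<^sup>2) * (- p * sin (p * V t) / sqrt (A t))"
    proof -
      have "y' - p * c' * X = (A' + c'\<^sup>2) * u" if "y' = A' * u" "c' * u = - p * X" for y' A' u c' X :: real
        using that by algebra
      then show ?thesis using y c by blast
    qed
    then show "cd t = - p * sin (p * V t) / sqrt (A t)" unfolding cd_def using den[of t] t by simp
  qed
  have contA: "continuous_on {a..b} A" and contC: "continuous_on {a..b} C" and contAd: "continuous_on {a..b} Ad"
    using Ck_on_A[of 0] Ck_on_C[of 0] Ck_on_Ad[of 0] by auto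
  have contc: "continuous_on {a..b} cosV" unfolding cosV_def[abs_def] by (intro continuous_intros continuous_V)
  have contY: "continuous_on {a..b} Y" unfolding Y_def[abs_def] by (intro continuous_intros continuous_V contA)
  have contcd: "continuous_on {a..b} cd"
    unfolding cd_def[abs_def] using den by (intro continuous_intros contY contC contc contA) (metis less_irrefl)
  have contYd: "continuous_on {a..b} Yd"
    unfolding Yd_def[abs_def] by (intro continuous_intros contc contAd contcd) auto
  have Dc: "(cosV has_real_derivative cd t) (at t within {a..b})" if "t \<in> {a..b}" for t
  proof (rule derivative_extends_to_closed_interval[OF ab contc contcd _ that])
    fix t assume t: "a < t" "t < b"
    show "(cosV has_real_derivative cd t) (at t)"
      unfolding inner(3)[OF t] cosV_def[abs_def] p_def[symmetric]
      by (auto intro!: derivative_eq_intros V_deriv[OF t])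
  qed
  have DY: "(Y has_real_derivative Yd t) (at t within {a..b})" if "t \<in> {a..b}" for t
  proof (rule derivative_extends_to_closed_interval[OF ab contY contYd _ that])
    fix t assume t: "a < t" "t < b"
    have A: "A t > 0" using A_pos t by blast
    have dA: "(A has_real_derivative Ad t) (at t)" using A_deriv[of t] t at_within_Icc_at[OF t] by auto
    have "((\<lambda>t. sqrt (A t)) has_real_derivative inverse (sqrt (A t)) / 2 * Ad t) (at t)"
      by (rule DERIV_chain2[OF DERIV_real_sqrt[OF A] dA])
    moreover have "((\<lambda>t. - p * sin (p * V t)) has_real_derivative - p * (cos (p * V t) * (p * (1 / sqrt (A t))))) (at t)"
      by (auto intro!: derivative_eq_intros V_deriv[OF t])
    ultimately have "(Y has_real_derivative - p * (cos (p * V t) * (p * (1 / sqrt (A t)))) * sqrt (A t)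
        + inverse (sqrt (A t)) / 2 * Ad t * (- p * sin (p * V t))) (at t)"
      unfolding Y_def[abs_def] by (rule DERIV_mult[rotated])
    moreover have "- p * (cos (p * V t) * (p * (1 / sqrt (A t)))) * sqrt (A t)
        + inverse (sqrt (A t)) / 2 * Ad t * (- p * sin (p * V t)) = Yd t"
      unfolding Yd_def inner(3)[OF t] cosV_def p_def[symmetric] using A
      by (simp add: field_simps power2_eq_square)
    ultimately show "(Y has_real_derivative Yd t) (at t)" by simp
  qed
  have smooth_both: "Ck_on k {a..b} cosV \<and> Ck_on k {a..b} Y" for k
  proof (induction k)
    case 0
    show ?case using contc contY by simp
  next
    case (Suc k)
    have cdk: "Ck_on k {a..b} cd"
      unfolding cd_def[abs_def] power2_eq_square
      by (intro Ck_on_divide Ck_on_diff Ck_on_add Ck_on_mult Ck_on_const Ck_on_A Ck_on_C conjunct1[OF Suc] conjunct2[OF Suc])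
        (use den in \<open>metis less_irrefl power2_eq_square\<close>)
    moreover have "Ck_on k {a..b} (\<lambda>t. - (p\<^sup>2) * cosV t + Ad t * (1 / 2) * cd t)"
      by (intro Ck_on_add Ck_on_mult Ck_on_const Ck_on_Ad conjunct1[OF Suc] cdk)
    then have "Ck_on k {a..b} Yd" unfolding Yd_def[abs_def] by simp
    ultimately show ?case using Ck_on_real_Suc[OF Dc] Ck_on_real_Suc[OF DY] by blast
  qed
  have cdk: "Ck_on k {a..b} cd" for k
    unfolding cd_def[abs_def] power2_eq_square
    by (intro Ck_on_divide Ck_on_diff Ck_on_add Ck_on_mult Ck_on_const Ck_on_A Ck_on_C
        conjunct1[OF smooth_both] conjunct2[OF smooth_both])
      (use den in \<open>metis less_irrefl power2_eq_square\<close>)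
  obtain cdd where cdd: "\<And>t. t \<in> {a..b} \<Longrightarrow> (cd has_real_derivative cdd t) (at t within {a..b})"
  proof -
    obtain c' where "\<forall>x\<in>{a..b}. (cd has_derivative c' x) (at x within {a..b})"
      using cdk[of "Suc 0"] by auto
    then have "\<forall>x\<in>{a..b}. \<exists>d. (cd has_real_derivative d) (at x within {a..b})"
      using differentiableI real_differentiableE by (metis real_differentiable_def)
    then show thesis using that by metis
  qed
  have ends: "cosV a = 1" "cosV b = - 1"
    unfolding cosV_def V_ends using g(2) unfolding p_def by simp_all
  have sq: "A t * (cd t)\<^sup>2 = p\<^sup>2 * (1 - (cosV t)\<^sup>2)" if t: "t \<in> {a..b}" for t
  proof (cases "t = a \<or> t = b")
    case True
    then show ?thesis using ends A_ends by auto
  next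
    case False
    then have t': "a < t" "t < b" using t by auto
    then have A: "A t > 0" using A_pos by blast
    have "1 - (cosV t)\<^sup>2 = (sin (p * V t))\<^sup>2" unfolding cosV_def p_def by (simp add: sin_squared_eq)
    then show ?thesis unfolding inner(3)[OF t'] using A sqA[OF t] by (simp add: power_divide power_mult_distrib)
  qed
  have AY: "A t * cd t = Y t" and Ccd: "C t * cd t = - p * (\<alpha> + \<beta> * cosV t)" if t: "t \<in> {a..b}" for t
  proof -
    have "A t * cd t = Y t \<and> C t * cd t = - p * (\<alpha> + \<beta> * cosV t)"
    proof (cases "t = a \<or> t = b")
      case True
      then have z: "A t = 0" "Y t = 0" "C t \<noteq> 0" using A_ends Ca Cb unfolding Y_def by auto
      then show ?thesis unfolding cd_def by (simp add: power2_eq_square)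
    next
      case False
      then have "a < t" "t < b" using t by auto
      then show ?thesis using inner[of t] by simp
    qed
    then show "A t * cd t = Y t" "C t * cd t = - p * (\<alpha> + \<beta> * cosV t)" by auto
  qed
  have second: "A t * cdd t - B t * cd t = - (p * \<alpha> + (p\<^sup>2 + p * \<beta>) * cosV t)" if t: "t \<in> {a..b}" for t
  proof -
    have "((\<lambda>t. A t * cd t) has_real_derivative Ad t * cd t + cdd t * A t) (at t within {a..b})"
      by (rule DERIV_mult[OF A_deriv[OF t] cdd[OF t]])
    then have "(Y has_real_derivative Ad t * cd t + cdd t * A t) (at t within {a..b})"
      by (rule has_field_derivative_transform_within[where d = 1]) (use AY t in auto)
    then have "Ad t * cd t + cdd t * A t = Yd t"
      using DY[OF t] vector_derivative_unique_within_closed_interval[OF ab] t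
      by (metis cbox_interval has_real_derivative_iff_has_vector_derivative)
    then have "A t * cdd t - B t * cd t = - (p\<^sup>2) * cosV t + C t * cd t"
      unfolding Yd_def C_def by (simp add: algebra_simps)
    then show ?thesis unfolding Ccd[OF t] by (simp add: algebra_simps)
  qed
  show thesis
    by (rule that[of I cd cdd \<alpha> z])
      (use raw Cb smooth_both Dc cdd sq second nz trace cots w0 in \<open>auto simp: p_def \<beta>_def\<close>)
qed

end

section \<open>Radial polynomials and their eigenvalues\<close>

text \<open>By the Weierstrass theorem the polynomials in \<open>cos (p v)\<close> are dense in the continuous functions on
\<open>{0..d}\<close>, because \<open>cos (p v)\<close> is a coordinate on that interval.\<close>

lemma zero_if_orthogonal_to_cosine_polynomials:
  fixes u :: "real \<Rightarrow> real"
  assumes p: "p > 0" "p * d = pi" and u: "continuous_on {0..d} u"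
    and orth: "\<And>q. integral {0..d} (\<lambda>v. u v * poly q (cos (p * v))) = 0"
    and v: "v \<in> {0..d}"
  shows "u v = 0"
proof -
  have "p * d > 0" using p(2) by simp
  then have d: "d > 0" using p(1) by (simp add: zero_less_mult_iff)
  have pv: "0 \<le> p * v" "p * v \<le> pi" if "v \<in> {0..d}" for v
    using that p mult_left_mono[of v d p] by auto
  have arc: "arccos (cos (p * v)) / p = v" if "v \<in> {0..d}" for v
    using pv[OF that] p(1) by (simp add: arccos_cos)
  define w where "w y = u (arccos y / p)" for y
  have ca: "continuous_on {-1..1} (\<lambda>y. arccos y / p)" using p(1) by (intro continuous_intros) auto
  have ra: "arccos y / p \<in> {0..d}" if "y \<in> {-1..1}" for y
  proof -
    have "0 \<le> arccos y" "arccos y \<le> p * d" using that arccos_lbound[of y] arccos_ubound[of y] p(2) by auto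
    then show ?thesis using p(1) by (simp add: field_simps)
  qed
  have contw: "continuous_on {-1..1} w"
    unfolding w_def by (rule continuous_on_compose2[OF u ca]) (use ra in blast)
  obtain M where M: "\<And>v. v \<in> {0..d} \<Longrightarrow> \<bar>u v\<bar> \<le> M" "M \<ge> 0"
  proof -
    have "bounded (u ` {0..d})" by (intro compact_imp_bounded compact_continuous_image u) auto
    then obtain M where "\<forall>v\<in>{0..d}. \<bar>u v\<bar> \<le> M" unfolding bounded_iff by auto
    then show thesis using that[of "max M 0"] by fastforce
  qed
  have bound: "integral {0..d} (\<lambda>v. (u v)\<^sup>2) \<le> e * (M * d)" if e: "e > 0" for e
  proof -
    obtain h where h: "real_polynomial_function h" "\<And>y. y \<in> {-1..1} \<Longrightarrow> \<bar>w y - h y\<bar> < e"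
      using Stone_Weierstrass_real_polynomial_function[OF _ contw e] by auto
    then obtain c n where "h = (\<lambda>x. \<Sum>i\<le>n. c i * x ^ i)" using real_polynomial_function_iff_sum by blast
    then have hq: "h y = poly (\<Sum>i\<le>n. monom (c i) i) y" for y by (simp add: poly_sum poly_monom)
    define q where "q = (\<Sum>i\<le>n. monom (c i) i)"
    have cq: "continuous_on {0..d} (\<lambda>v. u v * poly q (cos (p * v)))" by (intro continuous_intros u)
    have "integral {0..d} (\<lambda>v. (u v)\<^sup>2)
        = integral {0..d} (\<lambda>v. (u v)\<^sup>2) - integral {0..d} (\<lambda>v. u v * poly q (cos (p * v)))"
      using orth by simp
    also have "\<dots> = integral {0..d} (\<lambda>v. (u v)\<^sup>2 - u v * poly q (cos (p * v)))"
      by (rule Henstock_Kurzweil_Integration.integral_diff[symmetric])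
        (intro integrable_continuous_interval continuous_intros u cq)+
    also have "\<dots> \<le> integral {0..d} (\<lambda>v. M * e)"
    proof (rule integral_le)
      show "(\<lambda>v. (u v)\<^sup>2 - u v * poly q (cos (p * v))) integrable_on {0..d}"
        by (intro integrable_continuous_interval continuous_intros u cq)
      show "(\<lambda>v. M * e) integrable_on {0..d}" by (intro integrable_continuous_interval continuous_intros)
      fix v assume v: "v \<in> {0..d}"
      have "cos (p * v) \<in> {-1..1}" by simp
      then have "\<bar>w (cos (p * v)) - poly q (cos (p * v))\<bar> < e" using h(2) hq unfolding q_def by metis
      then have "\<bar>u v - poly q (cos (p * v))\<bar> \<le> e" unfolding w_def arc[OF v] by simp
      then have "\<bar>u v\<bar> * \<bar>u v - poly q (cos (p * v))\<bar> \<le> M * e"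
        using M(1)[OF v] M(2) by (intro mult_mono) auto
      then have "u v * (u v - poly q (cos (p * v))) \<le> M * e" by (metis abs_ge_self abs_mult order_trans)
      then show "(u v)\<^sup>2 - u v * poly q (cos (p * v)) \<le> M * e" by (simp add: power2_eq_square right_diff_distrib)
    qed
    also have "\<dots> = e * (M * d)" using d by simp
    finally show ?thesis .
  qed
  have "integral {0..d} (\<lambda>v. (u v)\<^sup>2) \<le> 0"
  proof (rule field_le_epsilon)
    fix e :: real assume e: "e > 0"
    have Md: "M * d \<ge> 0" using M(2) d by simp
    have "integral {0..d} (\<lambda>v. (u v)\<^sup>2) \<le> (e / (M * d + 1)) * (M * d)" using e Md by (intro bound) simp
    also have "\<dots> \<le> 0 + e" using e Md by (simp add: field_simps)
    finally show "integral {0..d} (\<lambda>v. (u v)\<^sup>2) \<le> 0 + e" .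
  qed
  moreover have c2: "continuous_on {0..d} (\<lambda>v. (u v)\<^sup>2)" by (intro continuous_intros u)
  then have "integral {0..d} (\<lambda>v. (u v)\<^sup>2) \<ge> 0" by (intro integral_nonneg integrable_continuous_interval) auto
  ultimately have "integral {0..d} (\<lambda>v. (u v)\<^sup>2) = 0" by simp
  then have "(u v)\<^sup>2 = 0" using integral_eq_0_iff[OF c2 d] v by auto
  then show ?thesis by simp
qed

context proper_isoparametric_foliation
begin

lemma radial_polynomial_smooth:
  assumes "\<And>k. Ck_on k {a..b} cosV"
  shows "smooth usphere (\<lambda>x. poly q (cosV (F x)))"
  unfolding smooth_def
proof
  fix x :: 'a assume x: "x \<in> usphere"
  let ?h = "\<lambda>y. poly q (cosV (hom_ext F y))"
  have "hom_ext F ` (- {0}) \<subseteq> {a..b}"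
  proof
    fix t assume "t \<in> hom_ext F ` (- {0})"
    then obtain y where "y \<noteq> 0" "t = F (sgn y)" unfolding hom_ext_def by auto
    then show "t \<in> {a..b}" using F_range[OF sgn_on_usphere(2)] by metis
  qed
  then have "Ck_on k (- {0}) ?h" for k
    by (intro Ck_on_poly Ck_on_compose[OF assms Ck_on_hom_ext[OF smooth_F]])
  then have "smooth_open (- {0}) ?h"
    unfolding smooth_open_def using Ck_open_iff_Ck_on[OF open_minus_zero] open_minus_zero by blast
  moreover have "\<forall>y\<in>usphere \<inter> - {0}. poly q (cosV (F y)) = ?h y" by (simp add: hom_ext_on_usphere)
  moreover have "x \<in> - {0}" using x by auto
  ultimately show "\<exists>U h. x \<in> U \<and> smooth_open U h \<and> (\<forall>y\<in>usphere \<inter> U. poly q (cosV (F y)) = h y)"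
    by (intro exI[of _ "- {0}"] exI[of _ ?h] conjI)
qed

text \<open>Below the level \<open>b\<close> the distance equals \<open>V (F x)\<close>, and on it the distance is at least \<open>D\<close>, so that
truncation at \<open>D\<close> recovers \<open>V (F x)\<close> everywhere.\<close>

lemma radial_polynomial_radial: "radial a F (\<lambda>x. poly q (cosV (F x)))"
  unfolding radial_def
proof (intro exI ballI)
  fix x :: 'a assume x: "x \<in> usphere"
  have "min (sdist_set x (level_set F a)) D = V (F x)"
  proof (cases "F x < b")
    case True
    then have "sdist_set x (level_set F a) = V (F x)" "V (F x) \<le> D"
      using sdist_set_eq_V[OF x] V_range[OF F_range[OF x]] by auto
    then show ?thesis by simp
  next
    case False
    then have "V (F x) = D" using F_range[OF x] V_ends by simp
    then show ?thesis using V_le_sdist_set[OF x] by simp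
  qed
  then show "poly q (cosV (F x)) = (\<lambda>r. poly q (cos (real g * min r D))) (sdist_set x (level_set F a))"
    unfolding cosV_def by simp
qed

lemma polynomial_eigenvalue:
  "real g * real k * (real g * real k + real (DIM('a) - 2)) \<in> radial_spectrum a F"
proof -
  obtain \<alpha> cd cdd where g: "g > 0" and gD: "real g * D = pi" and sm: "\<And>k. Ck_on k {a..b} cosV"
    and dc: "\<And>t. t \<in> {a..b} \<Longrightarrow> (cosV has_real_derivative cd t) (at t within {a..b})"
    and dcd: "\<And>t. t \<in> {a..b} \<Longrightarrow> (cd has_real_derivative cdd t) (at t within {a..b})"
    and first: "\<And>t. t \<in> {a..b} \<Longrightarrow> A t * (cd t)\<^sup>2 = (real g)\<^sup>2 * (1 - (cosV t)\<^sup>2)"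
    and second: "\<And>t. t \<in> {a..b} \<Longrightarrow> A t * cdd t - B t * cd t
        = - (real g * \<alpha> + ((real g)\<^sup>2 + real g * real (DIM('a) - 2)) * cosV t)"
    by (rule cosV_structure) (rule that)
  define \<mu> where "\<mu> = real g * real k * (real g * real k + real (DIM('a) - 2))"
  obtain q where q: "q \<noteq> 0" "jacobi_op (real g) \<alpha> (real (DIM('a) - 2)) q = smult (- \<mu>) q"
    using jacobi_eigenpolynomial[of "real g" "real (DIM('a) - 2)" \<alpha> k] g unfolding \<mu>_def by auto
  define f where "f x = poly q (cosV (F x))" for x
  have lap: "laplacian f x = \<mu> * f x" if x: "x \<in> usphere" for x
  proof -
    let ?t = "F x"
    have t: "?t \<in> {a..b}" by (rule F_range[OF x])
    define yd where "yd t = poly (pderiv q) (cosV t) * cd t" for t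
    have dpoly: "((\<lambda>t. poly r (cosV t)) has_real_derivative poly (pderiv r) (cosV t) * cd t) (at t within {a..b})"
      if "t \<in> {a..b}" for r t
      by (rule DERIV_chain2[OF poly_DERIV dc[OF that]])
    have dyd: "(yd has_real_derivative (poly (pderiv (pderiv q)) (cosV ?t) * cd ?t) * cd ?t + cdd ?t * poly (pderiv q) (cosV ?t)) (at ?t within {a..b})"
      unfolding yd_def[abs_def] by (rule DERIV_mult[OF dpoly[OF t] dcd[OF t]])
    have "laplacian f x = yd ?t * laplacian F x
        - ((poly (pderiv (pderiv q)) (cosV ?t) * cd ?t) * cd ?t + cdd ?t * poly (pderiv q) (cosV ?t)) * (norm (sgrad F x))\<^sup>2"
      by (rule laplacian_compose[OF smooth_F F_range x open_UNIV UNIV_I _ dyd])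
        (use dpoly in \<open>auto simp: yd_def f_def\<close>)
    also have "\<dots> = - (poly (pderiv (pderiv q)) (cosV ?t) * (A ?t * (cd ?t)\<^sup>2)
        + poly (pderiv q) (cosV ?t) * (A ?t * cdd ?t - B ?t * cd ?t))"
      unfolding norm_sgrad[OF x] laplacian_F[OF x] yd_def by (simp add: power2_eq_square algebra_simps)
    also have "\<dots> = - poly (jacobi_op (real g) \<alpha> (real (DIM('a) - 2)) q) (cosV ?t)"
      unfolding first[OF t] second[OF t] jacobi_op_def by (simp add: power2_eq_square algebra_simps)
    also have "\<dots> = \<mu> * f x" unfolding q(2) f_def by simp
    finally show ?thesis .
  qed
  have "\<exists>x\<in>usphere. f x \<noteq> 0"
  proof (rule ccontr)
    assume "\<not> (\<exists>x\<in>usphere. f x \<noteq> 0)"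
    then have z: "f x = 0" if "x \<in> usphere" for x using that by blast
    have "cosV ` {a..b} \<subseteq> {y. poly q y = 0}"
    proof
      fix y assume "y \<in> cosV ` {a..b}"
      then obtain x where "x \<in> usphere" "y = cosV (F x)" using range_F by (metis imageE)
      then show "y \<in> {y. poly q y = 0}" using z unfolding f_def by auto
    qed
    then have fin: "finite (cosV ` {a..b})" using poly_roots_finite[OF q(1)] finite_subset by blast
    have "connected (cosV ` {a..b})"
      using Ck_on_continuous[OF sm] by (intro connected_continuous_image) auto
    then obtain c where c: "cosV ` {a..b} \<subseteq> {c}"
      using fin connected_finite_iff_sing by (metis subset_singleton_iff)
    have "cosV a = c" "cosV b = c" using c ab by (auto simp: image_subset_iff)
    moreover have "cosV a = 1" "cosV b = - 1" unfolding cosV_def V_ends using gD by simp_all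
    ultimately show False by simp
  qed
  then show ?thesis
    unfolding radial_spectrum_def eigenfunction_def \<mu>_def[symmetric]
    using lap radial_polynomial_smooth[OF sm, of q] radial_polynomial_radial[of q]
    unfolding f_def by blast
qed

end

section \<open>Every radial eigenvalue is of the stated form\<close>

context proper_isoparametric_foliation
begin

definition base_geodesic :: "real \<Rightarrow> 'a" where
  "base_geodesic v = great_circle base_point (nrm base_point) (v + base_start)"

lemma F_base_geodesic: "F (base_geodesic v) = profile v"
  unfolding base_geodesic_def profile_def ..

lemma base_geodesic_in_usphere: "base_geodesic v \<in> usphere"
  unfolding base_geodesic_def using great_circle_in_usphere(1) regularD[OF regular_base] by blast

text \<open>Two points of the same level below \<open>b\<close> have the same distance from the level \<open>a\<close>.\<close>

lemma radial_factors:
  assumes f: "radial a F f" and x: "x \<in> usphere" "F x < b"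
  shows "f x = f (base_geodesic (V (F x)))"
proof -
  obtain \<psi> :: "real \<Rightarrow> real" where \<psi>: "\<And>x. x \<in> usphere \<Longrightarrow> f x = \<psi> (sdist_set x (level_set F a))"
    using f unfolding radial_def by blast
  have "F (base_geodesic (V (F x))) = F x" unfolding F_base_geodesic by (rule profile_V[OF F_range[OF x(1)]])
  then show ?thesis
    using \<psi>[OF x(1)] \<psi>[OF base_geodesic_in_usphere] sdist_set_eq_V[OF x] sdist_set_eq_V[OF base_geodesic_in_usphere] x(2)
    by simp
qed

lemma smooth_along_base_geodesic:
  assumes "smooth usphere f"
  obtains \<eta>d \<eta>dd where "\<And>v. ((\<lambda>v. f (base_geodesic v)) has_real_derivative \<eta>d v) (at v)"
    "\<And>v. (\<eta>d has_real_derivative \<eta>dd v) (at v)"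
proof -
  note R = regularD[OF regular_base]
  have "((\<lambda>v. v + base_start) has_real_derivative 1) (at v)" for v by (auto intro!: derivative_eq_intros)
  note D1 = DERIV_chain2[OF smooth_along_great_circle(1)[OF assms R(2,8,9)] this]
    and D2 = DERIV_chain2[OF smooth_along_great_circle(2)[OF assms R(2,8,9)] this]
  show thesis
    by (rule that[unfolded base_geodesic_def, OF D1[unfolded mult_1_right] D2[unfolded mult_1_right]])
qed

lemma radial_eigenfunction_ode:
  assumes f: "smooth usphere f" "\<And>x. x \<in> usphere \<Longrightarrow> laplacian f x = \<mu> * f x" "radial a F f"
    and d: "\<And>v. ((\<lambda>v. f (base_geodesic v)) has_real_derivative \<eta>d v) (at v)"
      "\<And>v. (\<eta>d has_real_derivative \<eta>dd v) (at v)"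
    and v: "v \<in> {0<..<D}" and h: "profile_d v * h = C (profile v)"
  shows "\<eta>dd v + h * \<eta>d v = - \<mu> * f (base_geodesic v)"
proof -
  define x where "x = base_geodesic v"
  have x: "x \<in> usphere" unfolding x_def by (rule base_geodesic_in_usphere)
  have Fx: "F x = profile v" unfolding x_def by (rule F_base_geodesic)
  have t: "a < F x" "F x < b" using profile_inside[of v] v unfolding Fx by auto
  have Vx: "V (F x) = v" unfolding Fx using V_profile[of v] v by simp
  have A: "A (F x) > 0" using A_pos t by blast
  define yd where "yd t = \<eta>d (V t) * (1 / sqrt (A t))" for t
  have dy: "((\<lambda>t. f (base_geodesic (V t))) has_real_derivative yd t) (at t within {a..b})" if "t \<in> {a<..<b} \<inter> {a..b}" for t
    unfolding yd_def by (rule has_field_derivative_at_within[OF DERIV_chain2[OF d(1) V_deriv]]) (use that in auto)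
  have dA: "(A has_real_derivative Ad (F x)) (at (F x))"
    using A_deriv[of "F x"] t at_within_Icc_at[OF t] by auto
  have "((\<lambda>t. sqrt (A t)) has_real_derivative inverse (sqrt (A (F x))) / 2 * Ad (F x)) (at (F x))"
    by (rule DERIV_chain2[OF DERIV_real_sqrt[OF A] dA])
  from DERIV_divide[OF DERIV_const this, of 1]
  have ds: "((\<lambda>t. 1 / sqrt (A t)) has_real_derivative
      - (inverse (sqrt (A (F x))) / 2 * Ad (F x)) / (sqrt (A (F x)) * sqrt (A (F x)))) (at (F x))"
    using A by simp
  have dV: "((\<lambda>t. \<eta>d (V t)) has_real_derivative \<eta>dd v * (1 / sqrt (A (F x)))) (at (F x))"
    using DERIV_chain2[OF d(2) V_deriv[OF t]] unfolding Vx .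
  define ydd where "ydd = \<eta>dd v * (1 / sqrt (A (F x))) * (1 / sqrt (A (F x)))
      + - (inverse (sqrt (A (F x))) / 2 * Ad (F x)) / (sqrt (A (F x)) * sqrt (A (F x))) * \<eta>d v"
  have "(yd has_real_derivative ydd) (at (F x))"
    using DERIV_mult[OF dV ds] unfolding yd_def[abs_def] ydd_def Vx .
  then have dyd: "(yd has_real_derivative ydd) (at (F x) within {a..b})" by (rule has_field_derivative_at_within)
  have "laplacian f x = yd (F x) * laplacian F x - ydd * (norm (sgrad F x))\<^sup>2"
    by (rule laplacian_compose[OF smooth_F F_range x _ _ dy dyd, of "{a<..<b}"])
      (use t radial_factors[OF f(3)] in auto)
  then have L: "\<mu> * f x = yd (F x) * B (F x) - ydd * A (F x)"
    unfolding f(2)[OF x] laplacian_F[OF x] norm_sgrad[OF x] .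
  define r where "r = sqrt (A (F x))"
  have r: "r > 0" "A (F x) = r * r" unfolding r_def using A by auto
  have hr: "r * h = - B (F x) - Ad (F x) / 2"
    using h profile_inside(3)[of v] v unfolding C_def Fx[symmetric] r_def by simp
  have "\<mu> * f x = \<eta>d v * B (F x) / r - \<eta>dd v + Ad (F x) * \<eta>d v / (2 * r)"
    unfolding L yd_def Vx ydd_def r_def[symmetric] unfolding r(2) using r(1) by (simp add: field_simps)
  also have "\<dots> = - \<eta>dd v - \<eta>d v * (r * h) / r"
    unfolding hr using r(1) by (simp add: field_simps)
  also have "\<dots> = - \<eta>dd v - h * \<eta>d v" using r(1) by simp
  finally show ?thesis unfolding x_def by simp
qed

text \<open>On the level \<open>b\<close> the gradient vanishes. If the level contained a neighbourhood of \<open>x\<close> then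
\<open>\<Delta>F = B b = 0\<close>, which makes \<open>C b = - A'(b)/2\<close> positive.\<close>

lemma no_flat_maximum:
  assumes Cb: "C b < 0" and x: "x \<in> usphere" "F x = b"
    and d: "d > 0" "\<And>z. z \<in> usphere \<Longrightarrow> dist z x < d \<Longrightarrow> F z = b"
  shows False
proof -
  have "(sgrad F has_derivative (\<lambda>w. 0)) (at x within usphere)"
  proof (rule has_derivative_transform_within[OF _ d(1) x(1)])
    show "((\<lambda>z. 0) has_derivative (\<lambda>w. 0)) (at x within usphere)" by simp
    show "0 = sgrad F z" if "z \<in> usphere" "dist z x < d" for z
      using G_zero_at_extremum[OF that(1)] d(2)[OF that] sgrad_eq_egrad[OF smooth_F that(1)] by simp
  qed
  then have "laplacian F x = 0" by (simp add: laplacian_eq[OF x(1)])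
  then have "B b = 0" using laplacian_F[OF x(1)] x(2) by simp
  then show False using Cb Ad_ends unfolding C_def by simp
qed

text \<open>Let \<open>\<eta>\<close> be the eigenfunction along the base circle, and \<open>Q v = poly q (cos (g v))\<close>. The function
\<open>P (\<eta> Q' - \<eta>' Q)\<close> vanishes at \<open>0\<close> and \<open>D\<close>, and its derivative is \<open>P \<eta> (L Q + \<mu> Q)\<close>, where \<open>L\<close> is the
Jacobi operator. If \<open>- \<mu>\<close> is no diagonal entry of \<open>L\<close> then \<open>L + \<mu>\<close> is onto the polynomials, so
\<open>P \<eta>\<close> is orthogonal to all of them.\<close>

lemma radial_eigenvalue_form:
  assumes "\<mu> \<in> radial_spectrum a F"
  shows "\<exists>k. \<mu> = real g * real k * (real g * real k + real (DIM('a) - 2))"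
proof (rule ccontr)
  assume not: "\<not> ?thesis"
  obtain f where f: "smooth usphere f" "\<exists>x\<in>usphere. f x \<noteq> 0" "\<And>x. x \<in> usphere \<Longrightarrow> laplacian f x = \<mu> * f x"
    "radial a F f"
    using assms unfolding radial_spectrum_def eigenfunction_def by blast
  obtain \<alpha> and I :: "'a set" and z where raw: "g > 0" "real g * D = pi" "finite I"
    and Cb: "C b < 0"
    and nz: "\<And>v i. v \<in> {0<..<D} \<Longrightarrow> i \<in> I \<Longrightarrow> sin (v - z i) \<noteq> 0"
    and trace: "\<And>v. v \<in> {0<..<D} \<Longrightarrow> profile_d v * (\<Sum>i\<in>I. cot (v - z i)) = C (profile v)"
    and raw_cots: "\<And>v. v \<in> {0<..<D} \<Longrightarrow>
       (\<Sum>i\<in>I. cot (v - z i)) * sin (real g * v) = \<alpha> + real (DIM('a) - 2) * cos (real g * v)"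
    and w0: "sin_prod I z (0::real) = 0" "sin_prod I z D = 0"
    by (rule cosV_structure) (rule that)
  define p where "p = real g"
  define \<beta> where "\<beta> = real (DIM('a) - 2)"
  note cots = raw_cots[folded p_def \<beta>_def] and pD = raw(2)[folded p_def]
  have p: "p > 0" using raw(1) unfolding p_def by simp
  define P where "P = (sin_prod I z :: real \<Rightarrow> real)"
  define h where "h v = (\<Sum>i\<in>I. cot (v - z i))" for v
  have dP: "(P has_real_derivative sin_prod' I z v) (at v)" for v unfolding P_def by (rule sin_prod_deriv[OF raw(3)])
  have hP: "sin_prod' I z v = h v * P v" if "v \<in> {0<..<D}" for v
    unfolding P_def h_def by (rule sin_prod'_eq[OF raw(3) nz[OF that]])
  define \<eta> where "\<eta> v = f (base_geodesic v)" for v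
  obtain \<eta>d \<eta>dd where d0: "\<And>v. ((\<lambda>v. f (base_geodesic v)) has_real_derivative \<eta>d v) (at v)"
    and d\<eta>d: "\<And>v. (\<eta>d has_real_derivative \<eta>dd v) (at v)"
    by (rule smooth_along_base_geodesic[OF f(1)]) (rule that)
  have d\<eta>: "(\<eta> has_real_derivative \<eta>d v) (at v)" for v unfolding \<eta>_def[abs_def] by (rule d0)
  have ode: "\<eta>dd v = - h v * \<eta>d v - \<mu> * \<eta> v" if v: "v \<in> {0<..<D}" for v
    using radial_eigenfunction_ode[OF f(1,3,4) d0 d\<eta>d v trace[OF v]] unfolding \<eta>_def h_def by simp
  have cont: "continuous_on {0..D} \<eta>" "continuous_on {0..D} P"
    by (rule DERIV_continuous_on[OF has_field_derivative_at_within[OF d\<eta>]],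
        rule DERIV_continuous_on[OF has_field_derivative_at_within[OF dP]])
  have orth: "integral {0..D} (\<lambda>v. (P v * \<eta> v) * poly (jacobi_op p \<alpha> \<beta> q + smult \<mu> q) (cos (p * v))) = 0" for q
  proof -
    define Q where "Q v = poly q (cos (p * v))" for v
    define Qd where "Qd v = poly (pderiv q) (cos (p * v)) * (- p * sin (p * v))" for v
    define Qdd where "Qdd v = poly (pderiv (pderiv q)) (cos (p * v)) * (- p * sin (p * v)) * (- p * sin (p * v))
        + - (p\<^sup>2) * cos (p * v) * poly (pderiv q) (cos (p * v))" for v
    have dc: "((\<lambda>v. cos (p * v)) has_real_derivative - p * sin (p * v)) (at v)" for v
      by (auto intro!: derivative_eq_intros)
    have ds: "((\<lambda>v. - p * sin (p * v)) has_real_derivative - (p\<^sup>2) * cos (p * v)) (at v)" for v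
      by (auto intro!: derivative_eq_intros simp: power2_eq_square)
    have dQ: "(Q has_real_derivative Qd v) (at v)" for v
      unfolding Q_def[abs_def] Qd_def by (rule DERIV_chain2[OF poly_DERIV dc])
    have dQd: "(Qd has_real_derivative Qdd v) (at v)" for v
      unfolding Qd_def[abs_def] Qdd_def by (rule DERIV_mult[OF DERIV_chain2[OF poly_DERIV dc] ds])
    have LQ: "Qdd v + h v * Qd v = poly (jacobi_op p \<alpha> \<beta> q) (cos (p * v))" if v: "v \<in> {0<..<D}" for v
    proof -
      have "h v * Qd v = - p * poly (pderiv q) (cos (p * v)) * (\<alpha> + \<beta> * cos (p * v))"
        unfolding Qd_def cots[OF v, folded h_def, symmetric] by simp
      moreover have "sin (p * v) * sin (p * v) = 1 - cos (p * v) * cos (p * v)"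
        using sin_squared_eq[of "p * v"] by (simp add: power2_eq_square)
      then have "Qdd v = poly (pderiv (pderiv q)) (cos (p * v)) * (p\<^sup>2 * (1 - cos (p * v) * cos (p * v)))
          - p\<^sup>2 * cos (p * v) * poly (pderiv q) (cos (p * v))"
        unfolding Qdd_def by (simp add: power2_eq_square)
      ultimately show ?thesis unfolding jacobi_op_def by (simp add: power2_eq_square algebra_simps)
    qed
    define S where "S v = P v * (\<eta> v * Qd v - \<eta>d v * Q v)" for v
    have dS: "(S has_real_derivative (P v * \<eta> v) * poly (jacobi_op p \<alpha> \<beta> q + smult \<mu> q) (cos (p * v))) (at v)"
      if v: "v \<in> {0<..<D}" for v
    proof -
      have "(S has_real_derivative sin_prod' I z v * (\<eta> v * Qd v - \<eta>d v * Q v)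
          + ((\<eta>d v * Qd v + Qdd v * \<eta> v) - (\<eta>dd v * Q v + Qd v * \<eta>d v)) * P v) (at v)"
        unfolding S_def[abs_def] by (intro DERIV_mult DERIV_diff dP d\<eta> d\<eta>d dQ dQd)
      moreover have "sin_prod' I z v * (\<eta> v * Qd v - \<eta>d v * Q v)
          + ((\<eta>d v * Qd v + Qdd v * \<eta> v) - (\<eta>dd v * Q v + Qd v * \<eta>d v)) * P v
        = (P v * \<eta> v) * ((Qdd v + h v * Qd v) + \<mu> * Q v)"
        unfolding hP[OF v] ode[OF v] by (simp add: algebra_simps)
      ultimately show ?thesis unfolding LQ[OF v] by (simp add: Q_def)
    qed
    have "((\<lambda>v. (P v * \<eta> v) * poly (jacobi_op p \<alpha> \<beta> q + smult \<mu> q) (cos (p * v))) has_integral (S D - S 0)) {0..D}"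
    proof (rule fundamental_theorem_of_calculus_interior)
      show "continuous_on {0..D} S"
        unfolding S_def[abs_def]
        by (intro continuous_intros cont DERIV_continuous_on[OF has_field_derivative_at_within[OF d\<eta>d]]
            DERIV_continuous_on[OF has_field_derivative_at_within[OF dQ]] DERIV_continuous_on[OF has_field_derivative_at_within[OF dQd]])
    qed (use D_pos dS in \<open>auto simp: has_real_derivative_iff_has_vector_derivative\<close>)
    moreover have "S D = 0" "S 0 = 0" unfolding S_def P_def w0 by simp_all
    ultimately show ?thesis by (simp add: integral_unique)
  qed
  have moments: "integral {0..D} (\<lambda>v. (P v * \<eta> v) * poly R (cos (p * v))) = 0" for R
  proof -
    have "\<And>i. i \<ge> Suc (degree R) \<Longrightarrow> coeff R i = 0" by (simp add: coeff_eq_0)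
    moreover have "\<mu> \<noteq> p * real j * (p * real j + \<beta>)" for j using not unfolding p_def \<beta>_def by blast
    ultimately obtain q where "jacobi_op p \<alpha> \<beta> q + smult \<mu> q = R"
      using jacobi_op_solvable[of "Suc (degree R)" \<mu> p \<beta> R \<alpha>] by blast
    then show ?thesis using orth by blast
  qed
  have prod0: "P v * \<eta> v = 0" if "v \<in> {0..D}" for v
    by (rule zero_if_orthogonal_to_cosine_polynomials[where u = "\<lambda>v. P v * \<eta> v", OF p pD _ moments that])
      (intro continuous_intros cont)
  have "P v \<noteq> 0" if "v \<in> {0<..<D}" for v
    using nz[OF that] raw(3) unfolding P_def sin_prod_def by simp
  then have "\<eta> v = 0" if "0 < v" "v < D" for v using prod0[of v] that by simp
  then have \<eta>0: "\<eta> v = 0" if "v \<in> {0..D}" for v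
    by (rule closed_interval_density[OF D_pos cont(1) _ that])
  have fz: "f x = 0" if "x \<in> usphere" "F x < b" for x
    using radial_factors[OF f(4) that] \<eta>0[OF V_range[OF F_range[OF that(1)]]] unfolding \<eta>_def by simp
  obtain x where x: "x \<in> usphere" "f x \<noteq> 0" using f(2) by blast
  have Fx: "F x = b" using fz[OF x(1)] x F_range[OF x(1)] by force
  have "continuous_on usphere f"
    using has_derivative_on_usphere[OF f(1)] has_derivative_continuous continuous_on_eq_continuous_within by blast
  then obtain d where d: "d > 0" "\<And>z. z \<in> usphere \<Longrightarrow> dist z x < d \<Longrightarrow> dist (f z) (f x) < \<bar>f x\<bar>"
    using x unfolding continuous_on_iff by (metis zero_less_abs_iff)
  have "F z = b" if z: "z \<in> usphere" "dist z x < d" for z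
  proof -
    have "f z \<noteq> 0" using d(2)[OF z] by (auto simp: dist_real_def)
    then show ?thesis using fz[OF z(1)] F_range[OF z(1)] by force
  qed
  then show False using no_flat_maximum[OF Cb x(1) Fx d(1)] by blast
qed

end

theorem theorem6:
  fixes F :: "'a::euclidean_space \<Rightarrow> real" and a b :: real and n g :: nat
  assumes "n \<ge> 2" and "DIM('a) = n + 1"
    and "proper_isoparametric a b F"
    and "num_principal_curvatures a b F g"
  shows "radial_spectrum a F =
    {real g * real k * (real g * real k + real n - 1) | k :: nat. True}"
proof -
  have iso: "isoparametric a b F" and codim: "codim_ge_2 (level_set F a)" "codim_ge_2 (level_set F b)"
    using assms(3) unfolding proper_isoparametric_def by auto
  obtain A B where AB: "a < b" "smooth usphere F" "F ` usphere = {a..b}" "smooth {a..b} A" "smooth {a..b} B"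
    "\<And>x. x \<in> usphere \<Longrightarrow> (norm (sgrad F x))\<^sup>2 = A (F x)" "\<And>x. x \<in> usphere \<Longrightarrow> laplacian F x = B (F x)"
    using iso unfolding isoparametric_def by blast
  obtain Ad where Ad: "smooth {a..b} Ad" "\<And>t. t \<in> {a..b} \<Longrightarrow> (A has_real_derivative Ad t) (at t within {a..b})"
    using smooth_interval_deriv[OF AB(1,4)] by blast
  interpret isoparametric_foliation F a b A Ad B
  proof
    show "DIM('a) \<ge> 3" using assms(1,2) by simp
  qed (fact AB Ad)+
  interpret proper_isoparametric_foliation F a b A Ad B g
  proof
    show "card (principal_curvatures F x) = g" if "regular x" for x
    proof -
      have "F x \<in> {a<..<b}" "x \<in> level_set F (F x)" using regularD[OF that] unfolding level_set_def by auto
      then show ?thesis using assms(4) unfolding num_principal_curvatures_def by blast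
    qed
  qed (fact codim)+
  have "real (DIM('a) - 2) = real n - 1" using assms(1,2) by simp
  then have eq: "real g * real k * (real g * real k + real (DIM('a) - 2))
      = real g * real k * (real g * real k + real n - 1)" for k by simp
  show ?thesis
    using polynomial_eigenvalue radial_eigenvalue_form unfolding eq by blast
qed

end
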